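(* Let $\gamma:[-1,1]\to\mathbb{R}^2$ be a $C^2$ curve of the form $$\gamma(t)=\gamma'(0)t+\frac{\gamma''(0)}{2}t^2+R(t),\qquad t\in(-1,1),$$ where $\gamma'(0),\gamma''(0)$ are linearly independent, $R\in C^2(-1,1)$ and $\lim_{|t|\to0}|R(t)|/|t|^2=0$. Let $H_\gamma f(x)=\int_{-1}^1 f(x-\gamma(t))\,\frac{dt}{t}$. Suppose $1<p<\infty$ and $\|[b,H_\gamma]\|_{L^p\to L^p}<\infty$. If (qualitative a priori assumption) $b\in\mathrm{BMO}_\gamma(\mathbb{R}^2)$, then $$\|b\|_{\mathrm{BMO}_\gamma(\mathbb{R}^2)}\le C\,\|[b,H_\gamma]\|_{L^p\to L^p},$$ where $C$ depends only on $\gamma$ and $p$ (in particular not on $b$).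
   Context: $b$ is a locally integrable function on $\mathbb{R}^2$ and $[b,H_\gamma]f:=bH_\gamma f-H_\gamma(bf)$; the integral defining $H_\gamma$ is understood in the principal value sense (at $t=0$), and $\|[b,H_\gamma]\|_{L^p\to L^p}$ is the least $N$ such that $\|[b,H_\gamma]f\|_{L^p(\mathbb{R}^2)}\le N\|f\|_{L^p(\mathbb{R}^2)}$ for all bounded compactly supported $f$. Let $e_1:=\gamma'(0)/|\gamma'(0)|$ and let $e_2:=c\left(\frac{\gamma''(0)}2-\left\langle\frac{\gamma''(0)}2,e_1\right\rangle e_1\right)$ with $c:=\left|\frac{\gamma''(0)}2-\left\langle\frac{\gamma''(0)}2,e_1\right\rangle e_1\right|^{-1}$, so $(e_1,e_2)$ is an orthonormal basis. Let $\mathcal{R}_\gamma$ be the collection of rectangles with sides parallel to $e_1,e_2$ such that, for some $\ell>0$, the side parallel to $e_j$ has length $\ell^j$, $j=1,2$; for such a rectangle $Q$ put $\ell(Q):=\ell$. With $\langle b\rangle_Q:=\frac1{|Q|}\int_Q b$, define $$\|b\|_{\mathrm{BMO}_\gamma(\mathbb{R}^2)}:=\sup_{Q\in\mathcal{R}_\gamma,\ \ell(Q)\le1}\frac1{|Q|}\int_Q|b-\langle b\rangle_Q|,$$ and $b\in\mathrm{BMO}_\gamma(\mathbb{R}^2)$ means that this quantity is finite. *)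

theory Defs
  imports "HOL-Analysis.Analysis"
begin

definition C2_on :: "real set \<Rightarrow> (real \<Rightarrow> 'a::real_normed_vector) \<Rightarrow> bool" where
  "C2_on S f \<longleftrightarrow>
     (\<exists>f' f''. (\<forall>t\<in>S. (f has_vector_derivative f' t) (at t within S)) \<and>
               (\<forall>t\<in>S. (f' has_vector_derivative f'' t) (at t within S)) \<and>
               continuous_on S f'')"

definition velocity :: "(real \<Rightarrow> real^2) \<Rightarrow> real^2" where
  "velocity \<gamma> = vector_derivative \<gamma> (at 0)"

definition acceleration :: "(real \<Rightarrow> real^2) \<Rightarrow> real^2" where
  "acceleration \<gamma> = vector_derivative (\<lambda>t. vector_derivative \<gamma> (at t)) (at 0)"

definition locally_integrable :: "(real^2 \<Rightarrow> complex) \<Rightarrow> bool" where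
  "locally_integrable b \<longleftrightarrow> (\<forall>K. compact K \<longrightarrow> set_integrable lebesgue K b)"

(* Principal value: symmetric truncation |t| > \<epsilon>, \<epsilon> \<rightarrow> 0+.  Where the limit does not exist,
   Lim returns an unspecified value. *)
definition curve_hilbert :: "(real \<Rightarrow> real^2) \<Rightarrow> (real^2 \<Rightarrow> complex) \<Rightarrow> real^2 \<Rightarrow> complex" where
  "curve_hilbert \<gamma> f x =
     Lim (at_right 0)
       (\<lambda>\<epsilon>::real. LINT t:{t. \<epsilon> < \<bar>t\<bar> \<and> \<bar>t\<bar> \<le> 1}|lebesgue. f (x - \<gamma> t) / complex_of_real t)"

definition curve_commutator ::
  "(real \<Rightarrow> real^2) \<Rightarrow> (real^2 \<Rightarrow> complex) \<Rightarrow> (real^2 \<Rightarrow> complex) \<Rightarrow> real^2 \<Rightarrow> complex" where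
  "curve_commutator \<gamma> b f x =
     b x * curve_hilbert \<gamma> f x - curve_hilbert \<gamma> (\<lambda>y. b y * f y) x"

definition Lp_norm :: "real \<Rightarrow> (real^2 \<Rightarrow> complex) \<Rightarrow> ennreal" where
  "Lp_norm p f =
     (let I = \<integral>\<^sup>+ x. ennreal (norm (f x) powr p) \<partial>lebesgue
      in if I = \<infinity> then \<infinity> else ennreal (enn2real I powr (1 / p)))"

definition bounded_compactly_supported :: "(real^2 \<Rightarrow> complex) \<Rightarrow> bool" where
  "bounded_compactly_supported f \<longleftrightarrow>
     f \<in> borel_measurable lebesgue \<and> bounded (range f) \<and> compact (closure {x. f x \<noteq> 0})"

(* The infimum is taken in [0,\<infinity>], so the norm is \<infinity> iff no finite N is admissible.
   The bound does not ask separately that the principal values exist a.e.: for locally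
   integrable b of finite BMO norm they do, and in general this only admits more symbols b. *)
definition commutator_norm ::
  "(real \<Rightarrow> real^2) \<Rightarrow> real \<Rightarrow> (real^2 \<Rightarrow> complex) \<Rightarrow> ennreal" where
  "commutator_norm \<gamma> p b =
     Inf {N. \<forall>f. bounded_compactly_supported f \<longrightarrow>
                 Lp_norm p (curve_commutator \<gamma> b f) \<le> N * Lp_norm p f}"

definition frame1 :: "(real \<Rightarrow> real^2) \<Rightarrow> real^2" where
  "frame1 \<gamma> = velocity \<gamma> /\<^sub>R norm (velocity \<gamma>)"

definition frame2 :: "(real \<Rightarrow> real^2) \<Rightarrow> real^2" where
  "frame2 \<gamma> =
     (let a = acceleration \<gamma> /\<^sub>R 2;
          v = a - (a \<bullet> frame1 \<gamma>) *\<^sub>R frame1 \<gamma>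
      in inverse (norm v) *\<^sub>R v)"

(* Closed rectangle with corner a; whether boundaries are included does not affect
   any of the averages below. *)
definition curve_rectangle :: "(real \<Rightarrow> real^2) \<Rightarrow> real^2 \<Rightarrow> real \<Rightarrow> (real^2) set" where
  "curve_rectangle \<gamma> a l =
     {a + s *\<^sub>R frame1 \<gamma> + u *\<^sub>R frame2 \<gamma> | s u. 0 \<le> s \<and> s \<le> l \<and> 0 \<le> u \<and> u \<le> l\<^sup>2}"

definition average :: "(real^2) set \<Rightarrow> (real^2 \<Rightarrow> complex) \<Rightarrow> complex" where
  "average Q b = (LINT x:Q|lebesgue. b x) /\<^sub>R measure lebesgue Q"

definition mean_oscillation :: "(real^2) set \<Rightarrow> (real^2 \<Rightarrow> complex) \<Rightarrow> ennreal" where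
  "mean_oscillation Q b =
     (\<integral>\<^sup>+ x \<in> Q. ennreal (norm (b x - average Q b)) \<partial>lebesgue) / emeasure lebesgue Q"

definition BMO_norm :: "(real \<Rightarrow> real^2) \<Rightarrow> (real^2 \<Rightarrow> complex) \<Rightarrow> ennreal" where
  "BMO_norm \<gamma> b =
     (SUP Q \<in> {curve_rectangle \<gamma> a l | a l. 0 < l \<and> l \<le> 1}. mean_oscillation Q b)"

end

theory Submission
  imports Defs
begin

text \<open>
Let X and Y be the coordinates of the plane along e1 and e2. Near \<open>t = 0\<close> the curve is, up to relative
errors that tend to 0 with t, the parabola \<open>(\<alpha> t, \<beta> t\<^sup>2)\<close>. The proof is an approximate factorization of
the oscillation of b through the commutator, which on the parabola itself would be exact.

Let Q be a rectangle of size l, R a translate of Q far enough below it, and P a suitable rectangle to the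
left. A point x of Q and a point z of R are joined by exactly one path of two steps
\<open>y = x - \<gamma> t\<close>, \<open>z = y - \<gamma> s\<close> with s negative, t positive and y in P (lemmas \<open>inj_two_points\<close>,
\<open>two_step_surj\<close>). Let \<open>w s t\<close> be the determinant of \<open>\<gamma>' s\<close> and \<open>\<gamma>' t\<close>. Changing variables from \<open>(s, t)\<close>
to z, the integral of \<open>(b x - b z) w\<close> over all these paths is the integral of \<open>b x - b z\<close> over R,
that is, the measure of R times \<open>b x - bR\<close> with the average \<open>bR\<close> of b over R (lemma \<open>integral_S\<close>).

Testing the commutator with a function f controls integrals of \<open>(b x - b y) f y / t\<close> over single
steps (lemma \<open>testing\<close>); factors that depend on t in another way are not directly available. But the
horizontal component of a step is the difference of the coordinates of its ends, so powers of it can be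
distributed over the two ends (lemma \<open>curve_diff_Suc\<close>). On the parabola the Jacobian w is \<open>1 / (t s)\<close> times a
cubic polynomial in the horizontal components of the two steps; on \<open>\<gamma>\<close> this holds with a relative error of
size \<open>\<epsilon>\<close> (lemma \<open>weight_compare\<close>). After w has been replaced by this product, the splitting
\<open>b x - b z = (b x - b y) + (b y - b z)\<close> leaves two terms, each an integrated commutator (lemma \<open>\<Theta>_split\<close>).

Two errors remain. One is the exchange of the weights. The other is that \<open>\<gamma>\<close> may return close to the origin at
parameters far from 0; the set of those parameters has small measure when l is small (lemma
\<open>far_returns_vanish\<close>). Both cost \<open>\<epsilon>\<close> times the oscillation of b on a larger rectangle, of size K l with K
independent of \<open>\<epsilon>\<close> (lemma \<open>one_scale_estimate\<close>). The larger rectangle is covered by boundedly many of size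
l (lemma \<open>osc_le_spread\<close>), so for small \<open>\<epsilon>\<close> any bound on the oscillation at small scales improves to half of
itself plus a multiple of the commutator norm. As some finite bound is given, iteration removes it (lemma
\<open>osc_le_a_priori_removed\<close>). Scales up to 1 follow by covering.

Principal values cause no trouble: points of Q and of P are separated, so the integrals converge absolutely
for almost every base point. For almost every base point, too, the translated curve meets a given null set
only at a null set of parameters, so b may be assumed to be a Borel function.
\<close>

section \<open>Rectangles and a two-parameter change of variables\<close>

definition cross2 :: "real^2 \<Rightarrow> real^2 \<Rightarrow> real" where
  "cross2 v w = v $ 1 * w $ 2 - v $ 2 * w $ 1"

abbreviation L1_on :: "(real^2) set \<Rightarrow> (real^2 \<Rightarrow> complex) \<Rightarrow> ennreal" where
  "L1_on A f \<equiv> (\<integral>\<^sup>+ x. ennreal (norm (f x)) * indicator A x \<partial>lborel)"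

text \<open>
Away from t = 0 the curve may come back close to the origin; these are the parameters at
which it does so. Parameters with \<open>\<gamma> t = 0\<close> are left out: only then does the measure of this set tend
to 0 with \<open>\<rho>\<close> for every continuous curve (one that rests at the origin for a while included), and
they never link two points of disjoint rectangles.
\<close>

abbreviation far_returns :: "(real \<Rightarrow> real^2) \<Rightarrow> real \<Rightarrow> real \<Rightarrow> real set" where
  "far_returns \<gamma> r \<rho> \<equiv> {t. r < \<bar>t\<bar> \<and> \<bar>t\<bar> \<le> 1 \<and> 0 < norm (\<gamma> t) \<and> norm (\<gamma> t) \<le> \<rho>}"

lemma cross2_alt:
  "cross2 v w = (v \<bullet> axis 1 1) * (w \<bullet> axis 2 1) - (v \<bullet> axis 2 1) * (w \<bullet> axis 1 1)"
  by (simp add: cross2_def inner_axis)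

lemma inner2: "(x::real^2) \<bullet> y = x $ 1 * y $ 1 + x $ 2 * y $ 2"
  by (simp add: inner_vec_def sum_2)

text \<open>
Tonelli and Fubini act on \<open>real \<times> real\<close>, the change of variables theorem on \<open>real^2\<close>; the
standard identification of the two carries one Lebesgue measure to the other.
\<close>

lemma distr_lborel_plane:
  "distr (lborel :: (real \<times> real) measure) borel (\<lambda>p. fst p *\<^sub>R axis 1 1 + snd p *\<^sub>R axis 2 1)
     = (lborel :: (real^2) measure)"
proof (rule lborel_eqI[symmetric])
  define \<iota> :: "real \<times> real \<Rightarrow> real^2" where "\<iota> = (\<lambda>p. fst p *\<^sub>R axis 1 1 + snd p *\<^sub>R axis 2 1)"
  have B: "(Basis :: (real^2) set) = {axis 1 1, axis 2 1}"
    by (auto simp: Basis_vec_def UNIV_2)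
  have ne: "axis 1 1 \<noteq> (axis 2 1 :: real^2)" by (simp add: axis_eq_axis)
  have m: "\<iota> \<in> borel_measurable borel" unfolding \<iota>_def
    by (intro borel_measurable_continuous_onI continuous_intros)
  fix l u :: "real^2" assume le: "\<And>b. b \<in> Basis \<Longrightarrow> l \<bullet> b \<le> u \<bullet> b"
  have lu: "l $ 1 \<le> u $ 1" "l $ 2 \<le> u $ 2"
    using le[of "axis 1 1"] le[of "axis 2 1"] B by (auto simp: inner_axis)
  have vi: "\<iota> -` box l u = box (l $ 1, l $ 2) (u $ 1, u $ 2)"
    by (rule set_eqI) (simp add: \<iota>_def mem_box_cart mem_box B forall_2 Basis_prod_def axis_def inner_prod_def conj_ac)
  have "emeasure (distr lborel borel \<iota>) (box l u) = emeasure lborel (box (l $ 1, l $ 2) (u $ 1, u $ 2))"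
    using m vi by (subst emeasure_distr) auto
  also have "\<dots> = (\<Prod>b\<in>Basis. ((u $ 1, u $ 2) - (l $ 1, l $ 2)) \<bullet> b)"
    using lu by (subst emeasure_lborel_box) (auto simp: Basis_prod_def)
  also have "\<dots> = (\<Prod>b\<in>Basis. (u - l) \<bullet> b)"
  proof -
    have b: "(Basis :: (real \<times> real) set) = {(1,0),(0,1)}" by (auto simp: Basis_prod_def)
    show ?thesis unfolding b B using ne by (simp add: inner_axis)
  qed
  finally show "emeasure (distr lborel borel (\<lambda>p. fst p *\<^sub>R axis 1 1 + snd p *\<^sub>R axis 2 1)) (box l u)
     = (\<Prod>b\<in>Basis. (u - l) \<bullet> b)" unfolding \<iota>_def .
qed simp

lemma nn_integral_plane_conv:
  assumes "f \<in> borel_measurable borel"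
  shows "(\<integral>\<^sup>+ p. f p \<partial>(lborel :: (real^2) measure)) = (\<integral>\<^sup>+ q. f (fst q *\<^sub>R axis 1 1 + snd q *\<^sub>R axis 2 1) \<partial>lborel)"
proof -
  have m: "(\<lambda>p::real \<times> real. fst p *\<^sub>R axis 1 1 + snd p *\<^sub>R axis 2 1 :: real^2) \<in> borel_measurable borel"
    by (intro borel_measurable_continuous_onI continuous_intros)
  show ?thesis
    by (subst distr_lborel_plane[symmetric], subst nn_integral_distr) (use assms m in auto)
qed

lemma det_image_two_points:
  fixes v w :: "real^2"
  shows "det (matrix (\<lambda>h::real^2. - (h $ 2 *\<^sub>R w) - h $ 1 *\<^sub>R v)) = cross2 v w"
  by (simp add: det_2 matrix_def cross2_def axis_def)

text \<open>
The change of variables \<open>(s, t) \<mapsto> x - \<gamma> t - \<gamma> s\<close>, whose Jacobian is the determinant of the two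
tangent vectors. As an equality of measures it serves nonnegative integrands and complex integrable
ones alike.
\<close>

lemma distr_curve_sum:
  fixes \<gamma> \<gamma>' :: "real \<Rightarrow> real^2" and S :: "(real \<times> real) set" and x :: "real^2"
  assumes S: "S \<in> sets borel" "bounded S"
    and cont: "continuous_on UNIV \<gamma>"
    and der: "\<And>s t. (s,t) \<in> S \<Longrightarrow> (\<gamma> has_vector_derivative \<gamma>' s) (at s)"
             "\<And>s t. (s,t) \<in> S \<Longrightarrow> (\<gamma> has_vector_derivative \<gamma>' t) (at t)"
    and meas: "\<gamma>' \<in> borel_measurable borel"
    and bd: "\<And>s t. (s,t) \<in> S \<Longrightarrow> \<bar>cross2 (\<gamma>' s) (\<gamma>' t)\<bar> \<le> K"
    and inj: "inj_on (\<lambda>(s,t). x - \<gamma> t - \<gamma> s) S"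
    and img: "(\<lambda>(s,t). x - \<gamma> t - \<gamma> s) ` S = R"
    and R: "R \<in> sets borel" "bounded R"
  shows "distr (density lborel (\<lambda>q. indicator S q * ennreal \<bar>cross2 (\<gamma>' (fst q)) (\<gamma>' (snd q))\<bar>)) borel
           (\<lambda>q. x - \<gamma> (snd q) - \<gamma> (fst q)) = density lborel (indicator R)"
    (is "distr (density lborel ?d) borel ?g = _")
proof (rule measure_eqI)
  fix A assume "A \<in> sets (distr (density lborel ?d) borel ?g)"
  then have A: "A \<in> sets borel" by simp
  have [measurable]: "\<gamma>' \<in> borel_measurable borel" by fact
  have [measurable]: "\<gamma> \<in> borel_measurable borel"
    using cont by (rule borel_measurable_continuous_onI)
  have [measurable]: "(\<lambda>q. cross2 (\<gamma>' (fst q)) (\<gamma>' (snd q))) \<in> borel_measurable borel"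
    unfolding cross2_alt borel_prod[symmetric] by measurable
  have [measurable]: "?g \<in> borel_measurable borel" unfolding borel_prod[symmetric] by measurable
  have [measurable]: "S \<in> sets borel" "R \<in> sets borel" "A \<in> sets borel" using S R A by auto
  define \<pi> :: "real^2 \<Rightarrow> real \<times> real" where "\<pi> p = (p $ 1, p $ 2)" for p
  have [measurable]: "\<pi> \<in> borel_measurable borel"
    unfolding \<pi>_def by (intro borel_measurable_continuous_onI continuous_intros)
  define T where "T = \<pi> -` (S \<inter> ?g -` A)"
  have SA: "S \<inter> ?g -` A \<in> sets borel"
    using measurable_sets[of ?g borel borel A] by auto
  then have T: "T \<in> sets borel" unfolding T_def
    using measurable_sets[of \<pi> borel borel "S \<inter> ?g -` A"] by auto
  have Tb: "bounded T"
  proof -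
    obtain B where B: "\<And>q. q \<in> S \<Longrightarrow> norm q \<le> B" using S(2) unfolding bounded_iff by blast
    have "norm p \<le> B" if "p \<in> T" for p
    proof -
      have "norm (\<pi> p) \<le> B" using that B unfolding T_def by auto
      then show ?thesis unfolding \<pi>_def norm_Pair norm_vec_def L2_set_def by (simp add: sum_2)
    qed
    then show ?thesis unfolding bounded_iff by blast
  qed
  define h where "h = (\<lambda>p::real^2. x - \<gamma> (p $ 2) - \<gamma> (p $ 1))"
  define h' where "h' p = (\<lambda>v::real^2. - (v $ 2 *\<^sub>R \<gamma>' (p $ 2)) - v $ 1 *\<^sub>R \<gamma>' (p $ 1))" for p :: "real^2"
  define J where "J p = \<bar>cross2 (\<gamma>' (p $ 1)) (\<gamma>' (p $ 2))\<bar>" for p :: "real^2"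
  have Jdet: "\<bar>det (matrix (h' p))\<bar> = J p" for p
    unfolding h'_def J_def by (simp add: det_image_two_points)
  have hT: "h ` T = A \<inter> R"
  proof (intro equalityI subsetI)
    fix z assume "z \<in> h ` T"
    then obtain p where p: "p \<in> T" "z = h p" by blast
    then have "(p $ 1, p $ 2) \<in> S" "z \<in> A" by (auto simp: T_def \<pi>_def h_def)
    moreover have "z = (\<lambda>(s,t). x - \<gamma> t - \<gamma> s) (p $ 1, p $ 2)" using p by (simp add: h_def)
    ultimately show "z \<in> A \<inter> R" unfolding img[symmetric] by blast
  next
    fix z assume z: "z \<in> A \<inter> R"
    then obtain s t where st: "(s,t) \<in> S" "z = x - \<gamma> t - \<gamma> s" unfolding img[symmetric] by auto
    define p :: "real^2" where "p = s *\<^sub>R axis 1 1 + t *\<^sub>R axis 2 1"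
    have p: "p $ 1 = s" "p $ 2 = t" by (simp_all add: p_def axis_def)
    have "p \<in> T" "z = h p" using st z by (auto simp: T_def h_def \<pi>_def p)
    then show "z \<in> h ` T" by blast
  qed
  have inj_h: "inj_on h T"
  proof (rule inj_onI)
    fix p q assume pq: "p \<in> T" "q \<in> T" "h p = h q"
    have "\<pi> p = \<pi> q"
      by (rule inj_onD[OF inj]) (use pq in \<open>auto simp: T_def h_def \<pi>_def\<close>)
    then show "p = q" by (simp add: \<pi>_def vec_eq_iff forall_2)
  qed
  have der_h: "(h has_derivative h' p) (at p within T)" if "p \<in> T" for p
  proof -
    have d1: "(\<gamma> has_derivative (\<lambda>k. k *\<^sub>R \<gamma>' (p $ 1))) (at (p $ 1))"
      and d2: "(\<gamma> has_derivative (\<lambda>k. k *\<^sub>R \<gamma>' (p $ 2))) (at (p $ 2))"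
      using der that unfolding T_def \<pi>_def has_vector_derivative_def by auto
    have c1: "((\<lambda>p::real^2. \<gamma> (p $ i)) has_derivative (\<lambda>v. (v $ i) *\<^sub>R \<gamma>' (p $ i))) (at p within T)"
      if "(\<gamma> has_derivative (\<lambda>k. k *\<^sub>R \<gamma>' (p $ i))) (at (p $ i))" for i
      using has_derivative_compose[of "\<lambda>p. p $ i" "\<lambda>v. v $ i" p T \<gamma> "\<lambda>k. k *\<^sub>R \<gamma>' (p $ i)"] that
        bounded_linear_imp_has_derivative[OF bounded_linear_vec_nth] by blast
    show ?thesis unfolding h_def h'_def
      using c1[OF d1] c1[OF d2] by (auto intro!: derivative_eq_intros)
  qed
  have [measurable]: "J \<in> borel_measurable borel"
    using measurable_compose[of \<pi> borel borel "\<lambda>q. cross2 (\<gamma>' (fst q)) (\<gamma>' (snd q))" borel]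
    unfolding J_def by (simp add: \<pi>_def)
  have mJ: "(\<lambda>p. ennreal (indicator T p * J p)) \<in> borel_measurable borel" using T by measurable
  have JT: "0 \<le> J p \<and> (p \<in> T \<longrightarrow> J p \<le> K)" for p
    using bd unfolding J_def T_def \<pi>_def by auto
  have Tl: "T \<in> lmeasurable" using T Tb by (simp add: bounded_set_imp_lmeasurable)
  have intJ: "set_integrable lborel T J"
    unfolding set_integrable_def
    by (rule integrableI_bounded_set[where A=T and B=K])
      (use T Tb JT emeasure_bounded_finite[OF Tb] in \<open>auto split: split_indicator\<close>)
  then have intJ': "set_integrable lebesgue T J"
    unfolding set_integrable_def by (simp add: integrable_completion T)
  have "measure lebesgue (h ` T) = integral T (\<lambda>p. \<bar>det (matrix (h' p))\<bar>)"
    by (rule measure_differentiable_image_eq[OF _ der_h inj_h])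
      (use T intJ' in \<open>auto simp: Jdet intro: set_lebesgue_integral_eq_integral(1)\<close>)
  also have "\<dots> = (LINT p:T|lebesgue. J p)" unfolding Jdet
    using set_lebesgue_integral_eq_integral(2)[OF intJ'] by simp
  also have "\<dots> = (LINT p:T|lborel. J p)"
    unfolding set_lebesgue_integral_def by (rule integral_completion) (use T in auto)
  finally have M: "measure lborel (A \<inter> R) = (LINT p:T|lborel. J p)" using hT by simp
  have "emeasure (distr (density lborel ?d) borel ?g) A = emeasure (density lborel ?d) (?g -` A)"
    by (subst emeasure_distr) auto
  also have "\<dots> = (\<integral>\<^sup>+ q. ?d q * indicator (?g -` A) q \<partial>lborel)"
    by (rule emeasure_density) (use measurable_sets[of ?g borel borel A] in auto)
  also have "\<dots> = (\<integral>\<^sup>+ p. ennreal (indicator T p * J p) \<partial>(lborel :: (real^2) measure))"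
    by (subst nn_integral_plane_conv[OF mJ])
      (auto intro!: nn_integral_cong simp: T_def \<pi>_def J_def axis_def split: split_indicator)
  also have "\<dots> = ennreal (LINT p:T|lborel. J p)"
    using intJ unfolding set_integrable_def set_lebesgue_integral_def
    by (subst nn_integral_eq_integral) (auto simp: JT)
  also have "\<dots> = emeasure lborel (A \<inter> R)"
  proof -
    have "bounded (A \<inter> R)" using R by (meson bounded_Int)
    from emeasure_bounded_finite[OF this] M show ?thesis
      by (simp add: emeasure_eq_ennreal_measure less_top[symmetric])
  qed
  also have "\<dots> = emeasure (density lborel (indicator R)) A"
    by (subst emeasure_density) (auto simp: Int_commute simp flip: indicator_inter_arith)
  finally show "emeasure (distr (density lborel ?d) borel ?g) A = emeasure (density lborel (indicator R)) A" .
qed simp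

text \<open>
All geometry is done in the coordinates \<open>x \<bullet> e1\<close> and \<open>x \<bullet> e2\<close>.
\<close>

locale orthonormal_frame =
  fixes e1 e2 :: "real^2"
  assumes e11: "e1 \<bullet> e1 = 1" and e22: "e2 \<bullet> e2 = 1" and e12: "e1 \<bullet> e2 = 0"
begin

lemma cross2_frame: "\<bar>cross2 e1 e2\<bar> = 1"
proof -
  have "(cross2 e1 e2)\<^sup>2 = (e1 \<bullet> e1) * (e2 \<bullet> e2) - (e1 \<bullet> e2)\<^sup>2"
    unfolding cross2_def inner2 by (simp add: power2_eq_square algebra_simps)
  then have "(cross2 e1 e2)\<^sup>2 = 1" by (simp add: e11 e22 e12)
  then show ?thesis by (auto simp: power2_eq_1_iff)
qed

lemma frame_expand: "x = (x \<bullet> e1) *\<^sub>R e1 + (x \<bullet> e2) *\<^sub>R e2"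
proof -
  define y where "y = x - (x \<bullet> e1) *\<^sub>R e1 - (x \<bullet> e2) *\<^sub>R e2"
  have y: "y \<bullet> e1 = 0" "y \<bullet> e2 = 0"
    unfolding y_def by (auto simp: inner_diff_left e11 e22 e12 inner_commute[of e2 e1])
  have "y $ 1 * cross2 e1 e2 = (y \<bullet> e1) * e2 $ 2 - (y \<bullet> e2) * e1 $ 2"
    "y $ 2 * cross2 e1 e2 = (y \<bullet> e2) * e1 $ 1 - (y \<bullet> e1) * e2 $ 1"
    unfolding cross2_def inner2 by (simp_all add: algebra_simps)
  moreover have "cross2 e1 e2 \<noteq> 0" using cross2_frame by auto
  ultimately have "y = 0" using y by (simp add: vec_eq_iff forall_2)
  then show ?thesis unfolding y_def by (simp add: algebra_simps)
qed

lemma abs_cross2_frame: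
  "\<bar>cross2 v w\<bar> = \<bar>(v \<bullet> e1) * (w \<bullet> e2) - (v \<bullet> e2) * (w \<bullet> e1)\<bar>"
proof -
  have "cross2 v w = ((v \<bullet> e1) * (w \<bullet> e2) - (v \<bullet> e2) * (w \<bullet> e1)) * cross2 e1 e2"
  proof -
    have "cross2 (p *\<^sub>R e1 + q *\<^sub>R e2) (r *\<^sub>R e1 + s *\<^sub>R e2) = (p * s - q * r) * cross2 e1 e2" for p q r s
      by (simp add: cross2_def algebra_simps)
    from this[of "v \<bullet> e1" "v \<bullet> e2" "w \<bullet> e1" "w \<bullet> e2"] show ?thesis
      unfolding frame_expand[symmetric] .
  qed
  then show ?thesis using cross2_frame by (simp add: abs_mult)
qed

lemma norm_le_frame: "norm x \<le> \<bar>x \<bullet> e1\<bar> + \<bar>x \<bullet> e2\<bar>"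
proof -
  have "norm e1 = 1" "norm e2 = 1" using e11 e22 by (auto simp: norm_eq_sqrt_inner)
  then show ?thesis
    using norm_triangle_ineq[of "(x \<bullet> e1) *\<^sub>R e1" "(x \<bullet> e2) *\<^sub>R e2"] frame_expand[of x] by simp
qed

definition frame_box :: "real^2 \<Rightarrow> real \<Rightarrow> real \<Rightarrow> (real^2) set" where
  "frame_box a w h =
     {x. 0 \<le> (x - a) \<bullet> e1 \<and> (x - a) \<bullet> e1 \<le> w \<and> 0 \<le> (x - a) \<bullet> e2 \<and> (x - a) \<bullet> e2 \<le> h}"

lemma frame_box_eq_image:
  "frame_box a w h = {a + s *\<^sub>R e1 + u *\<^sub>R e2 | s u. 0 \<le> s \<and> s \<le> w \<and> 0 \<le> u \<and> u \<le> h}" (is "?L = ?R")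
proof (intro equalityI subsetI)
  fix x assume "x \<in> ?L"
  moreover have "x = a + ((x - a) \<bullet> e1) *\<^sub>R e1 + ((x - a) \<bullet> e2) *\<^sub>R e2"
    using frame_expand[of "x - a"] by (simp add: algebra_simps)
  ultimately show "x \<in> ?R" unfolding frame_box_def by blast
next
  fix x assume "x \<in> ?R"
  then show "x \<in> ?L" unfolding frame_box_def
    by (auto simp: inner_add_left inner_diff_left e11 e22 e12 inner_commute[of e2 e1])
qed

lemma closed_frame_box: "closed (frame_box a w h)"
  unfolding frame_box_def
  by (intro closed_Collect_conj closed_Collect_le continuous_intros)

lemma frame_box_borel [measurable]: "frame_box a w h \<in> sets borel"
  using closed_frame_box by (rule borel_closed)

lemma bounded_frame_box: "bounded (frame_box a w h)"
proof -
  have "norm (x - a) \<le> \<bar>w\<bar> + \<bar>h\<bar>" if "x \<in> frame_box a w h" for x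
    using norm_le_frame[of "x - a"] that unfolding frame_box_def by auto
  then have "frame_box a w h \<subseteq> cball a (\<bar>w\<bar> + \<bar>h\<bar>)" by (auto simp: dist_norm norm_minus_commute)
  then show ?thesis using bounded_cball bounded_subset by blast
qed

lemma compact_frame_box: "compact (frame_box a w h)"
  using closed_frame_box bounded_frame_box compact_eq_bounded_closed by blast

lemma measure_frame_box:
  assumes "0 \<le> w" "0 \<le> h"
  shows "measure lborel (frame_box a w h) = w * h"
proof -
  define f where "f p = p $ 1 *\<^sub>R e1 + p $ 2 *\<^sub>R e2" for p :: "real^2"
  have lin: "linear f" unfolding f_def by (intro linearI) (auto simp: algebra_simps)
  have "det (matrix f) = cross2 e1 e2"
    by (simp add: det_2 matrix_def cross2_def axis_def f_def)
  then have d: "\<bar>det (matrix f)\<bar> = 1" using cross2_frame by simp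
  define c where "c = (w *\<^sub>R axis 1 1 + h *\<^sub>R axis 2 1 :: real^2)"
  have c: "c $ 1 = w" "c $ 2 = h" by (auto simp: c_def axis_def)
  have "frame_box a w h = (+) a ` (f ` cbox 0 c)"
  proof (intro equalityI subsetI)
    fix x assume "x \<in> frame_box a w h"
    then obtain s u where su: "x = a + s *\<^sub>R e1 + u *\<^sub>R e2" "0 \<le> s" "s \<le> w" "0 \<le> u" "u \<le> h"
      unfolding frame_box_eq_image by blast
    have "f (s *\<^sub>R axis 1 1 + u *\<^sub>R axis 2 1) = s *\<^sub>R e1 + u *\<^sub>R e2"
      by (simp add: f_def axis_def)
    moreover have "s *\<^sub>R axis 1 1 + u *\<^sub>R axis 2 1 \<in> cbox 0 c"
      using su c by (auto simp: mem_box_cart forall_2 axis_def)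
    ultimately show "x \<in> (+) a ` (f ` cbox 0 c)"
      using su by (auto simp: image_iff algebra_simps intro!: bexI)
  next
    fix x assume "x \<in> (+) a ` (f ` cbox 0 c)"
    then obtain p where "x = a + f p" "0 \<le> p $ 1" "p $ 1 \<le> w" "0 \<le> p $ 2" "p $ 2 \<le> h"
      using c by (auto simp: mem_box_cart forall_2)
    then show "x \<in> frame_box a w h" unfolding frame_box_eq_image f_def
      by (auto simp: algebra_simps intro!: exI)
  qed
  then have "measure lebesgue (frame_box a w h) = measure lebesgue (f ` cbox 0 c)"
    by (simp add: measure_translation)
  also have "\<dots> = measure lebesgue (cbox 0 c)"
    using measure_linear_image[OF lin, of "cbox 0 c"] d by simp
  also have "\<dots> = w * h"
  proof -
    have "cbox 0 c \<noteq> {}" using assms c by (auto simp: interval_eq_empty_cart forall_2 not_less)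
    then have "measure lborel (cbox 0 c) = w * h" using c by (subst content_cbox_cart) (auto simp: UNIV_2)
    then show ?thesis by simp
  qed
  finally show ?thesis by simp
qed

lemma emeasure_frame_box:
  assumes "0 \<le> w" "0 \<le> h"
  shows "emeasure lborel (frame_box a w h) = ennreal (w * h)"
  using measure_frame_box[OF assms] emeasure_bounded_finite[OF bounded_frame_box]
  by (simp add: emeasure_eq_ennreal_measure less_top[symmetric])

end

section \<open>Differences of the symbol along the curve\<close>

lemma nn_integral_translate:
  fixes \<psi> :: "real^2 \<Rightarrow> ennreal"
  assumes [measurable]: "\<psi> \<in> borel_measurable borel"
  shows "(\<integral>\<^sup>+ x. \<psi> (x - c) \<partial>lborel) = (\<integral>\<^sup>+ x. \<psi> x \<partial>lborel)"
proof -
  have "(\<integral>\<^sup>+ x. \<psi> x \<partial>lborel) = (\<integral>\<^sup>+ x. \<psi> x \<partial>distr lborel borel ((+) (- c)))"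
    by (simp add: lborel_distr_plus)
  also have "\<dots> = (\<integral>\<^sup>+ x. \<psi> (x - c) \<partial>lborel)"
    by (subst nn_integral_distr) auto
  finally show ?thesis by simp
qed

lemma nn_integral_shear:
  fixes \<psi> :: "real^2 \<Rightarrow> ennreal" and \<gamma> :: "real \<Rightarrow> real^2" and \<phi> :: "real \<Rightarrow> ennreal"
  assumes [measurable]: "\<psi> \<in> borel_measurable borel" "\<gamma> \<in> borel_measurable borel" "\<phi> \<in> borel_measurable borel"
  shows "(\<integral>\<^sup>+ x. (\<integral>\<^sup>+ t. \<phi> t * \<psi> (x - \<gamma> t) \<partial>lborel) \<partial>lborel)
       = (\<integral>\<^sup>+ t. \<phi> t \<partial>lborel) * (\<integral>\<^sup>+ y. \<psi> y \<partial>lborel)"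
proof -
  have "(\<integral>\<^sup>+ x. (\<integral>\<^sup>+ t. \<phi> t * \<psi> (x - \<gamma> t) \<partial>lborel) \<partial>lborel)
      = (\<integral>\<^sup>+ t. (\<integral>\<^sup>+ x. \<phi> t * \<psi> (x - \<gamma> t) \<partial>lborel) \<partial>lborel)"
    by (rule lborel_pair.Fubini') measurable
  also have "\<dots> = (\<integral>\<^sup>+ t. \<phi> t * (\<integral>\<^sup>+ y. \<psi> y \<partial>lborel) \<partial>lborel)"
    by (simp add: nn_integral_cmult nn_integral_translate)
  also have "\<dots> = (\<integral>\<^sup>+ t. \<phi> t \<partial>lborel) * (\<integral>\<^sup>+ y. \<psi> y \<partial>lborel)"
    by (rule nn_integral_multc) measurable
  finally show ?thesis .
qed

definition test_fun :: "'a set \<Rightarrow> real \<Rightarrow> ('a::topological_space \<Rightarrow> complex) \<Rightarrow> bool" where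
  "test_fun P F f \<longleftrightarrow> f \<in> borel_measurable borel \<and> (\<forall>y. norm (f y) \<le> F) \<and> (\<forall>y. y \<notin> P \<longrightarrow> f y = 0)"

lemma test_funD:
  assumes "test_fun P F f"
  shows "f \<in> borel_measurable borel" "norm (f y) \<le> F" "y \<notin> P \<Longrightarrow> f y = 0"
  using assms by (auto simp: test_fun_def)

locale symbol_on_curve =
  fixes \<gamma> :: "real \<Rightarrow> real^2" and b :: "real^2 \<Rightarrow> complex" and e :: "real^2"
  assumes cont: "continuous_on UNIV \<gamma>" and \<gamma>0: "\<gamma> 0 = 0"
    and b_borel [measurable]: "b \<in> borel_measurable borel"
    and loc: "\<And>K. compact K \<Longrightarrow> set_integrable lborel K b"
begin

lemma \<gamma>_borel [measurable]: "\<gamma> \<in> borel_measurable borel"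
  using cont by (rule borel_measurable_continuous_onI)

text \<open>
For \<open>A = {-1..1}\<close> and \<open>j = 0\<close> this is the commutator applied to \<open>m\<close>, at almost every point x away
from the support of \<open>m\<close>. The extra factor is the j-th power of one coordinate of the step from x
to \<open>x - \<gamma> t\<close>; it supplies the polynomial weights needed to reproduce a Jacobian.
\<close>

definition curve_diff :: "real set \<Rightarrow> nat \<Rightarrow> (real^2 \<Rightarrow> complex) \<Rightarrow> real^2 \<Rightarrow> complex" where
  "curve_diff A j m x =
     (LINT t|lborel. indicator A t *\<^sub>R
        (complex_of_real ((\<gamma> t \<bullet> e) ^ j / t) * ((b x - b (x - \<gamma> t)) * m (x - \<gamma> t))))"

lemma curve_diff_measurable [measurable]:
  assumes [measurable]: "m \<in> borel_measurable borel" "A \<in> sets borel"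
  shows "curve_diff A j m \<in> borel_measurable borel"
proof -
  have "(\<lambda>x. LINT t|lborel. indicator A t *\<^sub>R
        (complex_of_real ((\<gamma> t \<bullet> e) ^ j / t) * ((b x - b (x - \<gamma> t)) * m (x - \<gamma> t)))) \<in> borel_measurable lborel"
    by measurable
  then show ?thesis unfolding curve_diff_def[abs_def] by simp
qed

lemma near_origin:
  assumes "0 < \<delta>"
  shows "\<exists>\<delta>0>0. \<forall>t. \<bar>t\<bar> < \<delta>0 \<longrightarrow> norm (\<gamma> t) < \<delta>"
proof -
  have "isCont \<gamma> 0" using cont by (simp add: continuous_on_eq_continuous_at)
  then obtain d where "d > 0" "\<And>t. dist t 0 < d \<Longrightarrow> dist (\<gamma> t) (\<gamma> 0) < \<delta>"
    using assms unfolding continuous_at_eps_delta by (metis dist_commute)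
  then show ?thesis by (intro exI[of _ d]) (simp add: dist_norm \<gamma>0)
qed

lemma nn_integral_norm_loc:
  assumes "compact P"
  shows "L1_on P b < \<infinity>"
proof -
  have "(\<integral>\<^sup>+ y. ennreal (norm (indicator P y *\<^sub>R b y)) \<partial>lborel) < \<infinity>"
    using loc[OF assms] unfolding set_integrable_def integrable_iff_bounded by auto
  then show ?thesis by (simp add: indicator_mult_ennreal mult.commute ennreal_mult' flip: ennreal_indicator)
qed

text \<open>
Along the translate of the curve that starts at one particular point a locally integrable
function can be arbitrarily bad. The shear \<open>(x, t) \<mapsto> (x - \<gamma> t, t)\<close> preserves measure, so Tonelli makes
it integrable along almost every translate.
\<close>

lemma AE_slice_integrable:
  assumes P: "compact P" and A: "A \<in> sets borel" "bounded A"
  shows "AE x in lborel. integrable lborel (\<lambda>t. indicator A t *\<^sub>R (indicator P (x - \<gamma> t) *\<^sub>R b (x - \<gamma> t)))"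
proof -
  have [measurable]: "P \<in> sets borel" "A \<in> sets borel" using P A borel_compact by auto
  have "(\<integral>\<^sup>+ x. (\<integral>\<^sup>+ t. indicator A t * (ennreal (norm (b (x - \<gamma> t))) * indicator P (x - \<gamma> t)) \<partial>lborel) \<partial>lborel)
     = (\<integral>\<^sup>+ t. indicator A t \<partial>lborel) * L1_on P b"
    by (rule nn_integral_shear[of "\<lambda>y. ennreal (norm (b y)) * indicator P y" \<gamma> "indicator A"]) measurable
  also have "\<dots> < \<infinity>"
    using nn_integral_norm_loc[OF P] emeasure_bounded_finite[OF A(2)] by (simp add: ennreal_mult_less_top)
  finally have "AE x in lborel. (\<integral>\<^sup>+ t. indicator A t * (ennreal (norm (b (x - \<gamma> t))) * indicator P (x - \<gamma> t)) \<partial>lborel) \<noteq> \<infinity>"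
    by (intro nn_integral_noteq_infinite) auto
  then show ?thesis
  proof eventually_elim
    case (elim x)
    have eq: "ennreal (norm (indicator A t *\<^sub>R (indicator P (x - \<gamma> t) *\<^sub>R b (x - \<gamma> t))))
      = indicator A t * (ennreal (norm (b (x - \<gamma> t))) * indicator P (x - \<gamma> t))" for t
      by (auto split: split_indicator)
    have "(\<integral>\<^sup>+ t. ennreal (norm (indicator A t *\<^sub>R (indicator P (x - \<gamma> t) *\<^sub>R b (x - \<gamma> t)))) \<partial>lborel) < \<infinity>"
      unfolding eq using elim by (simp add: less_top)
    then show ?case by (intro integrableI_bounded) auto
  qed
qed

definition separated :: "real \<Rightarrow> (real^2) set \<Rightarrow> (real^2) set \<Rightarrow> bool" where
  "separated \<delta> Q P \<longleftrightarrow> 0 < \<delta> \<and> (\<forall>x\<in>Q. \<forall>y\<in>P. \<delta> \<le> norm (x - y))"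

text \<open>
Separation keeps t away from 0 wherever the integrand does not vanish, so \<open>1 / t\<close> acts as a
bounded factor.
\<close>

lemma integrable_kernel:
  assumes sep: "separated \<delta> Q P" and A: "A \<in> sets borel" "A \<subseteq> {-1..1}" and x: "x \<in> Q"
    and tf: "test_fun P F f"
    and P: "P \<in> sets borel" and h [measurable]: "h \<in> borel_measurable borel"
    and h_int: "integrable lborel (\<lambda>t. indicator A t *\<^sub>R (indicator P (x - \<gamma> t) *\<^sub>R h (x - \<gamma> t)))"
  shows "integrable lborel (\<lambda>t. indicator A t *\<^sub>R (complex_of_real ((\<gamma> t \<bullet> e) ^ j / t) * ((h (x - \<gamma> t) :: complex) * f (x - \<gamma> t))))"
proof -
  note f = test_funD[OF tf]
  obtain \<delta>0 where d: "0 < \<delta>0" "\<And>t. \<bar>t\<bar> < \<delta>0 \<Longrightarrow> norm (\<gamma> t) < \<delta>"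
    using near_origin[of \<delta>] sep unfolding separated_def by auto
  have "compact (\<gamma> ` {-1..1})" using cont by (intro compact_continuous_image) (auto intro: continuous_on_subset)
  then obtain G where G: "\<And>t. t \<in> {-1..1} \<Longrightarrow> norm (\<gamma> t) \<le> G"
    by (meson bounded_iff compact_imp_bounded imageI)
  have F0: "0 \<le> F" using f(2)[of 0] norm_ge_zero order_trans by blast
  have G0: "0 \<le> G" using G[of 0] \<gamma>0 by simp
  let ?K = "(G * norm e) ^ j / \<delta>0 * F"
  have [measurable]: "f \<in> borel_measurable borel" "A \<in> sets borel" using f A by auto
  have "norm (indicator A t *\<^sub>R (complex_of_real ((\<gamma> t \<bullet> e) ^ j / t) * (h (x - \<gamma> t) * f (x - \<gamma> t))))
     \<le> norm (?K *\<^sub>R (indicator A t *\<^sub>R (indicator P (x - \<gamma> t) *\<^sub>R h (x - \<gamma> t))))" for t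
  proof (cases "t \<in> A \<and> x - \<gamma> t \<in> P")
    case True
    then have "\<delta> \<le> norm (\<gamma> t)" using sep x unfolding separated_def by force
    then have t: "\<delta>0 \<le> \<bar>t\<bar>" using d(2)[of t] by linarith
    have "\<bar>\<gamma> t \<bullet> e\<bar> \<le> norm (\<gamma> t) * norm e" by (rule Cauchy_Schwarz_ineq2)
    also have "\<dots> \<le> G * norm e" using G[of t] True A(2) by (intro mult_right_mono) auto
    finally have "\<bar>(\<gamma> t \<bullet> e) ^ j\<bar> \<le> (G * norm e) ^ j" unfolding power_abs by (rule power_mono) simp
    then have "\<bar>(\<gamma> t \<bullet> e) ^ j / t\<bar> \<le> (G * norm e) ^ j / \<delta>0"
      unfolding abs_divide using t d(1) G0 by (intro frac_le) auto
    then have "\<bar>(\<gamma> t \<bullet> e) ^ j / t\<bar> * norm (f (x - \<gamma> t)) \<le> ?K"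
      using f(2) d(1) G0 by (intro mult_mono) auto
    then have "\<bar>(\<gamma> t \<bullet> e) ^ j / t\<bar> * norm (f (x - \<gamma> t)) \<le> \<bar>?K\<bar>" by linarith
    then have "\<bar>(\<gamma> t \<bullet> e) ^ j / t\<bar> * norm (f (x - \<gamma> t)) * norm (h (x - \<gamma> t)) \<le> \<bar>?K\<bar> * norm (h (x - \<gamma> t))"
      by (rule mult_right_mono) simp
    then show ?thesis using True by (simp add: norm_mult ac_simps del: of_real_divide of_real_power)
  qed (use f(3) in \<open>auto split: split_indicator\<close>)
  then show ?thesis
    by (intro Bochner_Integration.integrable_bound[OF integrable_scaleR_right[OF h_int, of ?K]]) (auto intro!: AE_I2)
qed

text \<open>
For small t the curve stays in a \<open>\<delta>\<close>-ball around 0 and \<open>x - \<gamma> t\<close> outside of P. All truncations at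
such small heights therefore give the same value, the integral over \<open>[-1, 1]\<close>.
\<close>

lemma curve_hilbert_separated:
  assumes sep: "separated \<delta> Q P" and x: "x \<in> Q"
    and f [measurable]: "f \<in> borel_measurable borel" and f0: "\<And>y. y \<notin> P \<Longrightarrow> f y = 0"
  shows "curve_hilbert \<gamma> f x = (LINT t|lborel. indicator {-1..1} t *\<^sub>R (f (x - \<gamma> t) / complex_of_real t))"
proof -
  obtain \<delta>0 where d: "0 < \<delta>0" "\<And>t. \<bar>t\<bar> < \<delta>0 \<Longrightarrow> norm (\<gamma> t) < \<delta>"
    using near_origin[of \<delta>] sep unfolding separated_def by auto
  let ?I = "LINT t|lborel. indicator {-1..1} t *\<^sub>R (f (x - \<gamma> t) / complex_of_real t)"
  have far: "\<delta>0 \<le> \<bar>t\<bar>" if "f (x - \<gamma> t) \<noteq> 0" for t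
  proof -
    have "x - \<gamma> t \<in> P" using that f0 by blast
    then have "\<delta> \<le> norm (\<gamma> t)" using sep x unfolding separated_def by force
    then show ?thesis using d(2)[of t] by linarith
  qed
  have "(LINT t:{t. \<epsilon> < \<bar>t\<bar> \<and> \<bar>t\<bar> \<le> 1}|lebesgue. f (x - \<gamma> t) / complex_of_real t) = ?I" if "\<epsilon> < \<delta>0" for \<epsilon>
  proof -
    have "indicator {t. \<epsilon> < \<bar>t\<bar> \<and> \<bar>t\<bar> \<le> 1} t *\<^sub>R (f (x - \<gamma> t) / complex_of_real t)
      = indicator {-1..1} t *\<^sub>R (f (x - \<gamma> t) / complex_of_real t)" for t
      using far[of t] that by (cases "f (x - \<gamma> t) = 0") (auto simp: indicator_def)
    then show ?thesis unfolding set_lebesgue_integral_def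
      by (simp only:) (rule integral_completion, measurable)
  qed
  then have "\<forall>\<^sub>F \<epsilon> in at_right 0. (LINT t:{t. \<epsilon> < \<bar>t\<bar> \<and> \<bar>t\<bar> \<le> 1}|lebesgue. f (x - \<gamma> t) / complex_of_real t) = ?I"
    unfolding eventually_at_right_field using d(1) by blast
  then show ?thesis unfolding curve_hilbert_def
    by (intro tendsto_Lim tendsto_eventually) auto
qed

lemma AE_curve_diff_integrable:
  assumes sep: "separated \<delta> Q P" and A: "A \<in> sets borel" "A \<subseteq> {-1..1}" and P: "compact P"
    and tf: "test_fun P F f"
  shows "AE x in lborel. x \<in> Q \<longrightarrow>
     integrable lborel (\<lambda>t. indicator A t *\<^sub>R (complex_of_real ((\<gamma> t \<bullet> e) ^ j / t) * (b (x - \<gamma> t) * f (x - \<gamma> t)))) \<and>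
     integrable lborel (\<lambda>t. indicator A t *\<^sub>R (complex_of_real ((\<gamma> t \<bullet> e) ^ j / t) * (b x * f (x - \<gamma> t)))) \<and>
     integrable lborel (\<lambda>t. indicator A t *\<^sub>R (complex_of_real ((\<gamma> t \<bullet> e) ^ j / t) * ((b x - b (x - \<gamma> t)) * f (x - \<gamma> t))))"
proof -
  note f = test_funD[OF tf]
  have bA: "bounded A" by (rule bounded_subset[OF bounded_closed_interval A(2)])
  have Pb [measurable]: "P \<in> sets borel" "A \<in> sets borel" using P borel_compact A by auto
  from AE_slice_integrable[OF P A(1) bA] show ?thesis
  proof eventually_elim
    case (elim x)
    show ?case
    proof (intro impI, goal_cases)
      case 1
      have i1: "integrable lborel (\<lambda>t. indicator A t *\<^sub>R (complex_of_real ((\<gamma> t \<bullet> e) ^ j / t) * (b (x - \<gamma> t) * f (x - \<gamma> t))))"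
        by (rule integrable_kernel[OF sep A 1 tf Pb(1) b_borel elim])
      have i0: "integrable lborel (\<lambda>t. indicator A t *\<^sub>R (indicator P (x - \<gamma> t) *\<^sub>R b x))"
        by (rule integrableI_bounded_set[where A=A and B="norm (b x)"])
          (use emeasure_bounded_finite[OF bA] in \<open>auto split: split_indicator\<close>)
      have i2: "integrable lborel (\<lambda>t. indicator A t *\<^sub>R (complex_of_real ((\<gamma> t \<bullet> e) ^ j / t) * (b x * f (x - \<gamma> t))))"
        by (rule integrable_kernel[OF sep A 1 tf Pb(1), of "\<lambda>y. b x"]) (use i0 in auto)
      have "integrable lborel (\<lambda>t. indicator A t *\<^sub>R (complex_of_real ((\<gamma> t \<bullet> e) ^ j / t) * ((b x - b (x - \<gamma> t)) * f (x - \<gamma> t))))"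
        using Bochner_Integration.integrable_diff[OF i2 i1] by (simp add: algebra_simps)
      with i1 i2 show ?case by blast
    qed
  qed
qed

lemma AE_curve_commutator:
  assumes sep: "separated \<delta> Q P" and P: "compact P"
    and tf: "test_fun P F f"
  shows "AE x in lborel. x \<in> Q \<longrightarrow> curve_commutator \<gamma> b f x = curve_diff {-1..1} 0 f x"
  using AE_curve_diff_integrable[OF sep _ _ P tf, of "{-1..1}" 0, simplified]
proof eventually_elim
  case (elim x)
  show ?case
  proof
    assume x: "x \<in> Q"
    note f = test_funD[OF tf]
    have [measurable]: "f \<in> borel_measurable borel" by (rule f(1))
    note i = elim[rule_format, OF x]
    have h1: "curve_hilbert \<gamma> f x = (LINT t|lborel. indicator {-1..1} t *\<^sub>R (f (x - \<gamma> t) / complex_of_real t))"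
      by (rule curve_hilbert_separated[OF sep x]) (use f in auto)
    have h2: "curve_hilbert \<gamma> (\<lambda>y. b y * f y) x = (LINT t|lborel. indicator {-1..1} t *\<^sub>R (b (x - \<gamma> t) * f (x - \<gamma> t) / complex_of_real t))"
      by (rule curve_hilbert_separated[OF sep x]) (use f in auto)
    have "b x * curve_hilbert \<gamma> f x = (LINT t|lborel. indicator {-1..1} t *\<^sub>R (b x * f (x - \<gamma> t) / complex_of_real t))"
      unfolding h1 by (subst integral_mult_right_zero[symmetric]) (simp add: algebra_simps)
    then have "curve_commutator \<gamma> b f x = (LINT t|lborel. indicator {-1..1} t *\<^sub>R (b x * f (x - \<gamma> t) / complex_of_real t)
         - indicator {-1..1} t *\<^sub>R (b (x - \<gamma> t) * f (x - \<gamma> t) / complex_of_real t))"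
      unfolding curve_commutator_def h2
      by (subst Bochner_Integration.integral_diff) (use i in auto)
    also have "\<dots> = curve_diff {-1..1} 0 f x" unfolding curve_diff_def
      by (intro Bochner_Integration.integral_cong) (auto simp: algebra_simps diff_divide_distrib)
    finally show "curve_commutator \<gamma> b f x = curve_diff {-1..1} 0 f x" .
  qed
qed

end

section \<open>Testing the commutator norm\<close>

lemma emeasure_bounded_eq:
  fixes A :: "'a::euclidean_space set"
  assumes "bounded A"
  shows "emeasure lborel A = ennreal (measure lborel A)"
  using emeasure_bounded_finite[OF assms] by (intro emeasure_eq_ennreal_measure) auto

text \<open>
This takes the place of the Hoelder inequality: below the height \<open>\<mu>\<close> use \<open>\<mu>\<close>, above it gain from
the p-th power. On sets of comparable measure an \<open>L\<^sup>p\<close> bound turns into an \<open>L\<^sup>1\<close> bound of the same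
size when \<open>\<mu>\<close> is that size.
\<close>

lemma le_add_powr:
  fixes y \<mu> p :: real
  assumes "0 \<le> y" "0 < \<mu>" "1 < p"
  shows "y \<le> \<mu> + \<mu> powr (1 - p) * y powr p"
proof (cases "y \<le> \<mu>")
  case True
  moreover have "0 \<le> \<mu> powr (1 - p) * y powr p" by (intro mult_nonneg_nonneg powr_ge_zero)
  ultimately show ?thesis by linarith
next
  case False
  then have y: "0 < y" "\<mu> \<le> y" using assms by auto
  have "y = y powr (1 - p) * y powr p" unfolding powr_add[symmetric] using y by simp
  also have "\<dots> \<le> \<mu> powr (1 - p) * y powr p"
    using assms y by (intro mult_right_mono powr_mono2') auto
  finally show ?thesis using assms by linarith
qed

text \<open>
A function that is not integrable has Bochner integral 0.
\<close>

lemma norm_integral_le_nn_integral: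
  fixes f :: "'a \<Rightarrow> 'b :: {banach, second_countable_topology}"
  shows "ennreal (norm (integral\<^sup>L M f)) \<le> (\<integral>\<^sup>+ x. ennreal (norm (f x)) \<partial>M)"
  by (cases "integrable M f") (simp_all add: integral_norm_bound_ennreal not_integrable_integral_eq)

text \<open>
The norm takes its p-th root after a conversion to a real number, so the finiteness of the
left-hand integral has to be read off before the inequality can be raised to the power p.
\<close>

lemma nn_integral_powr_le_of_Lp_norm_le:
  assumes p: "1 < p" and N: "0 < N" and le: "Lp_norm p g \<le> N0 * Lp_norm p f" "N0 \<le> ennreal N"
    and f: "(\<integral>\<^sup>+ x. ennreal (norm (f x) powr p) \<partial>lebesgue) \<le> ennreal B" and B: "0 \<le> B"
  shows "(\<integral>\<^sup>+ x. ennreal (norm (g x) powr p) \<partial>lebesgue) \<le> ennreal (N powr p * B)"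
proof -
  define If where "If = (\<integral>\<^sup>+ x. ennreal (norm (f x) powr p) \<partial>lebesgue)"
  define Ig where "Ig = (\<integral>\<^sup>+ x. ennreal (norm (g x) powr p) \<partial>lebesgue)"
  have "If < top" using f ennreal_less_top le_less_trans unfolding If_def by blast
  then obtain i where i: "If = ennreal i" "0 \<le> i" using less_top_ennreal by auto
  have "Lp_norm p f = ennreal (i powr (1 / p))"
    unfolding Lp_norm_def If_def[symmetric] by (simp add: i Let_def)
  then have le2: "Lp_norm p g \<le> ennreal (N * i powr (1 / p))"
  proof -
    have "Lp_norm p g \<le> ennreal N * ennreal (i powr (1 / p))"
      using le \<open>Lp_norm p f = _\<close> by (metis mult_right_mono order_trans zero_le)
    then show ?thesis using N by (simp add: ennreal_mult')
  qed
  then have "Ig \<noteq> \<infinity>" unfolding Lp_norm_def Ig_def[symmetric] Let_def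
    by (auto simp: top_unique split: if_splits)
  then obtain k where k: "Ig = ennreal k" "0 \<le> k" by (metis ennreal_cases infinity_ennreal_def)
  have "Lp_norm p g = ennreal (k powr (1 / p))"
    unfolding Lp_norm_def Ig_def[symmetric] by (simp add: k Let_def)
  with le2 have le3: "k powr (1 / p) \<le> N * i powr (1 / p)" using N by (simp add: ennreal_le_iff)
  have iB: "i \<le> B" using f B i unfolding If_def[symmetric] by (simp add: ennreal_le_iff)
  have "k = (k powr (1 / p)) powr p" using p k by (simp add: powr_powr)
  also have "\<dots> \<le> (N * i powr (1 / p)) powr p" using le3 p by (intro powr_mono2) auto
  also have "\<dots> = N powr p * i" using p i N by (simp add: powr_mult powr_powr)
  also have "\<dots> \<le> N powr p * B" using iB by (intro mult_left_mono) auto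
  finally show ?thesis unfolding Ig_def[symmetric] k(1) by (rule ennreal_leI)
qed

context symbol_on_curve
begin

text \<open>
The commutator norm enters the proof only here. Test functions may be multiplied by any bounded
function of the starting point and of the end point of the step, but not by functions of t.
\<close>

lemma testing:
  assumes p: "1 < p" and N: "0 < N" "commutator_norm \<gamma> p b < ennreal N"
    and sep: "separated \<delta> Q P" and Q: "compact Q" and P: "compact P"
    and tf: "test_fun P F f" and F: "0 < F"
  shows "L1_on Q (curve_diff {-1..1} 0 f)
           \<le> ennreal (F * (N * (measure lborel Q + measure lborel P)))"
proof -
  note f = test_funD[OF tf]
  define T where "T = curve_diff {-1..1} 0 f"
  have [measurable]: "f \<in> borel_measurable borel" "Q \<in> sets borel" "P \<in> sets borel"
    using f P Q borel_compact by auto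
  have [measurable]: "T \<in> borel_measurable borel" unfolding T_def by measurable
  have eP: "emeasure lborel P = ennreal (measure lborel P)" and eQ: "emeasure lborel Q = ennreal (measure lborel Q)"
    using P Q by (auto intro!: emeasure_bounded_eq compact_imp_bounded)
  have bcs: "bounded_compactly_supported f"
    unfolding bounded_compactly_supported_def
  proof (intro conjI)
    show "f \<in> borel_measurable lebesgue" by (intro measurable_completion) simp
    show "bounded (range f)" using f(2) by (auto simp: bounded_iff)
    have "{x. f x \<noteq> 0} \<subseteq> P" using f(3) by auto
    then show "compact (closure {x. f x \<noteq> 0})"
      by (intro compact_closure[THEN iffD2] bounded_subset[OF compact_imp_bounded[OF P]])
  qed
  obtain N0 where N0: "N0 < ennreal N" "Lp_norm p (curve_commutator \<gamma> b f) \<le> N0 * Lp_norm p f"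
    using N(2) bcs unfolding commutator_norm_def Inf_less_iff by blast
  have "(\<integral>\<^sup>+ x. ennreal (norm (f x) powr p) \<partial>lebesgue) = (\<integral>\<^sup>+ x. ennreal (norm (f x) powr p) \<partial>lborel)"
    by (rule nn_integral_completion)
  also have "\<dots> \<le> (\<integral>\<^sup>+ x. ennreal (F powr p) * indicator P x \<partial>lborel)"
    using f p by (intro nn_integral_mono) (auto simp: indicator_def intro!: ennreal_leI powr_mono2)
  also have "\<dots> = ennreal (F powr p * measure lborel P)"
    by (simp add: nn_integral_cmult_indicator eP ennreal_mult')
  finally have If: "(\<integral>\<^sup>+ x. ennreal (norm (f x) powr p) \<partial>lebesgue) \<le> ennreal (F powr p * measure lborel P)" .
  have Ic: "(\<integral>\<^sup>+ x. ennreal (norm (curve_commutator \<gamma> b f x) powr p) \<partial>lebesgue)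
     \<le> ennreal (N powr p * (F powr p * measure lborel P))"
    by (rule nn_integral_powr_le_of_Lp_norm_le[OF p N(1) N0(2) _ If]) (use N0 in auto)
  have ae: "AE x in lborel. x \<in> Q \<longrightarrow> curve_commutator \<gamma> b f x = T x"
    unfolding T_def by (rule AE_curve_commutator[OF sep P tf])
  have "(\<integral>\<^sup>+ x. ennreal (norm (T x) powr p) * indicator Q x \<partial>lborel)
     \<le> (\<integral>\<^sup>+ x. ennreal (norm (curve_commutator \<gamma> b f x) powr p) \<partial>lborel)"
    by (rule nn_integral_mono_AE) (use ae in \<open>eventually_elim, auto simp: indicator_def\<close>)
  also have "\<dots> \<le> ennreal (N powr p * (F powr p * measure lborel P))"
    using Ic by (simp add: nn_integral_completion)
  finally have IT: "(\<integral>\<^sup>+ x. ennreal (norm (T x) powr p) * indicator Q x \<partial>lborel)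
      \<le> ennreal (N powr p * (F powr p * measure lborel P))" .
  \<comment> \<open>This height balances the two terms: each becomes \<open>N * F\<close> times a measure.\<close>
  let ?\<mu> = "N * F"
  have \<mu>: "0 < ?\<mu>" using N F by simp
  have "L1_on Q T
     \<le> (\<integral>\<^sup>+ x. ennreal ?\<mu> * indicator Q x + ennreal (?\<mu> powr (1 - p)) * (ennreal (norm (T x) powr p) * indicator Q x) \<partial>lborel)"
    using le_add_powr[OF norm_ge_zero \<mu> p] \<mu>
    by (intro nn_integral_mono)
      (auto simp: indicator_def simp flip: ennreal_plus ennreal_mult' intro!: ennreal_leI)
  also have "\<dots> = ennreal ?\<mu> * emeasure lborel Q + ennreal (?\<mu> powr (1 - p)) * (\<integral>\<^sup>+ x. ennreal (norm (T x) powr p) * indicator Q x \<partial>lborel)"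
    by (subst nn_integral_add) (auto simp: nn_integral_cmult nn_integral_cmult_indicator)
  also have "\<dots> \<le> ennreal ?\<mu> * ennreal (measure lborel Q) + ennreal (?\<mu> powr (1 - p)) * ennreal (N powr p * (F powr p * measure lborel P))"
    unfolding eQ by (intro add_left_mono mult_left_mono IT) auto
  also have "\<dots> = ennreal (?\<mu> * measure lborel Q + ?\<mu> powr (1 - p) * (N powr p * (F powr p * measure lborel P)))"
    using \<mu> N F by (simp flip: ennreal_mult' ennreal_plus)
  also have "?\<mu> powr (1 - p) * (N powr p * (F powr p * measure lborel P)) = (?\<mu> powr (1 - p) * ?\<mu> powr p) * measure lborel P"
    using N F by (simp add: powr_mult)
  also have "?\<mu> powr (1 - p) * ?\<mu> powr p = ?\<mu>" unfolding powr_add[symmetric] using \<mu> by simp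
  finally show ?thesis unfolding T_def by (simp add: algebra_simps)
qed

text \<open>
A coordinate of the step is the difference of that coordinate at its two ends. One factor
\<open>\<gamma> t \<bullet> e\<close> therefore splits into a multiplication outside the integral and a new test function.
\<close>

lemma curve_diff_Suc:
  assumes sep: "separated \<delta> Q P" and A: "A \<in> sets borel" "A \<subseteq> {-1..1}" and P: "compact P"
    and tf: "test_fun P F f"
    and L: "\<And>y. y \<in> P \<Longrightarrow> \<bar>(y - a) \<bullet> e\<bar> \<le> L" and L0: "0 \<le> L"
  shows "AE x in lborel. x \<in> Q \<longrightarrow> curve_diff A (Suc j) f x
      = complex_of_real ((x - a) \<bullet> e) * curve_diff A j f x
        - curve_diff A j (\<lambda>y. complex_of_real ((y - a) \<bullet> e) * f y) x"
proof -
  note f = test_funD[OF tf]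
  let ?g = "\<lambda>y. complex_of_real ((y - a) \<bullet> e) * f y"
  have F0: "0 \<le> F" using f(2)[of 0] norm_ge_zero order_trans by blast
  have tg: "test_fun P (L * F) ?g"
    unfolding test_fun_def
  proof (intro conjI allI impI)
    show "?g \<in> borel_measurable borel" using f(1) by measurable
    show "norm (?g y) \<le> L * F" for y
      using f(2)[of y] f(3)[of y] L[of y] L0 F0 by (cases "y \<in> P") (auto simp: norm_mult intro!: mult_mono)
    show "?g y = 0" if "y \<notin> P" for y using f(3) that by simp
  qed
  show ?thesis
    using AE_curve_diff_integrable[OF sep A P tf, of j] AE_curve_diff_integrable[OF sep A P tg, of j]
  proof eventually_elim
    case (elim x)
    show ?case
    proof
      assume x: "x \<in> Q"
      let ?k = "\<lambda>t. complex_of_real ((\<gamma> t \<bullet> e) ^ j / t)"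
      let ?c = "complex_of_real ((x - a) \<bullet> e)"
      define U where "U t = indicator A t *\<^sub>R (?k t * ((b x - b (x - \<gamma> t)) * f (x - \<gamma> t)))" for t
      define W where "W t = indicator A t *\<^sub>R (?k t * ((b x - b (x - \<gamma> t)) * ?g (x - \<gamma> t)))" for t
      have iU: "integrable lborel U" and iW: "integrable lborel W"
        using elim x unfolding U_def W_def by blast+
      have "?c * curve_diff A j f x - curve_diff A j ?g x = ?c * (LINT t|lborel. U t) - (LINT t|lborel. W t)"
        unfolding curve_diff_def U_def W_def ..
      also have "\<dots> = (LINT t|lborel. ?c * U t - W t)"
        using iU iW by simp
      also have "\<dots> = curve_diff A (Suc j) f x"
        unfolding curve_diff_def
      proof (rule Bochner_Integration.integral_cong, simp)
        fix t :: real
        have e: "(x - a) \<bullet> e = \<gamma> t \<bullet> e + (x - \<gamma> t - a) \<bullet> e" by (simp add: inner_diff_left)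
        show "?c * U t - W t
          = indicator A t *\<^sub>R (complex_of_real ((\<gamma> t \<bullet> e) ^ Suc j / t) * ((b x - b (x - \<gamma> t)) * f (x - \<gamma> t)))"
        proof -
          have "complex_of_real (g + y) * (i *\<^sub>R (k * (d * m))) - i *\<^sub>R (k * (d * (complex_of_real y * m)))
            = i *\<^sub>R ((complex_of_real g * k) * (d * m))" for g y i k d m
            by (simp add: algebra_simps)
          moreover have "complex_of_real ((\<gamma> t \<bullet> e) ^ Suc j / t) = complex_of_real (\<gamma> t \<bullet> e) * ?k t" by simp
          ultimately show ?thesis unfolding e U_def W_def by (simp only:)
        qed
      qed
      finally show "curve_diff A (Suc j) f x
        = complex_of_real ((x - a) \<bullet> e) * curve_diff A j f x - curve_diff A j ?g x" by simp
    qed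
  qed
qed

text \<open>
Each use of the splitting doubles the number of terms and costs the factor L, the size of the
coordinates; whence \<open>(2 * L) ^ j\<close>.
\<close>

lemma testing_moment:
  assumes p: "1 < p" and N: "0 < N" "commutator_norm \<gamma> p b < ennreal N"
    and sep: "separated \<delta> Q P" and Q: "compact Q" and P: "compact P"
    and L: "\<And>y. y \<in> Q \<union> P \<Longrightarrow> \<bar>(y - a) \<bullet> e\<bar> \<le> L" and L0: "0 < L"
    and tf: "test_fun P F f" and F: "0 < F"
  shows "L1_on Q (curve_diff {-1..1} j f)
           \<le> ennreal ((2 * L) ^ j * (F * (N * (measure lborel Q + measure lborel P))))"
  using tf F
proof (induction j arbitrary: f F)
  case 0
  show ?case using testing[OF p N sep Q P 0] by simp
next
  case (Suc j)
  note f = test_funD[OF Suc.prems(1)] and F = Suc.prems(2)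
  let ?g = "\<lambda>y. complex_of_real ((y - a) \<bullet> e) * f y"
  let ?M = "N * (measure lborel Q + measure lborel P)"
  have [measurable]: "f \<in> borel_measurable borel" "Q \<in> sets borel" "P \<in> sets borel"
    using f P Q borel_compact by auto
  have g [measurable]: "?g \<in> borel_measurable borel" by measurable
  have tg: "test_fun P (L * F) ?g"
    unfolding test_fun_def
  proof (intro conjI allI impI g)
    show "norm (?g y) \<le> L * F" for y
      using f(2)[of y] f(3)[of y] F L[of y] L0 by (cases "y \<in> P") (auto simp: norm_mult intro!: mult_mono)
    show "?g y = 0" if "y \<notin> P" for y using f(3) that by simp
  qed
  have LF: "0 < L * F" using F L0 by simp
  have "L1_on Q (curve_diff {-1..1} (Suc j) f)
     \<le> (\<integral>\<^sup>+ x. ennreal L * (ennreal (norm (curve_diff {-1..1} j f x)) * indicator Q x)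
           + ennreal (norm (curve_diff {-1..1} j ?g x)) * indicator Q x \<partial>lborel)"
  proof (rule nn_integral_mono_AE)
    have "AE x in lborel. x \<in> Q \<longrightarrow> curve_diff {-1..1} (Suc j) f x
      = complex_of_real ((x - a) \<bullet> e) * curve_diff {-1..1} j f x - curve_diff {-1..1} j ?g x"
      by (rule curve_diff_Suc[OF sep _ _ P Suc.prems(1)]) (use L L0 in auto)
    then show "AE x in lborel. ennreal (norm (curve_diff {-1..1} (Suc j) f x)) * indicator Q x
      \<le> ennreal L * (ennreal (norm (curve_diff {-1..1} j f x)) * indicator Q x)
           + ennreal (norm (curve_diff {-1..1} j ?g x)) * indicator Q x"
    proof eventually_elim
      case (elim x)
      show ?case
      proof (cases "x \<in> Q")
        case True
        have "norm (curve_diff {-1..1} (Suc j) f x) \<le> \<bar>(x - a) \<bullet> e\<bar> * norm (curve_diff {-1..1} j f x) + norm (curve_diff {-1..1} j ?g x)"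
          using elim True norm_triangle_ineq4[of "complex_of_real ((x - a) \<bullet> e) * curve_diff {-1..1} j f x" "curve_diff {-1..1} j ?g x"]
          by (simp add: norm_mult)
        also have "\<dots> \<le> L * norm (curve_diff {-1..1} j f x) + norm (curve_diff {-1..1} j ?g x)"
          using L[of x] True by (intro add_right_mono mult_right_mono) auto
        finally show ?thesis using True L0 by (simp flip: ennreal_mult' ennreal_plus add: ennreal_leI)
      qed simp
    qed
  qed
  also have "\<dots> = ennreal L * L1_on Q (curve_diff {-1..1} j f)
      + L1_on Q (curve_diff {-1..1} j ?g)"
    by (subst nn_integral_add) (auto simp: nn_integral_cmult)
  also have "\<dots> \<le> ennreal L * ennreal ((2 * L) ^ j * (F * ?M)) + ennreal ((2 * L) ^ j * (L * F * ?M))"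
    by (intro add_mono mult_left_mono Suc.IH[OF Suc.prems] Suc.IH[OF tg LF]) auto
  also have "\<dots> = ennreal (L * ((2 * L) ^ j * (F * ?M)) + (2 * L) ^ j * (L * F * ?M))"
    using L0 F N by (simp flip: ennreal_mult' ennreal_plus)
  also have "L * ((2 * L) ^ j * (F * ?M)) + (2 * L) ^ j * (L * F * ?M) = (2 * L) ^ Suc j * (F * ?M)"
    by (simp add: algebra_simps)
  finally show ?case .
qed

text \<open>
Far parameters are estimated by absolute values: \<open>1 / t\<close> is at most \<open>1 / r\<close> in size, both ends of the
step are compared with one constant c, and smallness comes from the measure of the set of returns.
\<close>

lemma curve_diff_far:
  assumes sep: "separated \<delta> Q P" and Q: "compact Q" and P: "compact P"
    and diam: "\<And>x y. x \<in> Q \<Longrightarrow> y \<in> P \<Longrightarrow> norm (x - y) \<le> \<rho>"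
    and L: "\<And>y. y \<in> Q \<union> P \<Longrightarrow> \<bar>(y - a) \<bullet> e\<bar> \<le> L" and L0: "0 < L"
    and tf: "test_fun P F f" and F: "0 < F"
    and r: "0 < r"
    and E: "E = (far_returns \<gamma> r \<rho>)"
    and V: "L1_on Q (\<lambda>x. b x - c) \<le> ennreal V"
           "L1_on P (\<lambda>x. b x - c) \<le> ennreal V" and V0: "0 \<le> V"
  shows "L1_on Q (\<lambda>x. curve_diff ({-1..1} - {-r..r}) j f x)
           \<le> ennreal ((2 * L) ^ j * (F * (measure lborel E / r * (2 * V))))"
proof -
  note f = test_funD[OF tf]
  have [measurable]: "f \<in> borel_measurable borel" "Q \<in> sets borel" "P \<in> sets borel"
    using f P Q borel_compact by auto
  have E_sub: "E \<subseteq> {-1..1}" unfolding E by auto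
  have [measurable]: "E \<in> sets borel" unfolding E by measurable
  have eE: "emeasure lborel E = ennreal (measure lborel E)"
    by (rule emeasure_bounded_eq[OF bounded_subset[OF bounded_closed_interval E_sub]])
  let ?K = "(2 * L) ^ j / r * F"
  have K0: "0 \<le> ?K" using L0 r F by simp
  define u where "u x = ennreal (norm (b x - c))" for x
  have [measurable]: "u \<in> borel_measurable borel" unfolding u_def by measurable
  have pt: "norm (indicator ({-1..1} - {-r..r}) t *\<^sub>R (complex_of_real ((\<gamma> t \<bullet> e) ^ j / t) * ((b x - b (x - \<gamma> t)) * f (x - \<gamma> t))))
      \<le> ?K * (indicator E t * (norm (b x - c) + norm (b (x - \<gamma> t) - c) * indicator P (x - \<gamma> t)))"
    if x: "x \<in> Q" for x t
  proof (cases "t \<in> {-1..1} - {-r..r} \<and> x - \<gamma> t \<in> P")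
    case True
    have "\<delta> \<le> norm (\<gamma> t)" "norm (\<gamma> t) \<le> \<rho>" using sep x True diam[of x "x - \<gamma> t"] unfolding separated_def by force+
    then have tE: "t \<in> E" "r \<le> \<bar>t\<bar>" using True sep unfolding E separated_def by auto
    have "\<gamma> t \<bullet> e = (x - a) \<bullet> e - (x - \<gamma> t - a) \<bullet> e" by (simp add: inner_diff_left)
    then have "\<bar>\<gamma> t \<bullet> e\<bar> \<le> 2 * L" using L[of x] L[of "x - \<gamma> t"] x True by auto
    then have "\<bar>(\<gamma> t \<bullet> e) ^ j\<bar> \<le> (2 * L) ^ j" unfolding power_abs by (rule power_mono) simp
    then have "\<bar>(\<gamma> t \<bullet> e) ^ j / t\<bar> \<le> (2 * L) ^ j / r"
      unfolding abs_divide using tE r L0 by (intro frac_le) auto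
    then have "\<bar>(\<gamma> t \<bullet> e) ^ j / t\<bar> * norm (f (x - \<gamma> t)) \<le> ?K"
      using f(2) r L0 F by (intro mult_mono) auto
    moreover have "norm (b x - b (x - \<gamma> t)) \<le> norm (b x - c) + norm (b (x - \<gamma> t) - c)"
      using norm_triangle_ineq4[of "b x - c" "b (x - \<gamma> t) - c"] by simp
    ultimately have "\<bar>(\<gamma> t \<bullet> e) ^ j / t\<bar> * norm (f (x - \<gamma> t)) * norm (b x - b (x - \<gamma> t))
       \<le> ?K * (norm (b x - c) + norm (b (x - \<gamma> t) - c))"
      by (rule mult_mono) (use K0 in auto)
    then show ?thesis using True tE by (simp add: norm_mult ac_simps del: of_real_divide of_real_power)
  next
    case False
    have "0 \<le> ?K * (indicator E t * (norm (b x - c) + norm (b (x - \<gamma> t) - c) * indicator P (x - \<gamma> t)))"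
      by (rule mult_nonneg_nonneg[OF K0]) (auto intro!: mult_nonneg_nonneg add_nonneg_nonneg)
    then show ?thesis using False f(3) by (auto simp: indicator_def)
  qed
  have "L1_on Q (\<lambda>x. curve_diff ({-1..1} - {-r..r}) j f x)
     \<le> (\<integral>\<^sup>+ x. ennreal ?K * ((\<integral>\<^sup>+ t. indicator E t * (u x * indicator Q x) \<partial>lborel)
             + (\<integral>\<^sup>+ t. indicator E t * (u (x - \<gamma> t) * indicator P (x - \<gamma> t)) \<partial>lborel)) \<partial>lborel)"
  proof (rule nn_integral_mono)
    fix x
    show "ennreal (norm (curve_diff ({-1..1} - {-r..r}) j f x)) * indicator Q x
      \<le> ennreal ?K * ((\<integral>\<^sup>+ t. indicator E t * (u x * indicator Q x) \<partial>lborel)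
             + (\<integral>\<^sup>+ t. indicator E t * (u (x - \<gamma> t) * indicator P (x - \<gamma> t)) \<partial>lborel))"
    proof (cases "x \<in> Q")
      case True
      have "ennreal (norm (curve_diff ({-1..1} - {-r..r}) j f x))
        \<le> (\<integral>\<^sup>+ t. ennreal (norm (indicator ({-1..1} - {-r..r}) t *\<^sub>R (complex_of_real ((\<gamma> t \<bullet> e) ^ j / t) * ((b x - b (x - \<gamma> t)) * f (x - \<gamma> t))))) \<partial>lborel)"
        unfolding curve_diff_def by (rule norm_integral_le_nn_integral)
      also have "\<dots> \<le> (\<integral>\<^sup>+ t. ennreal ?K * (indicator E t * (u x * indicator Q x) + indicator E t * (u (x - \<gamma> t) * indicator P (x - \<gamma> t))) \<partial>lborel)"
      proof (rule nn_integral_mono)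
        fix t
        have "ennreal ?K * (indicator E t * (u x * indicator Q x) + indicator E t * (u (x - \<gamma> t) * indicator P (x - \<gamma> t)))
          = ennreal (?K * (indicator E t * (norm (b x - c) + norm (b (x - \<gamma> t) - c) * indicator P (x - \<gamma> t))))"
          using True K0 unfolding u_def by (subst ennreal_mult') (auto simp: indicator_def)
        then show "ennreal (norm (indicator ({-1..1} - {-r..r}) t *\<^sub>R (complex_of_real ((\<gamma> t \<bullet> e) ^ j / t) * ((b x - b (x - \<gamma> t)) * f (x - \<gamma> t)))))
          \<le> ennreal ?K * (indicator E t * (u x * indicator Q x) + indicator E t * (u (x - \<gamma> t) * indicator P (x - \<gamma> t)))"
          using pt[OF True, of t] by (simp only:) (rule ennreal_leI)
      qed
      also have "\<dots> = ennreal ?K * ((\<integral>\<^sup>+ t. indicator E t * (u x * indicator Q x) \<partial>lborel)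
             + (\<integral>\<^sup>+ t. indicator E t * (u (x - \<gamma> t) * indicator P (x - \<gamma> t)) \<partial>lborel))"
        by (subst nn_integral_cmult, measurable, subst nn_integral_add, measurable)
      finally show ?thesis using True by simp
    qed simp
  qed
  also have "\<dots> = ennreal ?K * ((\<integral>\<^sup>+ x. (\<integral>\<^sup>+ t. indicator E t * (u x * indicator Q x) \<partial>lborel) \<partial>lborel)
             + (\<integral>\<^sup>+ x. (\<integral>\<^sup>+ t. indicator E t * (u (x - \<gamma> t) * indicator P (x - \<gamma> t)) \<partial>lborel) \<partial>lborel))"
    by (subst nn_integral_cmult, measurable, subst nn_integral_add, measurable)
  also have "(\<integral>\<^sup>+ x. (\<integral>\<^sup>+ t. indicator E t * (u x * indicator Q x) \<partial>lborel) \<partial>lborel)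
      = emeasure lborel E * (\<integral>\<^sup>+ x. u x * indicator Q x \<partial>lborel)"
    by (simp add: nn_integral_multc nn_integral_cmult)
  also have "(\<integral>\<^sup>+ x. (\<integral>\<^sup>+ t. indicator E t * (u (x - \<gamma> t) * indicator P (x - \<gamma> t)) \<partial>lborel) \<partial>lborel)
      = emeasure lborel E * (\<integral>\<^sup>+ x. u x * indicator P x \<partial>lborel)"
    using nn_integral_shear[of "\<lambda>y. u y * indicator P y" \<gamma> "indicator E"] by simp
  also have "ennreal ?K * (emeasure lborel E * (\<integral>\<^sup>+ x. u x * indicator Q x \<partial>lborel)
       + emeasure lborel E * (\<integral>\<^sup>+ x. u x * indicator P x \<partial>lborel))
     \<le> ennreal ?K * (ennreal (measure lborel E) * ennreal V + ennreal (measure lborel E) * ennreal V)"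
    unfolding eE using V unfolding u_def by (intro mult_left_mono add_mono) auto
  also have "\<dots> = ennreal (?K * (measure lborel E * V + measure lborel E * V))"
    using K0 V0 by (simp flip: ennreal_mult' ennreal_plus)
  also have "?K * (measure lborel E * V + measure lborel E * V) = (2 * L) ^ j * (F * (measure lborel E / r * (2 * V)))"
    using r by (simp add: field_simps)
  finally show ?thesis .
qed

lemma testing_near:
  assumes p: "1 < p" and N: "0 < N" "commutator_norm \<gamma> p b < ennreal N"
    and sep: "separated \<delta> Q P" and Q: "compact Q" and P: "compact P"
    and diam: "\<And>x y. x \<in> Q \<Longrightarrow> y \<in> P \<Longrightarrow> norm (x - y) \<le> \<rho>"
    and L: "\<And>y. y \<in> Q \<union> P \<Longrightarrow> \<bar>(y - a) \<bullet> e\<bar> \<le> L" and L0: "0 < L"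
    and r: "0 < r" "r < 1"
    and E: "E = (far_returns \<gamma> r \<rho>)"
    and V: "L1_on Q (\<lambda>x. b x - c) \<le> ennreal V"
           "L1_on P (\<lambda>x. b x - c) \<le> ennreal V" and V0: "0 \<le> V"
    and tf: "test_fun P F f" and F: "0 < F"
  shows "L1_on Q (curve_diff {-r..r} j f)
           \<le> ennreal ((2 * L) ^ j * (F * (N * (measure lborel Q + measure lborel P) + measure lborel E / r * (2 * V))))"
proof -
  note f = test_funD[OF tf]
  have [measurable]: "f \<in> borel_measurable borel" "Q \<in> sets borel" "P \<in> sets borel"
    using f P Q borel_compact by auto
  let ?far = "{-1..1} - {-r..r}"
  have split: "AE x in lborel. x \<in> Q \<longrightarrow> curve_diff {-1..1} j f x = curve_diff {-r..r} j f x + curve_diff ?far j f x"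
  proof -
    have 1: "{-r..r} \<in> sets borel" "{-r..r} \<subseteq> {-1..1}" and 2: "?far \<in> sets borel" "?far \<subseteq> {-1..1}"
      using r by auto
    show ?thesis
      using AE_curve_diff_integrable[OF sep 1 P tf, of j] AE_curve_diff_integrable[OF sep 2 P tf, of j]
    proof eventually_elim
      case (elim x)
      show ?case
      proof
        assume x: "x \<in> Q"
        show "curve_diff {-1..1} j f x = curve_diff {-r..r} j f x + curve_diff ?far j f x"
        proof -
          define h where "h t = complex_of_real ((\<gamma> t \<bullet> e) ^ j / t) * ((b x - b (x - \<gamma> t)) * f (x - \<gamma> t))" for t
          have i: "integrable lborel (\<lambda>t. indicator {-r..r} t *\<^sub>R h t)" "integrable lborel (\<lambda>t. indicator ?far t *\<^sub>R h t)"
            using elim x unfolding h_def by blast+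
          have "indicator {-1..1} t = (indicator {-r..r} t + indicator ?far t :: real)" for t
            using r by (auto simp: indicator_def)
          then have "(LINT t|lborel. indicator {-1..1} t *\<^sub>R h t)
            = (LINT t|lborel. indicator {-r..r} t *\<^sub>R h t + indicator ?far t *\<^sub>R h t)"
            by (simp only: scaleR_add_left)
          also have "\<dots> = (LINT t|lborel. indicator {-r..r} t *\<^sub>R h t) + (LINT t|lborel. indicator ?far t *\<^sub>R h t)"
            by (rule Bochner_Integration.integral_add[OF i])
          finally show ?thesis unfolding curve_diff_def h_def .
        qed
      qed
    qed
  qed
  have "L1_on Q (curve_diff {-r..r} j f)
    \<le> (\<integral>\<^sup>+ x. ennreal (norm (curve_diff {-1..1} j f x)) * indicator Q x + ennreal (norm (curve_diff ?far j f x)) * indicator Q x \<partial>lborel)"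
  proof (rule nn_integral_mono_AE, use split in eventually_elim)
    case (elim x)
    then show ?case
      using norm_triangle_ineq4[of "curve_diff {-1..1} j f x" "curve_diff ?far j f x"]
      by (auto simp: indicator_def simp flip: ennreal_plus intro!: ennreal_leI)
  qed
  also have "\<dots> = L1_on Q (curve_diff {-1..1} j f)
      + L1_on Q (curve_diff ?far j f)"
    by (rule nn_integral_add) auto
  also have "\<dots> \<le> ennreal ((2 * L) ^ j * (F * (N * (measure lborel Q + measure lborel P))))
      + ennreal ((2 * L) ^ j * (F * (measure lborel E / r * (2 * V))))"
    by (intro add_mono testing_moment[OF p N sep Q P L L0 tf F] curve_diff_far[OF sep Q P diam L L0 tf F r(1) E V V0])
  also have "\<dots> = ennreal ((2 * L) ^ j * (F * (N * (measure lborel Q + measure lborel P) + measure lborel E / r * (2 * V))))"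
    using L0 F N r V0 by (simp flip: ennreal_plus add: algebra_simps)
  finally show ?thesis .
qed

end

section \<open>Two-step paths along a nearly parabolic arc\<close>

text \<open>
On \<open>[-r, r]\<close> the curve and its velocity agree with the parabola \<open>(\<alpha> t, \<beta> t\<^sup>2)\<close> up to the relative error
\<open>\<epsilon>\<close>. The constants below are functions of \<open>\<alpha>\<close> and \<open>\<beta>\<close> alone; this is what allows \<open>\<epsilon>\<close>, and then r, to be
chosen after them.
\<close>

locale near_parabola = orthonormal_frame e1 e2 for e1 e2 :: "real^2" +
  fixes \<gamma> \<gamma>' :: "real \<Rightarrow> real^2" and \<alpha> \<beta> r \<epsilon> :: real
  assumes cont: "continuous_on UNIV \<gamma>" and \<gamma>0: "\<gamma> 0 = 0"
    and \<gamma>'_borel [measurable]: "\<gamma>' \<in> borel_measurable borel"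
    and \<alpha>: "0 < \<alpha>" and \<beta>: "0 < \<beta>" and r: "0 < r" "r < 1" and \<epsilon>: "0 < \<epsilon>" "\<epsilon> \<le> 1 / 10"
    and der: "\<And>t. \<bar>t\<bar> \<le> r \<Longrightarrow> (\<gamma> has_vector_derivative \<gamma>' t) (at t)"
    and near1: "\<And>t. \<bar>t\<bar> \<le> r \<Longrightarrow> \<bar>\<gamma> t \<bullet> e1 - \<alpha> * t\<bar> \<le> \<epsilon> * (\<alpha> * \<bar>t\<bar>)"
    and near2: "\<And>t. \<bar>t\<bar> \<le> r \<Longrightarrow> \<bar>\<gamma> t \<bullet> e2 - \<beta> * t\<^sup>2\<bar> \<le> \<epsilon> * (\<beta> * t\<^sup>2)"
    and near1': "\<And>t. \<bar>t\<bar> \<le> r \<Longrightarrow> \<bar>\<gamma>' t \<bullet> e1 - \<alpha>\<bar> \<le> \<epsilon> * \<alpha>"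
    and near2': "\<And>t. \<bar>t\<bar> \<le> r \<Longrightarrow> \<bar>\<gamma>' t \<bullet> e2 - 2 * \<beta> * t\<bar> \<le> \<epsilon> * (2 * \<beta> * \<bar>t\<bar>)"
begin

text \<open>
The parabola is the graph of \<open>q X\<^sup>2\<close>. Let Q be a rectangle of size l and R its translate by
\<open>\<Lambda> l\<^sup>2\<close> downwards; a point of Q is joined to a point of R by one step to the left (t positive) and one
to the right (s negative). If the first step has horizontal length \<open>2 l\<close>, both steps together descend by at most
\<open>18 q l\<^sup>2 = (\<Lambda> - 1) l\<^sup>2\<close>; if it has length \<open>c2 l\<close>, by at least \<open>(\<Lambda> + 1) l\<^sup>2\<close>. All vertical distances between
Q and R lie in between. Finally \<open>H l\<^sup>2\<close> bounds the descent of the first step, so the intermediate point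
lies in the rectangle P below.
\<close>

definition "q = \<beta> / \<alpha>\<^sup>2"
definition "c2 = 6 + 1 / q"
definition "\<Lambda> = 18 * q + 1"
definition "H = 2 * q * c2\<^sup>2"

lemma q_pos: "0 < q" using \<alpha> \<beta> by (simp add: q_def)
lemma c2_ge: "6 \<le> c2" using q_pos by (simp add: c2_def)
lemma H_pos: "0 < H" using q_pos c2_ge by (simp add: H_def)

lemma g1_bounds:
  assumes "\<bar>t\<bar> \<le> r"
  shows "9 / 10 * \<alpha> * \<bar>t\<bar> \<le> \<bar>\<gamma> t \<bullet> e1\<bar>" "\<bar>\<gamma> t \<bullet> e1\<bar> \<le> 11 / 10 * \<alpha> * \<bar>t\<bar>" "0 < \<gamma> t \<bullet> e1 \<longleftrightarrow> 0 < t" "\<gamma> t \<bullet> e1 < 0 \<longleftrightarrow> t < 0"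
proof -
  have m: "\<epsilon> * (\<alpha> * \<bar>t\<bar>) \<le> 1 / 10 * (\<alpha> * \<bar>t\<bar>)" using \<epsilon> \<alpha> by (intro mult_right_mono) auto
  have n: "\<bar>\<gamma> t \<bullet> e1 - \<alpha> * t\<bar> \<le> 1 / 10 * (\<alpha> * \<bar>t\<bar>)" using near1[OF assms] m by linarith
  have at: "\<bar>\<alpha> * t\<bar> = \<alpha> * \<bar>t\<bar>" using \<alpha> by (simp add: abs_mult)
  show "9 / 10 * \<alpha> * \<bar>t\<bar> \<le> \<bar>\<gamma> t \<bullet> e1\<bar>" "\<bar>\<gamma> t \<bullet> e1\<bar> \<le> 11 / 10 * \<alpha> * \<bar>t\<bar>"
    using n at by linarith+
  have s: "0 < \<alpha> * t \<longleftrightarrow> 0 < t" "\<alpha> * t < 0 \<longleftrightarrow> t < 0" using \<alpha> by (auto simp: zero_less_mult_iff mult_less_0_iff)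
  show "0 < \<gamma> t \<bullet> e1 \<longleftrightarrow> 0 < t" "\<gamma> t \<bullet> e1 < 0 \<longleftrightarrow> t < 0"
    using n at s by linarith+
qed

lemma g2_bounds:
  assumes "\<bar>t\<bar> \<le> r"
  shows "74 / 100 * q * (\<gamma> t \<bullet> e1)\<^sup>2 \<le> \<gamma> t \<bullet> e2" "\<gamma> t \<bullet> e2 \<le> 136 / 100 * q * (\<gamma> t \<bullet> e1)\<^sup>2"
proof -
  let ?u = "\<bar>\<gamma> t \<bullet> e1\<bar>"
  have m: "\<epsilon> * (\<beta> * t\<^sup>2) \<le> 1 / 10 * (\<beta> * t\<^sup>2)" using \<epsilon> \<beta> by (intro mult_right_mono) auto
  have n: "9 / 10 * (\<beta> * t\<^sup>2) \<le> \<gamma> t \<bullet> e2" "\<gamma> t \<bullet> e2 \<le> 11 / 10 * (\<beta> * t\<^sup>2)"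
    using near2[OF assms] m by linarith+
  have "?u\<^sup>2 \<le> (11 / 10 * \<alpha> * \<bar>t\<bar>)\<^sup>2" using g1_bounds(2)[OF assms] by (intro power_mono) auto
  moreover have sq: "(k * \<alpha> * \<bar>t\<bar>)\<^sup>2 = k\<^sup>2 * (\<alpha>\<^sup>2 * t\<^sup>2)" for k by (simp add: power_mult_distrib)
  ultimately have u1: "?u\<^sup>2 \<le> 121 / 100 * (\<alpha>\<^sup>2 * t\<^sup>2)" unfolding sq by (simp add: power_divide)
  have "(9 / 10 * \<alpha> * \<bar>t\<bar>)\<^sup>2 \<le> ?u\<^sup>2" using g1_bounds(1)[OF assms] \<alpha> by (intro power_mono) auto
  then have u2: "81 / 100 * (\<alpha>\<^sup>2 * t\<^sup>2) \<le> ?u\<^sup>2" unfolding sq by (simp add: power_divide)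
  have qa: "q * \<alpha>\<^sup>2 = \<beta>" using \<alpha> by (simp add: q_def)
  have "q * ?u\<^sup>2 \<le> q * (121 / 100 * (\<alpha>\<^sup>2 * t\<^sup>2))" "q * (81 / 100 * (\<alpha>\<^sup>2 * t\<^sup>2)) \<le> q * ?u\<^sup>2"
    using u1 u2 q_pos by (auto intro: mult_left_mono)
  moreover have "q * (k * (\<alpha>\<^sup>2 * t\<^sup>2)) = k * (\<beta> * t\<^sup>2)" for k
    by (subst qa[symmetric]) (simp only: ac_simps)
  moreover have "0 \<le> \<beta> * t\<^sup>2" using \<beta> by simp
  ultimately have "74 / 100 * (q * ?u\<^sup>2) \<le> \<gamma> t \<bullet> e2" "\<gamma> t \<bullet> e2 \<le> 136 / 100 * (q * ?u\<^sup>2)"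
    using n by simp_all
  then show "74 / 100 * q * (\<gamma> t \<bullet> e1)\<^sup>2 \<le> \<gamma> t \<bullet> e2" "\<gamma> t \<bullet> e2 \<le> 136 / 100 * q * (\<gamma> t \<bullet> e1)\<^sup>2" by simp_all
qed

lemma DERIV_inner:
  assumes "\<bar>t\<bar> \<le> r"
  shows "((\<lambda>t. \<gamma> t \<bullet> e) has_real_derivative \<gamma>' t \<bullet> e) (at t)"
  using der[OF assms] unfolding has_vector_derivative_def has_field_derivative_def
  by (auto intro!: derivative_eq_intros simp: mult.commute)

lemma cont_inner: "continuous_on S (\<lambda>t. \<gamma> t \<bullet> e)"
  using continuous_on_subset[OF cont, of S] by (intro continuous_intros) auto

lemma g1'_pos: "\<bar>t\<bar> \<le> r \<Longrightarrow> 0 < \<gamma>' t \<bullet> e1"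
proof -
  assume "\<bar>t\<bar> \<le> r"
  have "\<epsilon> * \<alpha> \<le> 1 / 10 * \<alpha>" using \<epsilon> \<alpha> by (intro mult_right_mono) auto
  then show ?thesis using near1'[OF \<open>\<bar>t\<bar> \<le> r\<close>] \<alpha> by linarith
qed

lemma g1_less: "- r \<le> s \<Longrightarrow> s < t \<Longrightarrow> t \<le> r \<Longrightarrow> \<gamma> s \<bullet> e1 < \<gamma> t \<bullet> e1"
proof (rule DERIV_pos_imp_increasing_open[where f="\<lambda>t. \<gamma> t \<bullet> e1"])
  fix u assume "- r \<le> s" "t \<le> r" "s < u" "u < t"
  then have "\<bar>u\<bar> \<le> r" by auto
  then show "\<exists>y. ((\<lambda>t. \<gamma> t \<bullet> e1) has_real_derivative y) (at u) \<and> 0 < y"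
    using DERIV_inner g1'_pos by blast
qed (auto intro: cont_inner)

lemma g2'_sign: "\<bar>t\<bar> \<le> r \<Longrightarrow> 0 < t \<Longrightarrow> 0 < \<gamma>' t \<bullet> e2" "\<bar>t\<bar> \<le> r \<Longrightarrow> t < 0 \<Longrightarrow> \<gamma>' t \<bullet> e2 < 0"
proof -
  assume t: "\<bar>t\<bar> \<le> r"
  have "\<epsilon> * (2 * \<beta> * \<bar>t\<bar>) \<le> 1 / 10 * (2 * \<beta> * \<bar>t\<bar>)" using \<epsilon> \<beta> by (intro mult_right_mono) auto
  then have n: "\<bar>\<gamma>' t \<bullet> e2 - 2 * \<beta> * t\<bar> \<le> 1 / 10 * (2 * \<beta> * \<bar>t\<bar>)" using near2'[OF t] by linarith
  { assume "0 < t"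
    then have "0 < 2 * \<beta> * t" using \<beta> by simp
    moreover have "\<bar>\<gamma>' t \<bullet> e2 - 2 * \<beta> * t\<bar> \<le> 1 / 10 * (2 * \<beta> * t)" using n \<open>0 < t\<close> by simp
    ultimately show "0 < \<gamma>' t \<bullet> e2" by linarith }
  { assume "t < 0"
    then have "2 * \<beta> * t < 0" using \<beta> by (simp add: mult_less_0_iff)
    moreover have "\<bar>\<gamma>' t \<bullet> e2 - 2 * \<beta> * t\<bar> \<le> - (1 / 10 * (2 * \<beta> * t))" using n \<open>t < 0\<close> by simp
    ultimately show "\<gamma>' t \<bullet> e2 < 0" by linarith }
qed

lemma g2_less: "0 \<le> s \<Longrightarrow> s < t \<Longrightarrow> t \<le> r \<Longrightarrow> \<gamma> s \<bullet> e2 < \<gamma> t \<bullet> e2"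
proof (rule DERIV_pos_imp_increasing_open[where f="\<lambda>t. \<gamma> t \<bullet> e2"])
  fix u assume "0 \<le> s" "t \<le> r" "s < u" "u < t"
  then have "\<bar>u\<bar> \<le> r" "0 < u" by auto
  then show "\<exists>y. ((\<lambda>t. \<gamma> t \<bullet> e2) has_real_derivative y) (at u) \<and> 0 < y"
    using DERIV_inner g2'_sign by blast
qed (auto intro: cont_inner)

lemma g2_greater: "- r \<le> s \<Longrightarrow> s < t \<Longrightarrow> t \<le> 0 \<Longrightarrow> \<gamma> t \<bullet> e2 < \<gamma> s \<bullet> e2"
proof (rule DERIV_neg_imp_decreasing_open[where f="\<lambda>t. \<gamma> t \<bullet> e2"])
  fix u assume "- r \<le> s" "t \<le> 0" "s < u" "u < t"
  then have "\<bar>u\<bar> \<le> r" "u < 0" by auto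
  then show "\<exists>y. ((\<lambda>t. \<gamma> t \<bullet> e2) has_real_derivative y) (at u) \<and> y < 0"
    using DERIV_inner g2'_sign by blast
qed (auto intro: cont_inner)

text \<open>
The first coordinate increases along the curve, the second decreases for negative and increases
for positive parameters. If two paths have the same horizontal displacement and t grows, then s
decreases, and both changes raise the vertical displacement.
\<close>

lemma inj_two_points: "inj_on (\<lambda>(s,t). x - \<gamma> t - \<gamma> s) ({-r..0} \<times> {0..r})"
proof (rule inj_onI)
  fix p p' :: "real \<times> real"
  assume p: "p \<in> {-r..0} \<times> {0..r}" "p' \<in> {-r..0} \<times> {0..r}"
    and eqp: "(\<lambda>(s,t). x - \<gamma> t - \<gamma> s) p = (\<lambda>(s,t). x - \<gamma> t - \<gamma> s) p'"
  obtain s t s' t' where pp: "p = (s, t)" "p' = (s', t')" by (metis surj_pair)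
  have rng: "- r \<le> s" "s \<le> 0" "0 \<le> t" "t \<le> r" "- r \<le> s'" "s' \<le> 0" "0 \<le> t'" "t' \<le> r"
    using p unfolding pp by auto
  have eq: "x - \<gamma> t - \<gamma> s = x - \<gamma> t' - \<gamma> s'" using eqp unfolding pp by simp
  have e: "\<gamma> t \<bullet> e + \<gamma> s \<bullet> e = \<gamma> t' \<bullet> e + \<gamma> s' \<bullet> e" for e
    using arg_cong[OF eq, of "\<lambda>v. v \<bullet> e"] by (simp add: inner_diff_left)
  have key: "\<not> t < t'" if "\<gamma> t \<bullet> e1 + \<gamma> s \<bullet> e1 = \<gamma> t' \<bullet> e1 + \<gamma> s' \<bullet> e1"
    "\<gamma> t \<bullet> e2 + \<gamma> s \<bullet> e2 = \<gamma> t' \<bullet> e2 + \<gamma> s' \<bullet> e2"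
    "- r \<le> s" "s \<le> 0" "0 \<le> t" "t' \<le> r" "- r \<le> s'" "s' \<le> 0" for s t s' t'
  proof
    assume lt: "t < t'"
    have "\<gamma> t \<bullet> e1 < \<gamma> t' \<bullet> e1" using g1_less[of t t'] lt that r by simp
    then have "\<gamma> s' \<bullet> e1 < \<gamma> s \<bullet> e1" using that by simp
    then have "s' < s" using g1_less[of s s'] that r by (cases s s' rule: linorder_cases) auto
    then have "\<gamma> s \<bullet> e2 < \<gamma> s' \<bullet> e2" using g2_greater[of s' s] that by simp
    moreover have "\<gamma> t \<bullet> e2 < \<gamma> t' \<bullet> e2" using g2_less[of t t'] lt that by simp
    ultimately show False using that by simp
  qed
  have "t = t'" using key[OF e e] key[OF e[symmetric] e[symmetric]] rng by (cases t t' rule: linorder_cases) auto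
  moreover have "s = s'"
    using e[of e1] g1_less[of s s'] g1_less[of s' s] rng r \<open>t = t'\<close> by (cases s s' rule: linorder_cases) auto
  ultimately show "p = p'" unfolding pp by simp
qed

definition "Qbox a l = frame_box a l (l\<^sup>2)"
definition "Pbox a l = frame_box (a - (c2 * l) *\<^sub>R e1 - (H * l\<^sup>2) *\<^sub>R e2) ((c2 - 1) * l) ((H + 1) * l\<^sup>2)"
definition "Rbox a l = frame_box (a - (\<Lambda> * l\<^sup>2) *\<^sub>R e2) l (l\<^sup>2)"

lemma frame_coords:
  "(x - (a - u *\<^sub>R e1 - v *\<^sub>R e2)) \<bullet> e1 = (x - a) \<bullet> e1 + u"
  "(x - (a - u *\<^sub>R e1 - v *\<^sub>R e2)) \<bullet> e2 = (x - a) \<bullet> e2 + v"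
  "(x - (a - v *\<^sub>R e2)) \<bullet> e1 = (x - a) \<bullet> e1"
  "(x - (a - v *\<^sub>R e2)) \<bullet> e2 = (x - a) \<bullet> e2 + v"
  by (simp_all add: inner_diff_left e11 e22 e12 inner_commute[of e2 e1])

lemma mem_Qbox: "x \<in> Qbox a l \<longleftrightarrow> 0 \<le> (x - a) \<bullet> e1 \<and> (x - a) \<bullet> e1 \<le> l \<and> 0 \<le> (x - a) \<bullet> e2 \<and> (x - a) \<bullet> e2 \<le> l\<^sup>2"
  by (simp add: Qbox_def frame_box_def)

lemma mem_Pbox: "x \<in> Pbox a l \<longleftrightarrow> - (c2 * l) \<le> (x - a) \<bullet> e1 \<and> (x - a) \<bullet> e1 \<le> - l \<and> - (H * l\<^sup>2) \<le> (x - a) \<bullet> e2 \<and> (x - a) \<bullet> e2 \<le> l\<^sup>2"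
  unfolding Pbox_def frame_box_def mem_Collect_eq frame_coords(1,2) by (auto simp: algebra_simps)

lemma mem_Rbox: "x \<in> Rbox a l \<longleftrightarrow> 0 \<le> (x - a) \<bullet> e1 \<and> (x - a) \<bullet> e1 \<le> l \<and> - (\<Lambda> * l\<^sup>2) \<le> (x - a) \<bullet> e2 \<and> (x - a) \<bullet> e2 \<le> l\<^sup>2 - \<Lambda> * l\<^sup>2"
  unfolding Rbox_def frame_box_def mem_Collect_eq frame_coords(3,4) by (auto simp: algebra_simps)

lemma box_steps:
  assumes l: "0 < l"
  shows "x \<in> Qbox a l \<Longrightarrow> x - \<gamma> t \<in> Pbox a l \<Longrightarrow> l \<le> \<gamma> t \<bullet> e1 \<and> \<gamma> t \<bullet> e1 \<le> (c2 + 1) * l"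
    and "z \<in> Pbox a l \<Longrightarrow> z - \<gamma> s \<in> Rbox a l \<Longrightarrow> - ((c2 + 1) * l) \<le> \<gamma> s \<bullet> e1 \<and> \<gamma> s \<bullet> e1 \<le> - l"
  by (auto simp: mem_Qbox mem_Pbox mem_Rbox inner_diff_left algebra_simps)

text \<open>
For each horizontal length \<open>\<xi>\<close> of the first step the horizontal position of the target fixes the second step.
The resulting vertical displacement depends continuously on \<open>\<xi>\<close>, and the constants were chosen so that
it passes through the required value between \<open>2 l\<close> and \<open>c2 l\<close>.
\<close>

lemma two_step_surj:
  assumes l: "0 < l" "(c2 + 1) * l \<le> \<alpha> * r / 2" and x: "x \<in> Qbox a l" and z: "z \<in> Rbox a l"
  shows "\<exists>s t. \<bar>s\<bar> \<le> r \<and> \<bar>t\<bar> \<le> r \<and> x - \<gamma> t \<in> Pbox a l \<and> x - \<gamma> t - \<gamma> s = z"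
proof -
  define g1 where "g1 t = \<gamma> t \<bullet> e1" for t
  define g2 where "g2 t = \<gamma> t \<bullet> e2" for t
  define M where "M = (c2 + 1) * l"
  have M: "0 < M" using l c2_ge by (simp add: M_def)
  define \<tau> where "\<tau> = inv_into {-r..r} g1"
  have c1: "continuous_on {-r..r} g1" and c2c: "continuous_on {-r..r} g2"
    unfolding g1_def g2_def by (rule cont_inner)+
  have inj: "inj_on g1 {-r..r}"
    unfolding g1_def by (rule linorder_inj_onI') (use g1_less in force)
  have gr: "M \<le> g1 r" "g1 (-r) \<le> - M"
    using g1_bounds(1,3)[of r] g1_bounds(1,4)[of "-r"] r l \<alpha> unfolding g1_def M_def by auto
  have rng: "\<xi> \<in> g1 ` {-r..r}" if "- M \<le> \<xi>" "\<xi> \<le> M" for \<xi>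
    using IVT'[of g1 "-r" \<xi> r] gr that c1 r by auto
  have \<tau>: "\<bar>\<tau> \<xi>\<bar> \<le> r" "g1 (\<tau> \<xi>) = \<xi>" if "- M \<le> \<xi>" "\<xi> \<le> M" for \<xi>
    using inv_into_into[OF rng[OF that]] f_inv_into_f[OF rng[OF that]] unfolding \<tau>_def by auto
  have c\<tau>: "continuous_on (g1 ` {-r..r}) \<tau>"
    unfolding \<tau>_def by (rule continuous_on_inv[OF c1]) (auto simp: inj)
  have c\<tau>M: "continuous_on {-M..M} \<tau>"
    by (rule continuous_on_subset[OF c\<tau>]) (use rng in auto)
  define y1 where "y1 = (x - z) \<bullet> e1"
  define y2 where "y2 = (x - z) \<bullet> e2"
  have y: "- l \<le> y1" "y1 \<le> l" "(\<Lambda> - 1) * l\<^sup>2 \<le> y2" "y2 \<le> (\<Lambda> + 1) * l\<^sup>2"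
    using x z unfolding y1_def y2_def mem_Qbox mem_Rbox by (auto simp: inner_diff_left algebra_simps)
  define \<phi> where "\<phi> \<xi> = g2 (\<tau> \<xi>) + g2 (\<tau> (y1 - \<xi>))" for \<xi>
  have c2l: "2 * l \<le> c2 * l" using c2_ge l by simp
  have Mr: "- M \<le> \<xi>" "\<xi> \<le> M" "- M \<le> y1 - \<xi>" "y1 - \<xi> \<le> M" if "2 * l \<le> \<xi>" "\<xi> \<le> c2 * l" for \<xi>
    using that y l M unfolding M_def by (auto simp: algebra_simps)
  have c\<phi>: "continuous_on {2 * l..c2 * l} \<phi>"
    unfolding \<phi>_def g2_def
    by (intro continuous_on_add continuous_on_compose2[OF cont_inner[of UNIV]]
          continuous_on_compose2[OF c\<tau>M] continuous_intros) (use Mr in auto)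
  have g2\<tau>: "74 / 100 * q * \<xi>\<^sup>2 \<le> g2 (\<tau> \<xi>)" "g2 (\<tau> \<xi>) \<le> 136 / 100 * q * \<xi>\<^sup>2" if "- M \<le> \<xi>" "\<xi> \<le> M" for \<xi>
    using g2_bounds[OF \<tau>(1)[OF that]] \<tau>(2)[OF that] unfolding g1_def g2_def by auto
  have lo: "\<phi> (2 * l) \<le> y2"
  proof -
    have "\<phi> (2 * l) \<le> 136 / 100 * q * (2 * l)\<^sup>2 + 136 / 100 * q * (y1 - 2 * l)\<^sup>2"
      unfolding \<phi>_def by (intro add_mono g2\<tau>(2)) (use Mr[of "2 * l"] c2l in auto)
    also have "(y1 - 2 * l)\<^sup>2 \<le> (3 * l)\<^sup>2" using y l by (intro power2_le_iff_abs_le[THEN iffD2]) auto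
    then have "136 / 100 * q * (2 * l)\<^sup>2 + 136 / 100 * q * (y1 - 2 * l)\<^sup>2 \<le> 136 / 100 * q * (2 * l)\<^sup>2 + 136 / 100 * q * (3 * l)\<^sup>2"
      using q_pos by (intro add_left_mono mult_left_mono) auto
    also have "\<dots> \<le> 18 * q * l\<^sup>2" using q_pos by (simp add: power_mult_distrib)
    also have "\<dots> = (\<Lambda> - 1) * l\<^sup>2" by (simp add: \<Lambda>_def)
    finally show ?thesis using y by linarith
  qed
  have hi: "y2 \<le> \<phi> (c2 * l)"
  proof -
    have "(\<Lambda> + 1) \<le> 74 / 100 * (q * c2\<^sup>2)"
    proof -
      have "q * c2\<^sup>2 = 36 * q + 12 + 1 / q" using q_pos by (simp add: c2_def power2_eq_square field_simps)
      then show ?thesis using q_pos by (simp add: \<Lambda>_def)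
    qed
    then have "(\<Lambda> + 1) * l\<^sup>2 \<le> 74 / 100 * (q * c2\<^sup>2) * l\<^sup>2" by (rule mult_right_mono) simp
    also have "\<dots> = 74 / 100 * q * (c2 * l)\<^sup>2" by (simp add: power_mult_distrib)
    also have "\<dots> \<le> g2 (\<tau> (c2 * l))" using g2\<tau>(1) Mr[of "c2 * l"] c2l by auto
    also have "\<dots> \<le> \<phi> (c2 * l)"
    proof -
      have "0 \<le> 74 / 100 * q * (y1 - c2 * l)\<^sup>2" using q_pos by simp
      also have "\<dots> \<le> g2 (\<tau> (y1 - c2 * l))" using g2\<tau>(1) Mr[of "c2 * l"] c2l by auto
      finally show ?thesis unfolding \<phi>_def by simp
    qed
    finally show ?thesis using y by linarith
  qed
  obtain \<xi> where \<xi>: "2 * l \<le> \<xi>" "\<xi> \<le> c2 * l" "\<phi> \<xi> = y2"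
    using IVT'[OF lo hi c2l c\<phi>] by auto
  define t where "t = \<tau> \<xi>"
  define s where "s = \<tau> (y1 - \<xi>)"
  have st: "\<bar>s\<bar> \<le> r" "\<bar>t\<bar> \<le> r" "g1 t = \<xi>" "g1 s = y1 - \<xi>"
    unfolding s_def t_def using \<tau> Mr[OF \<xi>(1,2)] by auto
  have sum: "g1 t + g1 s = y1" "g2 t + g2 s = y2" using st \<xi>(3) unfolding \<phi>_def s_def t_def by auto
  have "(x - \<gamma> t - \<gamma> s - z) \<bullet> e1 = 0" "(x - \<gamma> t - \<gamma> s - z) \<bullet> e2 = 0"
    using sum unfolding y1_def y2_def g1_def g2_def by (simp_all add: inner_diff_left)
  then have "x - \<gamma> t - \<gamma> s - z = 0" by (subst frame_expand) simp
  moreover have "x - \<gamma> t \<in> Pbox a l"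
  proof -
    have "0 \<le> g2 t" "g2 t \<le> H * l\<^sup>2"
    proof -
      have "0 \<le> 74 / 100 * q * \<xi>\<^sup>2" using q_pos by simp
      then show "0 \<le> g2 t" using g2\<tau>(1)[of \<xi>] Mr[OF \<xi>(1,2)] unfolding t_def by linarith
      have "\<xi>\<^sup>2 \<le> (c2 * l)\<^sup>2" using \<xi> l by (intro power_mono) auto
      then have "q * \<xi>\<^sup>2 \<le> q * (c2 * l)\<^sup>2" using q_pos by (intro mult_left_mono) auto
      moreover have "0 \<le> q * (c2 * l)\<^sup>2" using q_pos by simp
      moreover have "H * l\<^sup>2 = 2 * (q * (c2 * l)\<^sup>2)" by (simp add: H_def power_mult_distrib)
      ultimately show "g2 t \<le> H * l\<^sup>2" using g2\<tau>(2)[of \<xi>] Mr[OF \<xi>(1,2)] unfolding t_def by linarith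
    qed
    then show ?thesis using x st(3) \<xi> l unfolding mem_Pbox mem_Qbox g1_def g2_def
      by (auto simp: inner_diff_left)
  qed
  ultimately show ?thesis using st by auto
qed

text \<open>
For the parabola the Jacobian is \<open>2 \<alpha> \<beta> (t - s)\<close>. Writing X and Z for the horizontal components
\<open>\<alpha> t\<close> and \<open>\<alpha> s\<close> of the steps, this equals \<open>(2 \<beta> / \<alpha>\<^sup>2) X Z (X - Z) / (t s)\<close>: the two singular kernels times a
polynomial in the coordinates, which is the kind of weight that the commutator can be tested with.
Near the parabola every factor is off by a relative error of at most \<open>\<epsilon>\<close>; as s and t have opposite signs
the terms of each sum have equal signs, and the relative errors add up.
\<close>

lemma weight_compare:
  assumes s: "- r \<le> s" "s < 0" and t: "0 < t" "t \<le> r"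
  defines "w \<equiv> \<bar>cross2 (\<gamma>' s) (\<gamma>' t)\<bar>"
    and "w' \<equiv> 2 * \<beta> / \<alpha>\<^sup>2 * (((\<gamma> t \<bullet> e1)\<^sup>2 / t) * ((\<gamma> s \<bullet> e1) / s) - ((\<gamma> t \<bullet> e1) / t) * ((\<gamma> s \<bullet> e1)\<^sup>2 / s))"
  shows "\<bar>w - w'\<bar> \<le> 7 * \<epsilon> * w"
proof -
  have at: "\<bar>t\<bar> \<le> r" and as: "\<bar>s\<bar> \<le> r" using s t by auto
  \<comment> \<open>Each of these quotients is 1 on the exact parabola.\<close>
  define A where "A u = \<gamma>' u \<bullet> e1 / \<alpha>" for u
  define B where "B u = \<gamma>' u \<bullet> e2 / (2 * \<beta> * u)" for u
  define a where "a u = \<gamma> u \<bullet> e1 / (\<alpha> * u)" for u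
  have Ab: "\<bar>A u - 1\<bar> \<le> \<epsilon>" if "\<bar>u\<bar> \<le> r" for u
  proof -
    have "A u - 1 = (\<gamma>' u \<bullet> e1 - \<alpha>) / \<alpha>" using \<alpha> by (simp add: A_def field_simps)
    then show ?thesis using near1'[OF that] \<alpha> by (simp add: divide_le_eq)
  qed
  have Bb: "\<bar>B u - 1\<bar> \<le> \<epsilon>" if "\<bar>u\<bar> \<le> r" "u \<noteq> 0" for u
  proof -
    have "B u - 1 = (\<gamma>' u \<bullet> e2 - 2 * \<beta> * u) / (2 * \<beta> * u)" using \<beta> that by (simp add: B_def field_simps)
    then show ?thesis using near2'[OF that(1)] \<beta> that by (simp add: divide_le_eq abs_mult)
  qed
  have ab: "\<bar>a u - 1\<bar> \<le> \<epsilon>" if "\<bar>u\<bar> \<le> r" "u \<noteq> 0" for u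
  proof -
    have "a u - 1 = (\<gamma> u \<bullet> e1 - \<alpha> * u) / (\<alpha> * u)" using \<alpha> that by (simp add: a_def field_simps)
    then show ?thesis using near1[OF that(1)] \<alpha> that by (simp add: divide_le_eq abs_mult)
  qed
  let ?W = "2 * \<alpha> * \<beta> * (t - s)"
  have W: "0 < ?W" using \<alpha> \<beta> s t by simp
  define lo where "lo = 1 - \<epsilon>"
  define hi where "hi = 1 + \<epsilon>"
  have lohi: "0 < lo" "0 < hi" using \<epsilon> by (auto simp: lo_def hi_def)
  have bnds: "lo \<le> A t" "A t \<le> hi" "lo \<le> A s" "A s \<le> hi" "lo \<le> B t" "B t \<le> hi" "lo \<le> B s" "B s \<le> hi"
      "lo \<le> a t" "a t \<le> hi" "lo \<le> a s" "a s \<le> hi"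
    using Ab[OF at] Ab[OF as] Bb[OF at] Bb[OF as] ab[OF at] ab[OF as] s t
    unfolding lo_def hi_def by (auto simp: abs_le_iff)
  have cr: "w = 2 * \<alpha> * \<beta> * (A s * B t * t + B s * A t * (- s))"
  proof -
    have e: "\<gamma>' t \<bullet> e1 = \<alpha> * A t" "\<gamma>' s \<bullet> e1 = \<alpha> * A s" "\<gamma>' t \<bullet> e2 = 2 * \<beta> * t * B t" "\<gamma>' s \<bullet> e2 = 2 * \<beta> * s * B s"
      using \<alpha> \<beta> s t by (auto simp: A_def B_def)
    have "w = \<bar>2 * \<alpha> * \<beta> * (A s * B t * t + B s * A t * (- s))\<bar>"
      unfolding w_def abs_cross2_frame e by (simp add: algebra_simps)
    moreover have "0 \<le> 2 * \<alpha> * \<beta> * (A s * B t * t + B s * A t * (- s))"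
      using \<alpha> \<beta> s t bnds lohi by (intro mult_nonneg_nonneg add_nonneg_nonneg) auto
    ultimately show ?thesis by simp
  qed
  have w': "w' = 2 * \<alpha> * \<beta> * (a t * a s * (a t * t + a s * (- s)))"
  proof -
    have e: "\<gamma> t \<bullet> e1 = \<alpha> * t * a t" "\<gamma> s \<bullet> e1 = \<alpha> * s * a s"
      using \<alpha> s t by (auto simp: a_def)
    show ?thesis unfolding w'_def e using \<alpha> s t by (simp add: power2_eq_square field_simps)
  qed
  have X: "lo * lo * ?W \<le> w" "w \<le> hi * hi * ?W"
  proof -
    have "lo * lo * t \<le> A s * B t * t" "lo * lo * (- s) \<le> B s * A t * (- s)"
      "A s * B t * t \<le> hi * hi * t" "B s * A t * (- s) \<le> hi * hi * (- s)"
      using bnds lohi s t by (auto intro!: mult_right_mono mult_right_mono_neg mult_mono)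
    then have "lo * lo * (t - s) \<le> A s * B t * t + B s * A t * (- s)" "A s * B t * t + B s * A t * (- s) \<le> hi * hi * (t - s)"
      unfolding right_diff_distrib by linarith+
    then have "2 * \<alpha> * \<beta> * (lo * lo * (t - s)) \<le> w" "w \<le> 2 * \<alpha> * \<beta> * (hi * hi * (t - s))"
      unfolding cr using \<alpha> \<beta> by (auto intro!: mult_left_mono)
    then show "lo * lo * ?W \<le> w" "w \<le> hi * hi * ?W" by (simp_all add: ac_simps)
  qed
  have Y: "lo * lo * lo * ?W \<le> w'" "w' \<le> hi * hi * hi * ?W"
  proof -
    have "lo * t \<le> a t * t" "lo * (- s) \<le> a s * (- s)" "a t * t \<le> hi * t" "a s * (- s) \<le> hi * (- s)"
      using bnds lohi s t by (auto intro!: mult_right_mono mult_right_mono_neg)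
    then have i: "lo * (t - s) \<le> a t * t + a s * (- s)" "a t * t + a s * (- s) \<le> hi * (t - s)"
      unfolding right_diff_distrib by linarith+
    have "lo * lo * (lo * (t - s)) \<le> a t * a s * (a t * t + a s * (- s))"
      using bnds lohi s t i(1) by (intro mult_mono) auto
    moreover have "a t * a s * (a t * t + a s * (- s)) \<le> hi * hi * (hi * (t - s))"
    proof (intro mult_mono i(2))
      have "0 \<le> lo * (t - s)" using lohi s t by auto
      then show "0 \<le> a t * t + a s * (- s)" using i(1) by linarith
    qed (use bnds lohi in auto)
    ultimately have "2 * \<alpha> * \<beta> * (lo * lo * (lo * (t - s))) \<le> w'" "w' \<le> 2 * \<alpha> * \<beta> * (hi * hi * (hi * (t - s)))"
      unfolding w' using \<alpha> \<beta> by (auto intro!: mult_left_mono)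
    then show "lo * lo * lo * ?W \<le> w'" "w' \<le> hi * hi * hi * ?W" by (simp_all add: ac_simps)
  qed
  have e2: "\<epsilon> * \<epsilon> \<le> 1 / 10 * \<epsilon>" using \<epsilon> by (intro mult_right_mono) auto
  have "\<epsilon> * (\<epsilon> * \<epsilon>) \<le> \<epsilon> * (1 / 10 * \<epsilon>)" using e2 \<epsilon> by (intro mult_left_mono) auto
  also have "\<dots> = 1 / 10 * (\<epsilon> * \<epsilon>)" by simp
  finally have e3: "\<epsilon> * (\<epsilon> * \<epsilon>) \<le> 1 / 100 * \<epsilon>" using e2 by linarith
  have e4: "0 \<le> \<epsilon> * (\<epsilon> * \<epsilon>)" using \<epsilon> by simp
  have "hi * hi * hi - lo * lo \<le> 7 * \<epsilon> * (lo * lo)" "hi * hi - lo * lo * lo \<le> 7 * \<epsilon> * (lo * lo)"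
    using e2 e3 e4 \<epsilon> unfolding lo_def hi_def ring_distribs by (simp_all only: mult_1_left mult_1_right)
  note mult_right_mono[OF this(1), of ?W] mult_right_mono[OF this(2), of ?W]
  then have Z: "(hi * hi * hi - lo * lo) * ?W \<le> 7 * \<epsilon> * (lo * lo) * ?W" "(hi * hi - lo * lo * lo) * ?W \<le> 7 * \<epsilon> * (lo * lo) * ?W"
    using W by linarith+
  have T: "7 * \<epsilon> * (lo * lo) * ?W \<le> 7 * \<epsilon> * w"
    using mult_left_mono[OF X(1), of "7 * \<epsilon>"] \<epsilon> by (simp add: ac_simps)
  have "w' - w \<le> hi * hi * hi * ?W - lo * lo * ?W" "w - w' \<le> hi * hi * ?W - lo * lo * lo * ?W"
    using X Y by linarith+
  then have "w' - w \<le> (hi * hi * hi - lo * lo) * ?W" "w - w' \<le> (hi * hi - lo * lo * lo) * ?W"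
    unfolding left_diff_distrib by auto
  then have "w' - w \<le> 7 * \<epsilon> * w" "w - w' \<le> 7 * \<epsilon> * w"
    using order_trans[OF Z(1) T] order_trans[OF Z(2) T] by (auto intro: order_trans)
  then show ?thesis by (intro abs_leI) auto
qed

end

section \<open>The symbol against its average over a second rectangle\<close>

locale near_parabola_symbol = near_parabola +
  fixes b :: "real^2 \<Rightarrow> complex"
  assumes b_meas: "b \<in> borel_measurable borel"
    and b_loc: "\<And>K. compact K \<Longrightarrow> set_integrable lborel K b"

sublocale near_parabola_symbol \<subseteq> symbol_on_curve \<gamma> b e1
  by unfold_locales (use cont \<gamma>0 b_meas b_loc in auto)

context near_parabola
begin

definition "\<kappa> i t = (\<gamma> t \<bullet> e1) ^ i / t"

lemma \<gamma>_meas [measurable]: "\<gamma> \<in> borel_measurable borel"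
  using cont by (rule borel_measurable_continuous_onI)

lemma \<kappa>_meas [measurable]: "\<kappa> i \<in> borel_measurable borel"
  unfolding \<kappa>_def[abs_def] by measurable

lemma \<kappa>_bound:
  assumes t: "\<bar>t\<bar> \<le> r" "\<bar>\<gamma> t \<bullet> e1\<bar> \<le> M"
  shows "\<bar>\<kappa> (Suc i) t\<bar> \<le> 11 / 10 * \<alpha> * M ^ i"
proof (cases "t = 0")
  case True
  have "0 \<le> M" using t by linarith
  then show ?thesis using True \<alpha> by (simp add: \<kappa>_def)
next
  case False
  have "\<bar>\<kappa> (Suc i) t\<bar> = \<bar>\<gamma> t \<bullet> e1\<bar> / \<bar>t\<bar> * \<bar>\<gamma> t \<bullet> e1\<bar> ^ i"
    by (simp add: \<kappa>_def abs_mult power_abs)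
  also have "\<dots> \<le> 11 / 10 * \<alpha> * M ^ i"
  proof (rule mult_mono)
    show "\<bar>\<gamma> t \<bullet> e1\<bar> / \<bar>t\<bar> \<le> 11 / 10 * \<alpha>" using g1_bounds(2)[OF t(1)] False by (simp add: divide_le_eq)
    show "\<bar>\<gamma> t \<bullet> e1\<bar> ^ i \<le> M ^ i" using t by (intro power_mono) auto
  qed (use \<alpha> in auto)
  finally show ?thesis .
qed

text \<open>
At least one power of the step cancels the singularity \<open>1 / t\<close>, and the horizontal bound M confines
t to an interval of length comparable to M.
\<close>

lemma nn_integral_\<kappa>:
  assumes M: "0 \<le> M"
  shows "(\<integral>\<^sup>+ t. indicator {t. \<bar>t\<bar> \<le> r \<and> \<bar>\<gamma> t \<bullet> e1\<bar> \<le> M} t * ennreal \<bar>\<kappa> (Suc i) t\<bar> \<partial>lborel) \<le> ennreal (2 * (2 * M) ^ Suc i)"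
proof -
  define T where "T = M / (9 / 10 * \<alpha>)"
  have T: "0 \<le> T" using M \<alpha> by (simp add: T_def)
  let ?C = "11 / 10 * \<alpha> * M ^ i"
  have C: "0 \<le> ?C" using M \<alpha> by simp
  have "(\<integral>\<^sup>+ t. indicator {t. \<bar>t\<bar> \<le> r \<and> \<bar>\<gamma> t \<bullet> e1\<bar> \<le> M} t * ennreal \<bar>\<kappa> (Suc i) t\<bar> \<partial>lborel)
    \<le> (\<integral>\<^sup>+ t. ennreal ?C * indicator {-T..T} t \<partial>lborel)"
  proof (rule nn_integral_mono)
    fix t
    show "indicator {t. \<bar>t\<bar> \<le> r \<and> \<bar>\<gamma> t \<bullet> e1\<bar> \<le> M} t * ennreal \<bar>\<kappa> (Suc i) t\<bar> \<le> ennreal ?C * indicator {-T..T} t"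
    proof (cases "\<bar>t\<bar> \<le> r \<and> \<bar>\<gamma> t \<bullet> e1\<bar> \<le> M")
      case True
      have "9 / 10 * \<alpha> * \<bar>t\<bar> \<le> M" using g1_bounds(1)[of t] True by linarith
      then have "\<bar>t\<bar> \<le> T" unfolding T_def using \<alpha> by (simp add: field_simps)
      then show ?thesis using True \<kappa>_bound[of t M i] by (simp add: abs_le_iff ennreal_leI)
    qed simp
  qed
  also have "\<dots> = ennreal ?C * emeasure lborel {-T..T}" by (rule nn_integral_cmult_indicator) simp
  also have "emeasure lborel {-T..T} = ennreal (T - (- T))" using T by (intro emeasure_lborel_Icc) simp
  also have "ennreal ?C * ennreal (T - (- T)) = ennreal (?C * (2 * T))" using C T by (subst ennreal_mult[symmetric]) auto
  also have "?C * (2 * T) = 22 / 9 * M ^ Suc i" using \<alpha> by (simp add: T_def field_simps)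
  also have "22 / 9 * M ^ Suc i \<le> 2 * 2 ^ Suc i * M ^ Suc i"
  proof (rule mult_right_mono)
    have "(1::real) \<le> 2 ^ i" by simp
    then show "(22 / 9 :: real) \<le> 2 * 2 ^ Suc i" unfolding power_Suc by linarith
  qed (use M in simp)
  also have "2 * 2 ^ Suc i * M ^ Suc i = 2 * (2 * M) ^ Suc i" by (simp only: power_mult_distrib mult.assoc)
  finally show ?thesis by (simp add: ennreal_leI)
qed

end

locale one_scale = near_parabola_symbol +
  fixes a :: "real^2" and l :: real
  assumes l_pos: "0 < l" and l_small: "(c2 + 1) * l \<le> \<alpha> * r / 2"
begin

abbreviation "Q \<equiv> Qbox a l"
abbreviation "P \<equiv> Pbox a l"
abbreviation "R \<equiv> Rbox a l"
definition "L = (c2 + 1) * l"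

lemma L_pos: "0 < L" using l_pos c2_ge by (simp add: L_def)

lemma boxes_compact: "compact Q" "compact P" "compact R"
  unfolding Qbox_def Pbox_def Rbox_def by (rule compact_frame_box)+

lemma boxes_meas [measurable]: "Q \<in> sets borel" "P \<in> sets borel" "R \<in> sets borel"
  using boxes_compact by (auto intro: borel_compact)

lemma box_coord: "y \<in> Q \<union> P \<Longrightarrow> \<bar>(y - a) \<bullet> e1\<bar> \<le> L" "y \<in> P \<union> R \<Longrightarrow> \<bar>(y - a) \<bullet> e1\<bar> \<le> L"
proof -
  have "l \<le> L" "c2 * l \<le> L" "0 \<le> c2 * l" using l_pos c2_ge by (auto simp: L_def distrib_right)
  then show "y \<in> Q \<union> P \<Longrightarrow> \<bar>(y - a) \<bullet> e1\<bar> \<le> L" "y \<in> P \<union> R \<Longrightarrow> \<bar>(y - a) \<bullet> e1\<bar> \<le> L"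
    using l_pos L_pos by (auto simp: mem_Qbox mem_Pbox mem_Rbox abs_le_iff)
qed

lemma e1_le_norm: "\<bar>v \<bullet> e1\<bar> \<le> norm v"
  using Cauchy_Schwarz_ineq2[of v e1] e11 by (simp add: norm_eq_sqrt_inner)

lemma sep_QP: "separated l Q P"
  unfolding separated_def
proof (intro conjI ballI l_pos)
  fix x y assume "x \<in> Q" "y \<in> P"
  then have "l \<le> (x - y) \<bullet> e1" by (auto simp: mem_Qbox mem_Pbox inner_diff_left)
  then show "l \<le> norm (x - y)" using e1_le_norm[of "x - y"] by linarith
qed

lemma sep_PR: "separated l P R"
  unfolding separated_def
proof (intro conjI ballI l_pos)
  fix x y assume "x \<in> P" "y \<in> R"
  then have "(x - y) \<bullet> e1 \<le> - l" by (auto simp: mem_Rbox mem_Pbox inner_diff_left)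
  then show "l \<le> norm (x - y)" using e1_le_norm[of "x - y"] l_pos by linarith
qed

text \<open>
The parameters \<open>(s, t)\<close> of the two-step paths from x through P to R.
\<close>

definition "S x = {p. \<bar>fst p\<bar> \<le> r \<and> \<bar>snd p\<bar> \<le> r \<and> x - \<gamma> (snd p) \<in> P \<and> x - \<gamma> (snd p) - \<gamma> (fst p) \<in> R}"

lemma S_meas [measurable]: "S x \<in> sets borel"
proof -
  have "S x = {p \<in> space (borel \<Otimes>\<^sub>M borel). \<bar>fst p\<bar> \<le> r \<and> \<bar>snd p\<bar> \<le> r \<and> x - \<gamma> (snd p) \<in> P \<and> x - \<gamma> (snd p) - \<gamma> (fst p) \<in> R}"
    by (auto simp: S_def space_pair_measure)
  also have "\<dots> \<in> sets (borel \<Otimes>\<^sub>M borel)" by measurable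
  finally show ?thesis unfolding borel_prod .
qed

lemma S_D:
  assumes "x \<in> Q" "p \<in> S x"
  shows "0 < snd p" "snd p \<le> r" "fst p < 0" "- r \<le> fst p" "\<bar>\<gamma> (snd p) \<bullet> e1\<bar> \<le> L" "\<bar>\<gamma> (fst p) \<bullet> e1\<bar> \<le> L"
proof -
  have p: "\<bar>fst p\<bar> \<le> r" "\<bar>snd p\<bar> \<le> r" "x - \<gamma> (snd p) \<in> P" "x - \<gamma> (snd p) - \<gamma> (fst p) \<in> R" using assms by (auto simp: S_def)
  note A = box_steps(1)[OF l_pos assms(1) p(3)] and B = box_steps(2)[OF l_pos p(3,4)]
  show "0 < snd p" using g1_bounds(3)[OF p(2)] A l_pos by simp
  show "fst p < 0" using g1_bounds(4)[OF p(1)] B l_pos by simp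
  show "\<bar>\<gamma> (snd p) \<bullet> e1\<bar> \<le> L" "\<bar>\<gamma> (fst p) \<bullet> e1\<bar> \<le> L" using A B l_pos unfolding L_def by auto
qed (use assms in \<open>auto simp: S_def\<close>)

lemma bounded_S: "bounded (S x)"
  by (rule bounded_subset[of "{-r..r} \<times> {-r..r}"]) (auto simp: S_def intro!: bounded_Times)

text \<open>
The Jacobian, and the weight that approximates it by a combination of products of a function of
t with a function of s.
\<close>

definition "jac p = \<bar>cross2 (\<gamma>' (fst p)) (\<gamma>' (snd p))\<bar>"
definition "wt_const = 2 * \<beta> / \<alpha>\<^sup>2"
definition "K i j p = \<kappa> i (snd p) * \<kappa> j (fst p)"
definition "prod_wt p = wt_const * (K 2 1 p - K 1 2 p)"

lemma wt_const_pos: "0 < wt_const" using \<alpha> \<beta> by (simp add: wt_const_def)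

lemma jac_meas [measurable]: "jac \<in> borel_measurable borel"
  unfolding jac_def[abs_def] cross2_alt borel_prod[symmetric] by measurable

lemma K_meas [measurable]: "K i j \<in> borel_measurable borel"
  unfolding K_def[abs_def] borel_prod[symmetric] by measurable

lemma prod_wt_meas [measurable]: "prod_wt \<in> borel_measurable borel"
  unfolding prod_wt_def[abs_def] by measurable

lemma jac_prod_wt: 
  assumes "x \<in> Q" "p \<in> S x"
  shows "\<bar>jac p - prod_wt p\<bar> \<le> 7 * \<epsilon> * jac p" "\<bar>prod_wt p\<bar> \<le> 2 * jac p"
    "\<bar>wt_const * K 2 1 p\<bar> \<le> 2 * jac p" "\<bar>wt_const * K 1 2 p\<bar> \<le> 2 * jac p"
proof -
  note p = S_D[OF assms]
  show 1: "\<bar>jac p - prod_wt p\<bar> \<le> 7 * \<epsilon> * jac p"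
    using weight_compare[OF p(4,3,1,2)] unfolding jac_def prod_wt_def K_def wt_const_def \<kappa>_def by simp
  have w0: "0 \<le> jac p" by (simp add: jac_def)
  have "7 * \<epsilon> * jac p \<le> 1 * jac p" using \<epsilon> w0 by (intro mult_right_mono) auto
  then show 2: "\<bar>prod_wt p\<bar> \<le> 2 * jac p" using 1 by linarith
  have g_sign: "0 < \<gamma> (snd p) \<bullet> e1" "\<gamma> (fst p) \<bullet> e1 < 0" using g1_bounds(3)[of "snd p"] g1_bounds(4)[of "fst p"] p by auto
  have "0 \<le> \<kappa> 2 (snd p)" "0 \<le> \<kappa> 1 (snd p)" "0 \<le> \<kappa> 1 (fst p)" "\<kappa> 2 (fst p) \<le> 0"
    using g_sign p by (auto simp: \<kappa>_def divide_nonneg_neg divide_nonpos_neg)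
  then have "0 \<le> K 2 1 p" "K 1 2 p \<le> 0" by (auto simp: K_def mult_nonneg_nonpos)
  then have "0 \<le> wt_const * K 2 1 p" "wt_const * K 1 2 p \<le> 0" using wt_const_pos by (auto simp: mult_nonneg_nonpos)
  then show "\<bar>wt_const * K 2 1 p\<bar> \<le> 2 * jac p" "\<bar>wt_const * K 1 2 p\<bar> \<le> 2 * jac p"
    using 2 unfolding prod_wt_def right_diff_distrib by linarith+
qed

lemma K_bound:
  assumes "x \<in> Q" "p \<in> S x"
  shows "\<bar>K (Suc i) (Suc j) p\<bar> \<le> (11 / 10 * \<alpha> * L ^ i) * (11 / 10 * \<alpha> * L ^ j)"
proof -
  note p = S_D[OF assms]
  show ?thesis unfolding K_def abs_mult
    by (intro mult_mono \<kappa>_bound) (use p L_pos \<alpha> in auto)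
qed

definition "two_step x p = x - \<gamma> (snd p) - \<gamma> (fst p)"

lemma two_step_meas [measurable]: "two_step x \<in> borel_measurable borel"
  unfolding two_step_def[abs_def] borel_prod[symmetric] by measurable

lemma S_image:
  assumes x: "x \<in> Q"
  shows "(\<lambda>(s,t). x - \<gamma> t - \<gamma> s) ` S x = R"
proof (intro equalityI subsetI)
  fix z assume "z \<in> R"
  from two_step_surj[OF l_pos l_small x this] obtain s t where
    st: "\<bar>s\<bar> \<le> r" "\<bar>t\<bar> \<le> r" "x - \<gamma> t \<in> P" "x - \<gamma> t - \<gamma> s = z" by blast
  then have "(s, t) \<in> S x" using \<open>z \<in> R\<close> by (simp add: S_def)
  then show "z \<in> (\<lambda>(s,t). x - \<gamma> t - \<gamma> s) ` S x" using st by force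
qed (auto simp: S_def)

text \<open>
Every point of R is reached from x by exactly one path, so the paths weighted by the Jacobian
are distributed uniformly over R, whatever the starting point x.
\<close>

lemma distr_S:
  assumes x: "x \<in> Q"
  shows "distr (density lborel (\<lambda>p. ennreal (indicator (S x) p * jac p))) borel (two_step x) = density lborel (\<lambda>z. ennreal (indicator R z))"
proof -
  have wb: "\<bar>cross2 (\<gamma>' s) (\<gamma>' t)\<bar> \<le> (11 / 10 * \<alpha>) * (11 / 5 * \<beta>) + (11 / 5 * \<beta>) * (11 / 10 * \<alpha>)" if "(s, t) \<in> S x" for s t
  proof -
    have st: "\<bar>s\<bar> \<le> r" "\<bar>t\<bar> \<le> r" using that by (auto simp: S_def)
    have A: "\<bar>\<gamma>' u \<bullet> e1\<bar> \<le> 11 / 10 * \<alpha>" if "\<bar>u\<bar> \<le> r" for u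
    proof -
      have "\<epsilon> * \<alpha> \<le> 1 / 10 * \<alpha>" using \<epsilon> \<alpha> by (intro mult_right_mono) auto
      then show ?thesis using near1'[OF that] \<alpha> by linarith
    qed
    have B: "\<bar>\<gamma>' u \<bullet> e2\<bar> \<le> 11 / 5 * \<beta>" if "\<bar>u\<bar> \<le> r" for u
    proof -
      have "\<beta> * \<bar>u\<bar> \<le> \<beta> * 1" using that r \<beta> by (intro mult_left_mono) auto
      moreover have "\<epsilon> * (2 * \<beta> * \<bar>u\<bar>) \<le> 1 / 10 * (2 * \<beta> * \<bar>u\<bar>)" using \<epsilon> \<beta> by (intro mult_right_mono) auto
      moreover have "\<bar>2 * \<beta> * u\<bar> = 2 * (\<beta> * \<bar>u\<bar>)" using \<beta> by (simp add: abs_mult)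
      ultimately show ?thesis using near2'[OF that] by linarith
    qed
    show ?thesis unfolding abs_cross2_frame
      by (rule order_trans[OF abs_triangle_ineq4], unfold abs_mult, intro add_mono mult_mono A B st)
        (use \<alpha> \<beta> in auto)
  qed
  have "distr (density lborel (\<lambda>q. indicator (S x) q * ennreal \<bar>cross2 (\<gamma>' (fst q)) (\<gamma>' (snd q))\<bar>)) borel
           (\<lambda>q. x - \<gamma> (snd q) - \<gamma> (fst q)) = density lborel (indicator R)"
  proof (rule distr_curve_sum[OF _ bounded_S cont _ _ \<gamma>'_borel wb _ S_image[OF x]])
    show "inj_on (\<lambda>(s, t). x - \<gamma> t - \<gamma> s) (S x)"
    proof (rule inj_on_subset[OF inj_two_points], rule subsetI)
      fix p assume "p \<in> S x"
      from S_D[OF x this] show "p \<in> {-r..0} \<times> {0..r}" by (cases p) auto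
    qed
    show "bounded R" using boxes_compact(3) by (rule compact_imp_bounded)
    show "S x \<in> sets borel" "R \<in> sets borel" by measurable
    fix s t assume "(s, t) \<in> S x"
    then have "\<bar>s\<bar> \<le> r" "\<bar>t\<bar> \<le> r" by (auto simp: S_def)
    then show "(\<gamma> has_vector_derivative \<gamma>' s) (at s)" "(\<gamma> has_vector_derivative \<gamma>' t) (at t)" by (auto intro: der)
  qed
  moreover have "indicator (S x) q * ennreal \<bar>cross2 (\<gamma>' (fst q)) (\<gamma>' (snd q))\<bar> = ennreal (indicator (S x) q * jac q)" for q
    by (simp add: jac_def indicator_def)
  moreover have "indicator R = (\<lambda>z. ennreal (indicator R z))" by (auto simp: indicator_def fun_eq_iff)
  ultimately show ?thesis unfolding two_step_def[abs_def] by simp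
qed

lemma nn_integral_S:
  assumes x: "x \<in> Q" and [measurable]: "\<phi> \<in> borel_measurable borel"
  shows "(\<integral>\<^sup>+ p. ennreal (indicator (S x) p * jac p) * \<phi> (two_step x p) \<partial>lborel) = (\<integral>\<^sup>+ z. ennreal (indicator R z) * \<phi> z \<partial>lborel)"
proof -
  have "(\<integral>\<^sup>+ z. \<phi> z \<partial>density lborel (\<lambda>z. ennreal (indicator R z))) = (\<integral>\<^sup>+ z. \<phi> z \<partial>distr (density lborel (\<lambda>p. ennreal (indicator (S x) p * jac p))) borel (two_step x))"
    unfolding distr_S[OF x] ..
  then show ?thesis by (simp add: nn_integral_distr nn_integral_density)
qed

lemma integral_S:
  fixes f :: "real^2 \<Rightarrow> complex"
  assumes x: "x \<in> Q" and [measurable]: "f \<in> borel_measurable borel" and i: "integrable lborel (\<lambda>z. indicator R z *\<^sub>R f z)"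
  shows "integrable lborel (\<lambda>p. (indicator (S x) p * jac p) *\<^sub>R f (two_step x p))"
    and "(LINT p|lborel. (indicator (S x) p * jac p) *\<^sub>R f (two_step x p)) = (LINT z|lborel. indicator R z *\<^sub>R f z)"
proof -
  have w0: "0 \<le> indicator (S x) p * jac p" for p by (simp add: jac_def)
  have m: "two_step x \<in> density lborel (\<lambda>p. ennreal (indicator (S x) p * jac p)) \<rightarrow>\<^sub>M borel" by simp
  have "integrable (density lborel (\<lambda>z. ennreal (indicator R z))) f" using i by (simp add: integrable_density)
  then have "integrable (distr (density lborel (\<lambda>p. ennreal (indicator (S x) p * jac p))) borel (two_step x)) f"
    unfolding distr_S[OF x] .
  then have "integrable (density lborel (\<lambda>p. ennreal (indicator (S x) p * jac p))) (\<lambda>p. f (two_step x p))"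
    by (subst (asm) integrable_distr_eq[OF m]) simp_all
  then show "integrable lborel (\<lambda>p. (indicator (S x) p * jac p) *\<^sub>R f (two_step x p))"
    by (subst (asm) integrable_density) (use w0 in auto)
  have "(LINT z|density lborel (\<lambda>z. ennreal (indicator R z)). f z) = (LINT z|distr (density lborel (\<lambda>p. ennreal (indicator (S x) p * jac p))) borel (two_step x). f z)"
    unfolding distr_S[OF x] ..
  also have "\<dots> = (LINT p|density lborel (\<lambda>p. ennreal (indicator (S x) p * jac p)). f (two_step x p))"
    by (rule integral_distr[OF m]) simp
  also have "\<dots> = (LINT p|lborel. (indicator (S x) p * jac p) *\<^sub>R f (two_step x p))"
    by (rule integral_density) (use w0 in auto)
  finally show "(LINT p|lborel. (indicator (S x) p * jac p) *\<^sub>R f (two_step x p)) = (LINT z|lborel. indicator R z *\<^sub>R f z)"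
    by (simp add: integral_density)
qed

text \<open>
With the exact Jacobian in place of its approximation, \<open>\<Psi> x\<close> would be \<open>measure lborel R\<close> times the
difference of \<open>b x\<close> and the average \<open>bR\<close> of b over R.
\<close>

definition "\<Psi> x = (LINT p|lborel. (indicator (S x) p * prod_wt p) *\<^sub>R (b x - b (two_step x p)))"
definition "\<Theta> i j x = (LINT p|lborel. (indicator (S x) p * K i j p) *\<^sub>R (b x - b (two_step x p)))"
definition "bR = (LINT z|lborel. indicator R z *\<^sub>R b z) / complex_of_real (measure lborel R)"

lemma integrable_R: "integrable lborel (\<lambda>z. indicator R z *\<^sub>R (b x - b z))"
proof -
  have "integrable lborel (\<lambda>z. indicator R z *\<^sub>R b x)"
    using emeasure_bounded_finite[OF compact_imp_bounded[OF boxes_compact(3)]] by (intro integrable_scaleR_left integrable_real_indicator) auto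
  moreover have "integrable lborel (\<lambda>z. indicator R z *\<^sub>R b z)"
    using b_loc[OF boxes_compact(3)] unfolding set_integrable_def .
  ultimately show ?thesis by (simp add: scaleR_diff_right)
qed

lemma integrable_weighted:
  assumes x: "x \<in> Q" and v [measurable]: "v \<in> borel_measurable borel" and vw: "\<And>p. p \<in> S x \<Longrightarrow> \<bar>v p\<bar> \<le> C * jac p"
  shows "integrable lborel (\<lambda>p. (indicator (S x) p * v p) *\<^sub>R (b x - b (two_step x p)))"
proof -
  have i: "integrable lborel (\<lambda>p. C *\<^sub>R ((indicator (S x) p * jac p) *\<^sub>R (b x - b (two_step x p))))"
    by (intro integrable_scaleR_right integral_S(1)[OF x _ integrable_R]) measurable
  show ?thesis
  proof (rule Bochner_Integration.integrable_bound[OF i])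
    show "AE p in lborel. norm ((indicator (S x) p * v p) *\<^sub>R (b x - b (two_step x p))) \<le> norm (C *\<^sub>R ((indicator (S x) p * jac p) *\<^sub>R (b x - b (two_step x p))))"
    proof (rule AE_I2)
      fix p
      show "norm ((indicator (S x) p * v p) *\<^sub>R (b x - b (two_step x p))) \<le> norm (C *\<^sub>R ((indicator (S x) p * jac p) *\<^sub>R (b x - b (two_step x p))))"
      proof (cases "p \<in> S x")
        case True
        have "\<bar>v p\<bar> \<le> \<bar>C\<bar> * \<bar>jac p\<bar>" using vw[OF True] by (metis abs_ge_self abs_mult order_trans)
        then have "\<bar>v p\<bar> * norm (b x - b (two_step x p)) \<le> \<bar>C\<bar> * \<bar>jac p\<bar> * norm (b x - b (two_step x p))" by (rule mult_right_mono) simp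
        then show ?thesis using True by (simp add: ac_simps abs_mult)
      qed simp
    qed
  qed measurable
qed

text \<open>
Exchanging the Jacobian for the approximate weight is a relative error of \<open>7 \<epsilon>\<close>. Undoing the
change of variables in the error term leaves the differences of b integrated over R.
\<close>

lemma oscillation_le_\<Psi>:
  assumes x: "x \<in> Q"
  shows "ennreal (measure lborel R) * ennreal (norm (b x - bR)) \<le> ennreal (norm (\<Psi> x)) + ennreal (7 * \<epsilon>) * (\<integral>\<^sup>+ z. ennreal (indicator R z) * ennreal (norm (b x - b z)) \<partial>lborel)"
proof -
  define A where "A = (LINT p|lborel. (indicator (S x) p * jac p) *\<^sub>R (b x - b (two_step x p)))"
  have iw: "integrable lborel (\<lambda>p. (indicator (S x) p * jac p) *\<^sub>R (b x - b (two_step x p)))"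
    by (rule integrable_weighted[OF x, of jac 1]) (auto simp: jac_def)
  have iw': "integrable lborel (\<lambda>p. (indicator (S x) p * prod_wt p) *\<^sub>R (b x - b (two_step x p)))"
    by (rule integrable_weighted[OF x, of prod_wt 2]) (use jac_prod_wt[OF x] in auto)
  have R0: "measure lborel R = l * l\<^sup>2" unfolding Rbox_def using l_pos by (simp add: measure_frame_box)
  have "A = (LINT z|lborel. indicator R z *\<^sub>R (b x - b z))"
    unfolding A_def by (rule integral_S(2)[OF x _ integrable_R]) measurable
  also have "\<dots> = (LINT z|lborel. indicator R z *\<^sub>R b x) - (LINT z|lborel. indicator R z *\<^sub>R b z)"
    unfolding scaleR_diff_right
  proof (rule Bochner_Integration.integral_diff)
    show "integrable lborel (\<lambda>z. indicator R z *\<^sub>R b x)"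
      using emeasure_bounded_finite[OF compact_imp_bounded[OF boxes_compact(3)]] by (intro integrable_scaleR_left integrable_real_indicator) auto
    show "integrable lborel (\<lambda>z. indicator R z *\<^sub>R b z)"
      using b_loc[OF boxes_compact(3)] unfolding set_integrable_def .
  qed
  also have "(LINT z|lborel. indicator R z *\<^sub>R b x) = (LINT z|lborel. indicator R z) *\<^sub>R b x"
    using emeasure_bounded_finite[OF compact_imp_bounded[OF boxes_compact(3)]] by (intro integral_scaleR_left integrable_real_indicator) auto
  also have "(LINT z|lborel. indicator R z) = measure lborel R" by simp
  also have "(LINT z|lborel. indicator R z *\<^sub>R b z) = measure lborel R *\<^sub>R bR"
    unfolding bR_def using R0 l_pos by (simp add: scaleR_conv_of_real)
  finally have A: "norm A = measure lborel R * norm (b x - bR)"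
    by (simp flip: scaleR_diff_right)
  have "ennreal (norm (A - \<Psi> x)) = ennreal (norm (LINT p|lborel. (indicator (S x) p * (jac p - prod_wt p)) *\<^sub>R (b x - b (two_step x p))))"
    unfolding A_def \<Psi>_def by (subst Bochner_Integration.integral_diff[OF iw iw', symmetric]) (simp add: algebra_simps)
  also have "\<dots> \<le> (\<integral>\<^sup>+ p. ennreal (norm ((indicator (S x) p * (jac p - prod_wt p)) *\<^sub>R (b x - b (two_step x p)))) \<partial>lborel)"
    by (rule norm_integral_le_nn_integral)
  also have "\<dots> \<le> (\<integral>\<^sup>+ p. ennreal (7 * \<epsilon>) * (ennreal (indicator (S x) p * jac p) * ennreal (norm (b x - b (two_step x p)))) \<partial>lborel)"
  proof (rule nn_integral_mono)
    fix p
    show "ennreal (norm ((indicator (S x) p * (jac p - prod_wt p)) *\<^sub>R (b x - b (two_step x p)))) \<le> ennreal (7 * \<epsilon>) * (ennreal (indicator (S x) p * jac p) * ennreal (norm (b x - b (two_step x p))))"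
    proof (cases "p \<in> S x")
      case True
      have "\<bar>jac p - prod_wt p\<bar> * norm (b x - b (two_step x p)) \<le> 7 * \<epsilon> * jac p * norm (b x - b (two_step x p))"
        using jac_prod_wt(1)[OF x True] by (rule mult_right_mono) simp
      then show ?thesis using True \<epsilon> by (simp add: jac_def ac_simps ennreal_leI flip: ennreal_mult')
    qed simp
  qed
  also have "\<dots> = ennreal (7 * \<epsilon>) * (\<integral>\<^sup>+ z. ennreal (indicator R z) * ennreal (norm (b x - b z)) \<partial>lborel)"
    by (subst nn_integral_cmult, measurable, subst nn_integral_S[OF x, of "\<lambda>z. ennreal (norm (b x - b z))"]) auto
  finally have D: "ennreal (norm (A - \<Psi> x)) \<le> ennreal (7 * \<epsilon>) * (\<integral>\<^sup>+ z. ennreal (indicator R z) * ennreal (norm (b x - b z)) \<partial>lborel)" .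
  have "ennreal (measure lborel R) * ennreal (norm (b x - bR)) = ennreal (norm A)" unfolding A by (simp add: ennreal_mult')
  also have "\<dots> \<le> ennreal (norm (\<Psi> x) + norm (A - \<Psi> x))"
    using norm_triangle_sub[of A "\<Psi> x"] by (intro ennreal_leI) auto
  also have "\<dots> = ennreal (norm (\<Psi> x)) + ennreal (norm (A - \<Psi> x))" by simp
  finally show ?thesis using D by (meson add_left_mono order_trans)
qed

lemma integrable_\<Theta>:
  assumes x: "x \<in> Q"
  shows "integrable lborel (\<lambda>p. (indicator (S x) p * K 2 1 p) *\<^sub>R (b x - b (two_step x p)))"
    "integrable lborel (\<lambda>p. (indicator (S x) p * K 1 2 p) *\<^sub>R (b x - b (two_step x p)))"
proof -
  have "\<bar>K 2 1 p\<bar> \<le> 2 / wt_const * jac p" "\<bar>K 1 2 p\<bar> \<le> 2 / wt_const * jac p" if "p \<in> S x" for p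
    using jac_prod_wt(3,4)[OF x that] wt_const_pos by (auto simp: abs_mult field_simps)
  then show "integrable lborel (\<lambda>p. (indicator (S x) p * K 2 1 p) *\<^sub>R (b x - b (two_step x p)))"
    "integrable lborel (\<lambda>p. (indicator (S x) p * K 1 2 p) *\<^sub>R (b x - b (two_step x p)))"
    using integrable_weighted[OF x, of "K 2 1" "2 / wt_const"] integrable_weighted[OF x, of "K 1 2" "2 / wt_const"] by auto
qed

lemma \<Psi>_eq:
  assumes x: "x \<in> Q"
  shows "\<Psi> x = wt_const *\<^sub>R (\<Theta> 2 1 x - \<Theta> 1 2 x)"
proof -
  note i = integrable_\<Theta>[OF x]
  have "\<Psi> x = (LINT p|lborel. wt_const *\<^sub>R ((indicator (S x) p * K 2 1 p) *\<^sub>R (b x - b (two_step x p)) - (indicator (S x) p * K 1 2 p) *\<^sub>R (b x - b (two_step x p))))"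
    unfolding \<Psi>_def prod_wt_def by (intro Bochner_Integration.integral_cong) (simp_all add: algebra_simps)
  also have "\<dots> = wt_const *\<^sub>R ((LINT p|lborel. (indicator (S x) p * K 2 1 p) *\<^sub>R (b x - b (two_step x p))) - (LINT p|lborel. (indicator (S x) p * K 1 2 p) *\<^sub>R (b x - b (two_step x p))))"
    unfolding Bochner_Integration.integral_diff[OF i, symmetric]
    by (rule integral_scaleR_right)
  also have "\<dots> = wt_const *\<^sub>R (\<Theta> 2 1 x - \<Theta> 1 2 x)" unfolding \<Theta>_def ..
  finally show ?thesis .
qed

end

section \<open>Splitting the two steps\<close>

context one_scale
begin

text \<open>
The two legs of a path are handled separately, as \<open>b x - b z = (b x - b y) + (b y - b z)\<close> with the
intermediate point y. In the first summand the integration over s produces a function of y alone,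
which then serves as the test function; in the second summand the integration over s produces the
commutator tested on R, which is then averaged over the first leg.
\<close>

definition "moment j z = (LINT s|lborel. indicator {-r..r} s *\<^sub>R (complex_of_real (\<kappa> j s) * indicator R (z - \<gamma> s)))"
definition "moment_on_P j y = indicator P y * moment j y"
definition "second_leg i j x = (LINT t|lborel. indicator {-r..r} t *\<^sub>R
   (complex_of_real (\<kappa> i t) * (indicator P (x - \<gamma> t) * curve_diff {-r..r} j (indicator R) (x - \<gamma> t))))"

lemma moment_meas [measurable]: "moment j \<in> borel_measurable borel"
proof -
  have "(\<lambda>z. LINT s|lborel. indicator {-r..r} s *\<^sub>R (complex_of_real (\<kappa> j s) * indicator R (z - \<gamma> s))) \<in> borel_measurable lborel"
    by measurable
  then show ?thesis unfolding moment_def[abs_def] by simp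
qed

lemma moment_on_P_test: "test_fun P (2 * (2 * L) ^ Suc j) (moment_on_P (Suc j))"
  unfolding test_fun_def
proof (intro conjI allI impI)
  show "moment_on_P (Suc j) \<in> borel_measurable borel" unfolding moment_on_P_def[abs_def] by measurable
  show "moment_on_P (Suc j) y = 0" if "y \<notin> P" for y using that by (simp add: moment_on_P_def)
  show "norm (moment_on_P (Suc j) y) \<le> 2 * (2 * L) ^ Suc j" for y
  proof (cases "y \<in> P")
    case True
    have "ennreal (norm (moment (Suc j) y)) \<le> (\<integral>\<^sup>+ s. ennreal (norm (indicator {-r..r} s *\<^sub>R (complex_of_real (\<kappa> (Suc j) s) * indicator R (y - \<gamma> s)))) \<partial>lborel)"
      unfolding moment_def by (rule norm_integral_le_nn_integral)
    also have "\<dots> \<le> (\<integral>\<^sup>+ t. indicator {t. \<bar>t\<bar> \<le> r \<and> \<bar>\<gamma> t \<bullet> e1\<bar> \<le> L} t * ennreal \<bar>\<kappa> (Suc j) t\<bar> \<partial>lborel)"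
    proof (rule nn_integral_mono)
      fix s
      show "ennreal (norm (indicator {-r..r} s *\<^sub>R (complex_of_real (\<kappa> (Suc j) s) * indicator R (y - \<gamma> s))))
        \<le> indicator {t. \<bar>t\<bar> \<le> r \<and> \<bar>\<gamma> t \<bullet> e1\<bar> \<le> L} s * ennreal \<bar>\<kappa> (Suc j) s\<bar>"
      proof (cases "s \<in> {-r..r} \<and> y - \<gamma> s \<in> R")
        case True
        then have "\<bar>\<gamma> s \<bullet> e1\<bar> \<le> L" using box_steps(2)[OF l_pos \<open>y \<in> P\<close>] l_pos unfolding L_def by force
        then show ?thesis using True by (auto simp: indicator_def norm_mult abs_le_iff)
      qed (auto simp: indicator_def)
    qed
    also have "\<dots> \<le> ennreal (2 * (2 * L) ^ Suc j)" using L_pos by (intro nn_integral_\<kappa>) simp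
    finally show ?thesis using True L_pos by (simp add: moment_on_P_def norm_mult ennreal_le_iff)
  qed (use L_pos in \<open>simp add: moment_on_P_def\<close>)
qed

lemma integrable_slice_prod:
  fixes h :: "real \<Rightarrow> complex"
  assumes h: "integrable lborel h"
  shows "integrable lborel (\<lambda>p::real \<times> real. indicator {-r..r} (fst p) *\<^sub>R h (snd p))"
proof (rule integrableI_bounded)
  have [measurable]: "h \<in> borel_measurable borel" using h by (simp add: borel_measurable_integrable[of lborel, simplified])
  show "(\<lambda>p::real \<times> real. indicator {-r..r} (fst p) *\<^sub>R h (snd p)) \<in> borel_measurable lborel"
    unfolding lborel_prod[symmetric] by measurable
  have "(\<integral>\<^sup>+ p. ennreal (norm (indicator {-r..r} (fst p) *\<^sub>R h (snd p))) \<partial>(lborel :: (real \<times> real) measure))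
    = (\<integral>\<^sup>+ s. (\<integral>\<^sup>+ t. ennreal (norm (indicator {-r..r} s *\<^sub>R h t)) \<partial>lborel) \<partial>lborel)"
    unfolding lborel_prod[symmetric] by (subst lborel.nn_integral_fst[symmetric]) auto
  also have "\<dots> = (\<integral>\<^sup>+ s. indicator {-r..r} s * (\<integral>\<^sup>+ t. ennreal (norm (h t)) \<partial>lborel) \<partial>lborel)"
    by (intro nn_integral_cong) (auto simp: indicator_def)
  also have "\<dots> = emeasure lborel {-r..r} * (\<integral>\<^sup>+ t. ennreal (norm (h t)) \<partial>lborel)"
    by (subst nn_integral_multc) auto
  also have "\<dots> < \<infinity>"
    using h emeasure_bounded_finite[of "{-r..r}"] unfolding integrable_iff_bounded by (simp add: ennreal_mult_less_top)
  finally show "(\<integral>\<^sup>+ p. ennreal (norm (indicator {-r..r} (fst p) *\<^sub>R h (snd p))) \<partial>(lborel :: (real \<times> real) measure)) < \<infinity>" .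
qed

lemma integral_prod_snd:
  fixes F :: "real \<times> real \<Rightarrow> complex"
  assumes "integrable lborel F"
  shows "(LINT p|lborel. F p) = (LINT t|lborel. (LINT s|lborel. F (s, t)))"
  using lborel_pair.integral_snd[of "\<lambda>s t. F (s, t)"] assms by (simp add: lborel_prod)

lemma ind_S: "indicator (S x) (s, t) = (indicator {-r..r} s * indicator {-r..r} t * indicator P (x - \<gamma> t) * indicator R (x - \<gamma> t - \<gamma> s) :: real)"
  by (auto simp: S_def indicator_def abs_le_iff)

text \<open>
Fubini for both legs. The hypothesis on the slice through x, which holds for almost every x,
makes the first leg integrable; the second leg is the whole minus the first one.
\<close>

lemma \<Theta>_split:
  assumes x: "x \<in> Q"
    and slice: "integrable lborel (\<lambda>t. indicator {-r..r} t *\<^sub>R (indicator P (x - \<gamma> t) *\<^sub>R b (x - \<gamma> t)))"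
    and i\<Theta>: "integrable lborel (\<lambda>p. (indicator (S x) p * K i j p) *\<^sub>R (b x - b (two_step x p)))"
    and KC: "\<And>p. p \<in> S x \<Longrightarrow> \<bar>K i j p\<bar> \<le> C"
  shows "\<Theta> i j x = curve_diff {-r..r} i (moment_on_P j) x + second_leg i j x"
proof -
  define U where "U p = (indicator (S x) p * K i j p) *\<^sub>R (b x - b (x - \<gamma> (snd p)))" for p
  define V where "V p = (indicator (S x) p * K i j p) *\<^sub>R (b (x - \<gamma> (snd p)) - b (two_step x p))" for p
  define h where "h t = indicator {-r..r} t *\<^sub>R (indicator P (x - \<gamma> t) *\<^sub>R (b x - b (x - \<gamma> t)))" for t
  have "integrable lborel (\<lambda>t. indicator {-r..r} t *\<^sub>R (indicator P (x - \<gamma> t) *\<^sub>R b x))"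
    by (rule integrableI_bounded_set[where A="{-r..r}" and B="norm (b x)"])
      (use emeasure_bounded_finite[of "{-r..r}"] in \<open>auto split: split_indicator\<close>)
  from Bochner_Integration.integrable_diff[OF this slice] have "integrable lborel h"
    unfolding h_def by (simp add: scaleR_diff_right)
  from integrable_scaleR_right[OF integrable_slice_prod[OF this], of C]
  have ih: "integrable lborel (\<lambda>p::real \<times> real. C *\<^sub>R (indicator {-r..r} (fst p) *\<^sub>R h (snd p)))" .
  have iU: "integrable lborel U"
  proof (rule Bochner_Integration.integrable_bound[OF ih])
    have [measurable]: "(\<lambda>p::real \<times> real. x - \<gamma> (snd p)) \<in> borel_measurable borel"
      unfolding borel_prod[symmetric] by measurable
    show "U \<in> borel_measurable lborel" unfolding U_def[abs_def] by measurable
    show "AE p in lborel. norm (U p) \<le> norm (C *\<^sub>R (indicator {-r..r} (fst p) *\<^sub>R h (snd p)))"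
    proof (rule AE_I2)
      fix p
      show "norm (U p) \<le> norm (C *\<^sub>R (indicator {-r..r} (fst p) *\<^sub>R h (snd p)))"
      proof (cases "p \<in> S x")
        case True
        then have "\<bar>K i j p\<bar> \<le> \<bar>C\<bar>" using KC by (metis abs_ge_self order_trans)
        then have "\<bar>K i j p\<bar> * norm (b x - b (x - \<gamma> (snd p))) \<le> \<bar>C\<bar> * norm (b x - b (x - \<gamma> (snd p)))"
          by (rule mult_right_mono) simp
        then show ?thesis using True by (simp add: U_def h_def S_def abs_le_iff)
      qed (simp add: U_def)
    qed
  qed
  have VW: "V = (\<lambda>p. (indicator (S x) p * K i j p) *\<^sub>R (b x - b (two_step x p)) - U p)"
    by (simp add: V_def U_def fun_eq_iff flip: scaleR_diff_right)
  have iV: "integrable lborel V" unfolding VW by (rule Bochner_Integration.integrable_diff[OF i\<Theta> iU])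
  have "\<Theta> i j x = (LINT p|lborel. U p + V p)" unfolding \<Theta>_def VW by simp
  also have "\<dots> = (LINT p|lborel. U p) + (LINT p|lborel. V p)" by (rule Bochner_Integration.integral_add[OF iU iV])
  also have "(LINT p|lborel. U p) = (LINT t|lborel. LINT s|lborel. U (s, t))" by (rule integral_prod_snd[OF iU])
  also have "\<dots> = curve_diff {-r..r} i (moment_on_P j) x"
    unfolding curve_diff_def
  proof (rule Bochner_Integration.integral_cong, simp)
    fix t
    let ?c = "indicator {-r..r} t *\<^sub>R (complex_of_real (\<kappa> i t) * ((b x - b (x - \<gamma> t)) * indicator P (x - \<gamma> t)))"
    have "U (s, t) = ?c * (indicator {-r..r} s *\<^sub>R (complex_of_real (\<kappa> j s) * indicator R (x - \<gamma> t - \<gamma> s)))" for s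
      unfolding U_def ind_S K_def by (auto simp: indicator_def scaleR_conv_of_real)
    then have "(LINT s|lborel. U (s, t)) = ?c * moment j (x - \<gamma> t)"
      unfolding moment_def by (simp only: integral_mult_right_zero)
    then show "(LINT s|lborel. U (s, t)) = indicator {-r..r} t *\<^sub>R (complex_of_real ((\<gamma> t \<bullet> e1) ^ i / t) * ((b x - b (x - \<gamma> t)) * moment_on_P j (x - \<gamma> t)))"
      by (simp add: moment_on_P_def \<kappa>_def)
  qed
  also have "(LINT p|lborel. V p) = (LINT t|lborel. LINT s|lborel. V (s, t))" by (rule integral_prod_snd[OF iV])
  also have "\<dots> = second_leg i j x"
    unfolding second_leg_def
  proof (rule Bochner_Integration.integral_cong, simp)
    fix t
    let ?c = "indicator {-r..r} t *\<^sub>R (complex_of_real (\<kappa> i t) * indicator P (x - \<gamma> t))"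
    have "V (s, t) = ?c * (indicator {-r..r} s *\<^sub>R (complex_of_real ((\<gamma> s \<bullet> e1) ^ j / s) * ((b (x - \<gamma> t) - b (x - \<gamma> t - \<gamma> s)) * indicator R (x - \<gamma> t - \<gamma> s))))" for s
      unfolding V_def ind_S K_def two_step_def \<kappa>_def by (auto simp: indicator_def scaleR_conv_of_real)
    then have "(LINT s|lborel. V (s, t)) = ?c * curve_diff {-r..r} j (indicator R) (x - \<gamma> t)"
      unfolding curve_diff_def by (simp only: integral_mult_right_zero)
    then show "(LINT s|lborel. V (s, t)) = indicator {-r..r} t *\<^sub>R
      (complex_of_real (\<kappa> i t) * (indicator P (x - \<gamma> t) * curve_diff {-r..r} j (indicator R) (x - \<gamma> t)))"
      by simp
  qed
  finally show ?thesis .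
qed

lemma second_leg_meas [measurable]: "second_leg i j \<in> borel_measurable borel"
proof -
  have "(\<lambda>x. LINT t|lborel. indicator {-r..r} t *\<^sub>R
   (complex_of_real (\<kappa> i t) * (indicator P (x - \<gamma> t) * curve_diff {-r..r} j (indicator R) (x - \<gamma> t)))) \<in> borel_measurable lborel"
    by measurable
  then show ?thesis unfolding second_leg_def[abs_def] by simp
qed

lemma nn_integral_second_leg:
  "L1_on Q (second_leg (Suc i) j)
     \<le> ennreal (2 * (2 * L) ^ Suc i) * L1_on P (curve_diff {-r..r} j (indicator R))"
proof -
  let ?D = "\<lambda>y. ennreal (norm (curve_diff {-r..r} j (indicator R) y)) * indicator P y"
  let ?k = "\<lambda>t. indicator {t. \<bar>t\<bar> \<le> r \<and> \<bar>\<gamma> t \<bullet> e1\<bar> \<le> L} t * ennreal \<bar>\<kappa> (Suc i) t\<bar>"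
  have "L1_on Q (second_leg (Suc i) j)
    \<le> (\<integral>\<^sup>+ x. (\<integral>\<^sup>+ t. ?k t * ?D (x - \<gamma> t) \<partial>lborel) \<partial>lborel)"
  proof (rule nn_integral_mono)
    fix x
    show "ennreal (norm (second_leg (Suc i) j x)) * indicator Q x \<le> (\<integral>\<^sup>+ t. ?k t * ?D (x - \<gamma> t) \<partial>lborel)"
    proof (cases "x \<in> Q")
      case True
      have "ennreal (norm (second_leg (Suc i) j x)) \<le> (\<integral>\<^sup>+ t. ennreal (norm (indicator {-r..r} t *\<^sub>R
         (complex_of_real (\<kappa> (Suc i) t) * (indicator P (x - \<gamma> t) * curve_diff {-r..r} j (indicator R) (x - \<gamma> t))))) \<partial>lborel)"
        unfolding second_leg_def by (rule norm_integral_le_nn_integral)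
      also have "\<dots> \<le> (\<integral>\<^sup>+ t. ?k t * ?D (x - \<gamma> t) \<partial>lborel)"
      proof (rule nn_integral_mono)
        fix t
        show "ennreal (norm (indicator {-r..r} t *\<^sub>R
         (complex_of_real (\<kappa> (Suc i) t) * (indicator P (x - \<gamma> t) * curve_diff {-r..r} j (indicator R) (x - \<gamma> t))))) \<le> ?k t * ?D (x - \<gamma> t)"
        proof (cases "t \<in> {-r..r} \<and> x - \<gamma> t \<in> P")
          case True
          then have "\<bar>\<gamma> t \<bullet> e1\<bar> \<le> L" using box_steps(1)[OF l_pos \<open>x \<in> Q\<close>] l_pos unfolding L_def by force
          then show ?thesis using True by (auto simp: norm_mult abs_le_iff ennreal_mult')
        qed (auto simp: indicator_def)
      qed
      finally show ?thesis using True by simp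
    qed simp
  qed
  also have "\<dots> = (\<integral>\<^sup>+ t. ?k t \<partial>lborel) * (\<integral>\<^sup>+ y. ?D y \<partial>lborel)"
    by (rule nn_integral_shear) measurable
  also have "\<dots> \<le> ennreal (2 * (2 * L) ^ Suc i) * (\<integral>\<^sup>+ y. ?D y \<partial>lborel)"
    using L_pos by (intro mult_right_mono nn_integral_\<kappa>) auto
  finally show ?thesis .
qed

text \<open>
Both index pairs have \<open>i + j = 3\<close>, so the bound has size \<open>L\<^sup>3\<close>, that of the measure of R.
\<close>

lemma nn_integral_\<Theta>:
  assumes ij: "(i, j) = (2, 1) \<or> (i, j) = (1, 2)"
    and test: "\<And>i f F. test_fun P F f \<Longrightarrow> 0 < F \<Longrightarrow> L1_on Q (curve_diff {-r..r} i f) \<le> ennreal ((2 * L) ^ i * (F * Z))"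
    and test': "\<And>i f F. test_fun R F f \<Longrightarrow> 0 < F \<Longrightarrow> L1_on P (curve_diff {-r..r} i f) \<le> ennreal ((2 * L) ^ i * (F * Z))"
    and Z: "0 \<le> Z"
  shows "L1_on Q (\<Theta> i j) \<le> ennreal (32 * L ^ 3 * Z)"
proof -
  obtain i' j' where ij': "i = Suc i'" "j = Suc j'" "i + j = 3" using ij by force
  have "AE x in lborel. integrable lborel (\<lambda>t. indicator {-r..r} t *\<^sub>R (indicator P (x - \<gamma> t) *\<^sub>R b (x - \<gamma> t)))"
    by (rule AE_slice_integrable[OF boxes_compact(2)]) auto
  then have ae: "AE x in lborel. ennreal (norm (\<Theta> i j x)) * indicator Q x
     \<le> ennreal (norm (curve_diff {-r..r} i (moment_on_P j) x)) * indicator Q x + ennreal (norm (second_leg i j x)) * indicator Q x"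
  proof eventually_elim
    case (elim x)
    show ?case
    proof (cases "x \<in> Q")
      case True
      have "\<Theta> i j x = curve_diff {-r..r} i (moment_on_P j) x + second_leg i j x"
      proof (rule \<Theta>_split[OF True elim])
        show "integrable lborel (\<lambda>p. (indicator (S x) p * K i j p) *\<^sub>R (b x - b (two_step x p)))"
          using ij integrable_\<Theta>[OF True] by auto
        show "\<bar>K i j p\<bar> \<le> (11 / 10 * \<alpha> * L ^ i') * (11 / 10 * \<alpha> * L ^ j')" if "p \<in> S x" for p
          unfolding ij' by (rule K_bound[OF True that])
      qed
      then have "norm (\<Theta> i j x) \<le> norm (curve_diff {-r..r} i (moment_on_P j) x) + norm (second_leg i j x)"
        by (simp add: norm_triangle_ineq)
      then show ?thesis using True by (simp flip: ennreal_plus add: ennreal_leI)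
    qed simp
  qed
  have [measurable]: "moment_on_P j \<in> borel_measurable borel" unfolding moment_on_P_def[abs_def] by measurable
  have "L1_on Q (\<Theta> i j)
    \<le> (\<integral>\<^sup>+ x. ennreal (norm (curve_diff {-r..r} i (moment_on_P j) x)) * indicator Q x + ennreal (norm (second_leg i j x)) * indicator Q x \<partial>lborel)"
    by (rule nn_integral_mono_AE[OF ae])
  also have "\<dots> = L1_on Q (curve_diff {-r..r} i (moment_on_P j)) + L1_on Q (second_leg i j)"
    by (rule nn_integral_add) measurable
  also have "\<dots> \<le> ennreal ((2 * L) ^ i * (2 * (2 * L) ^ j * Z)) + ennreal (2 * (2 * L) ^ i) * ennreal ((2 * L) ^ j * (1 * Z))"
  proof (rule add_mono)
    show "L1_on Q (curve_diff {-r..r} i (moment_on_P j)) \<le> ennreal ((2 * L) ^ i * (2 * (2 * L) ^ j * Z))"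
      by (rule test) (use moment_on_P_test[of j'] L_pos ij' in auto)
    have "L1_on Q (second_leg i j) \<le> ennreal (2 * (2 * L) ^ i) * L1_on P (curve_diff {-r..r} j (indicator R))"
      unfolding ij'(1) by (rule nn_integral_second_leg)
    also have "\<dots> \<le> ennreal (2 * (2 * L) ^ i) * ennreal ((2 * L) ^ j * (1 * Z))"
      by (intro mult_left_mono test') (auto simp: test_fun_def indicator_def)
    finally show "L1_on Q (second_leg i j) \<le> ennreal (2 * (2 * L) ^ i) * ennreal ((2 * L) ^ j * (1 * Z))" .
  qed
  also have "\<dots> = ennreal (4 * (2 * L) ^ (i + j) * Z)"
    using L_pos Z by (simp add: power_add algebra_simps flip: ennreal_mult' ennreal_plus)
  also have "4 * (2 * L) ^ (i + j) * Z = 32 * L ^ 3 * Z" unfolding ij'(3) by (simp add: power_mult_distrib)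
  finally show ?thesis .
qed

end

section \<open>Oscillation at one scale and on enlarged rectangles\<close>

context one_scale
begin

lemma nn_integral_cross:
  assumes V: "L1_on Q (\<lambda>x. b x - c) \<le> ennreal V"
    "L1_on R (\<lambda>x. b x - c) \<le> ennreal V" and V0: "0 \<le> V"
  shows "(\<integral>\<^sup>+ x. (\<integral>\<^sup>+ z. ennreal (indicator R z) * ennreal (norm (b x - b z)) \<partial>lborel) * indicator Q x \<partial>lborel)
    \<le> ennreal (measure lborel R * V + measure lborel Q * V)"
proof -
  have eR: "emeasure lborel R = ennreal (measure lborel R)" and eQ: "emeasure lborel Q = ennreal (measure lborel Q)"
    by (rule emeasure_bounded_eq[OF compact_imp_bounded[OF boxes_compact(3)]], rule emeasure_bounded_eq[OF compact_imp_bounded[OF boxes_compact(1)]])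
  let ?u = "\<lambda>x. ennreal (norm (b x - c))"
  have "(\<integral>\<^sup>+ x. (\<integral>\<^sup>+ z. ennreal (indicator R z) * ennreal (norm (b x - b z)) \<partial>lborel) * indicator Q x \<partial>lborel)
    \<le> (\<integral>\<^sup>+ x. (\<integral>\<^sup>+ z. indicator R z * ?u x + ?u z * indicator R z \<partial>lborel) * indicator Q x \<partial>lborel)"
  proof (intro nn_integral_mono mult_right_mono)
    fix x z
    have "norm (b x - b z) \<le> norm (b x - c) + norm (b z - c)"
      using norm_triangle_ineq4[of "b x - c" "b z - c"] by simp
    then show "ennreal (indicator R z) * ennreal (norm (b x - b z)) \<le> indicator R z * ?u x + ?u z * indicator R z"
      by (auto simp: indicator_def simp flip: ennreal_plus intro!: ennreal_leI)
  qed simp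
  also have "\<dots> = (\<integral>\<^sup>+ x. emeasure lborel R * (?u x * indicator Q x) + (\<integral>\<^sup>+ z. ?u z * indicator R z \<partial>lborel) * indicator Q x \<partial>lborel)"
  proof (rule nn_integral_cong)
    fix x
    have "(\<integral>\<^sup>+ z. indicator R z * ?u x + ?u z * indicator R z \<partial>lborel) = emeasure lborel R * ?u x + (\<integral>\<^sup>+ z. ?u z * indicator R z \<partial>lborel)"
      by (subst nn_integral_add) (auto simp: nn_integral_multc)
    then show "(\<integral>\<^sup>+ z. indicator R z * ?u x + ?u z * indicator R z \<partial>lborel) * indicator Q x = emeasure lborel R * (?u x * indicator Q x) + (\<integral>\<^sup>+ z. ?u z * indicator R z \<partial>lborel) * indicator Q x"
      by (simp add: distrib_right mult.assoc)
  qed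
  also have "\<dots> = emeasure lborel R * (\<integral>\<^sup>+ x. ?u x * indicator Q x \<partial>lborel) + (\<integral>\<^sup>+ z. ?u z * indicator R z \<partial>lborel) * emeasure lborel Q"
    by (subst nn_integral_add) (auto simp: nn_integral_cmult)
  also have "\<dots> \<le> ennreal (measure lborel R) * ennreal V + ennreal V * ennreal (measure lborel Q)"
    unfolding eR eQ by (intro add_mono mult_left_mono mult_right_mono V) auto
  also have "\<dots> = ennreal (measure lborel R * V + measure lborel Q * V)"
    using V0 by (simp add: mult.commute flip: ennreal_mult' ennreal_plus)
  finally show ?thesis .
qed

text \<open>
Both error terms, the weight exchange and the far returns, cost \<open>\<epsilon>\<close> times the oscillation V over a
rectangle U that contains Q, P and R.
\<close>

lemma one_scale_estimate:
  assumes p: "1 < p" and N: "0 < N" "commutator_norm \<gamma> p b < ennreal N"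
    and U: "Q \<union> P \<union> R \<subseteq> U" "U \<in> sets borel" "bounded U" and W: "measure lborel U \<le> W"
    and V: "L1_on U (\<lambda>x. b x - c) \<le> ennreal V" and V0: "0 \<le> V"
    and \<rho>: "L + (H + \<Lambda> + 2) * l\<^sup>2 \<le> \<rho>"
    and E: "measure lborel (far_returns \<gamma> r \<rho>) / r \<le> \<epsilon>"
  shows "L1_on Q (\<lambda>x. b x - bR)
    \<le> ennreal (64 * wt_const * (c2 + 1) ^ 3 * (2 * N * W + 2 * \<epsilon> * V) + 14 * \<epsilon> * V)"
proof -
  let ?E = "(far_returns \<gamma> r \<rho>)"
  define Z where "Z = N * (2 * W) + \<epsilon> * (2 * V)"
  have W0: "0 \<le> W" using W measure_nonneg[of lborel U] by linarith
  have Z0: "0 \<le> Z" using N W0 V0 \<epsilon> by (simp add: Z_def)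
  have [measurable]: "U \<in> sets borel" by (rule U)
  have VB: "L1_on B (\<lambda>x. b x - c) \<le> ennreal V" if "B \<subseteq> U" for B
    by (rule order_trans[OF nn_integral_mono V]) (use that in \<open>auto simp: indicator_def\<close>)
  have mB: "measure lborel B \<le> W" if "B \<subseteq> U" "B \<in> sets borel" for B
  proof -
    have "measure lborel B \<le> measure lborel U"
      by (rule measure_mono_fmeasurable) (use that U emeasure_bounded_finite[OF U(3)] in \<open>auto simp: fmeasurable_def\<close>)
    then show ?thesis using W by linarith
  qed
  have sub: "Q \<subseteq> U" "P \<subseteq> U" "R \<subseteq> U" using U by auto
  have Hl: "0 \<le> H * l\<^sup>2" "0 \<le> \<Lambda> * l\<^sup>2" using H_pos q_pos by (auto simp: \<Lambda>_def)
  have d1: "norm (x - y) \<le> \<rho>" if "x \<in> Q" "y \<in> P" for x y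
  proof -
    have "\<bar>(x - y) \<bullet> e1\<bar> \<le> L" "\<bar>(x - y) \<bullet> e2\<bar> \<le> (H + \<Lambda> + 2) * l\<^sup>2"
      using that l_pos Hl unfolding mem_Qbox mem_Pbox L_def inner_diff_left abs_le_iff by (auto simp: algebra_simps)
    then show ?thesis using norm_le_frame[of "x - y"] \<rho> by linarith
  qed
  have d2: "norm (x - y) \<le> \<rho>" if "x \<in> P" "y \<in> R" for x y
  proof -
    have "\<bar>(x - y) \<bullet> e1\<bar> \<le> L" "\<bar>(x - y) \<bullet> e2\<bar> \<le> (H + \<Lambda> + 2) * l\<^sup>2"
      using that l_pos Hl unfolding mem_Rbox mem_Pbox L_def inner_diff_left abs_le_iff by (auto simp: algebra_simps)
    then show ?thesis using norm_le_frame[of "x - y"] \<rho> by linarith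
  qed
  have ZZ: "N * (measure lborel A + measure lborel B) + measure lborel ?E / r * (2 * V) \<le> Z"
    if "A \<subseteq> U" "B \<subseteq> U" "A \<in> sets borel" "B \<in> sets borel" for A B
    unfolding Z_def using mB[of A] mB[of B] that N V0 \<epsilon> by (intro add_mono mult_mono E) auto
  have test: "L1_on Q (curve_diff {-r..r} i f) \<le> ennreal ((2 * L) ^ i * (F * Z))"
    if "test_fun P F f" "0 < F" for i f F
  proof (rule order_trans[OF testing_near[OF p N sep_QP boxes_compact(1,2) d1 box_coord(1) L_pos r refl VB[OF sub(1)] VB[OF sub(2)] V0 that]])
    show "ennreal ((2 * L) ^ i * (F * (N * (measure lborel Q + measure lborel P) + measure lborel ?E / r * (2 * V)))) \<le> ennreal ((2 * L) ^ i * (F * Z))"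
      by (intro ennreal_leI mult_left_mono ZZ sub) (use L_pos that in auto)
  qed
  have test': "L1_on P (curve_diff {-r..r} i f) \<le> ennreal ((2 * L) ^ i * (F * Z))"
    if "test_fun R F f" "0 < F" for i f F
  proof (rule order_trans[OF testing_near[OF p N sep_PR boxes_compact(2,3) d2 box_coord(2) L_pos r refl VB[OF sub(2)] VB[OF sub(3)] V0 that]])
    show "ennreal ((2 * L) ^ i * (F * (N * (measure lborel P + measure lborel R) + measure lborel ?E / r * (2 * V)))) \<le> ennreal ((2 * L) ^ i * (F * Z))"
      by (intro ennreal_leI mult_left_mono ZZ sub) (use L_pos that in auto)
  qed
  have T1: "L1_on Q (\<Theta> 2 1) \<le> ennreal (32 * L ^ 3 * Z)"
    by (rule nn_integral_\<Theta>[OF _ test test' Z0]) auto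
  have T2: "L1_on Q (\<Theta> 1 2) \<le> ennreal (32 * L ^ 3 * Z)"
    by (rule nn_integral_\<Theta>[OF _ test test' Z0]) auto
  have [measurable]: "\<Theta> i j \<in> borel_measurable borel" for i j
  proof -
    have S': "indicator (S x) p = (indicator {-r..r} (fst p) * indicator {-r..r} (snd p) * indicator P (x - \<gamma> (snd p)) * indicator R (x - \<gamma> (snd p) - \<gamma> (fst p)) :: real)" for x p
      using ind_S[of x "fst p" "snd p"] by simp
    have [measurable]: "K i j \<in> borel_measurable (borel \<Otimes>\<^sub>M borel)" unfolding borel_prod by (rule K_meas)
    have "(\<lambda>x. LINT p|(lborel \<Otimes>\<^sub>M lborel). (indicator (S x) p * K i j p) *\<^sub>R (b x - b (two_step x p))) \<in> borel_measurable lborel"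
      unfolding S' two_step_def K_def by measurable
    then show ?thesis unfolding \<Theta>_def[abs_def] lborel_prod by simp
  qed
  have "L1_on Q \<Psi>
    \<le> (\<integral>\<^sup>+ x. ennreal wt_const * (ennreal (norm (\<Theta> 2 1 x)) * indicator Q x + ennreal (norm (\<Theta> 1 2 x)) * indicator Q x) \<partial>lborel)"
  proof (rule nn_integral_mono)
    fix x
    show "ennreal (norm (\<Psi> x)) * indicator Q x \<le> ennreal wt_const * (ennreal (norm (\<Theta> 2 1 x)) * indicator Q x + ennreal (norm (\<Theta> 1 2 x)) * indicator Q x)"
    proof (cases "x \<in> Q")
      case True
      have "norm (\<Psi> x) \<le> wt_const * (norm (\<Theta> 2 1 x) + norm (\<Theta> 1 2 x))"
        unfolding \<Psi>_eq[OF True] using wt_const_pos norm_triangle_ineq4[of "\<Theta> 2 1 x" "\<Theta> 1 2 x"] by simp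
      then show ?thesis using True wt_const_pos by (simp flip: ennreal_plus ennreal_mult' add: ennreal_leI)
    qed simp
  qed
  also have "\<dots> = ennreal wt_const * (L1_on Q (\<Theta> 2 1) + L1_on Q (\<Theta> 1 2))"
    by (subst nn_integral_cmult, measurable, subst nn_integral_add, measurable)
  also have "\<dots> \<le> ennreal wt_const * (ennreal (32 * L ^ 3 * Z) + ennreal (32 * L ^ 3 * Z))"
    by (intro mult_left_mono add_mono T1 T2) auto
  also have "\<dots> = ennreal (64 * wt_const * L ^ 3 * Z)"
    using L_pos Z0 wt_const_pos by (simp flip: ennreal_plus ennreal_mult' add: algebra_simps)
  finally have IP: "L1_on Q \<Psi> \<le> ennreal (64 * wt_const * L ^ 3 * Z)" .
  have mQ: "measure lborel Q = l ^ 3" "measure lborel R = l ^ 3"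
    unfolding Qbox_def Rbox_def using l_pos by (simp_all add: measure_frame_box power3_eq_cube power2_eq_square)
  let ?X = "\<integral>\<^sup>+ x. ennreal (norm (b x - bR)) * indicator Q x \<partial>lborel"
  have \<Psi>m: "(\<lambda>x. ennreal (norm (\<Psi> x)) * indicator Q x) \<in> borel_measurable lborel"
  proof -
    have "(\<lambda>x. ennreal (norm (\<Psi> x)) * indicator Q x) = (\<lambda>x. ennreal (norm (wt_const *\<^sub>R (\<Theta> 2 1 x - \<Theta> 1 2 x))) * indicator Q x)"
      by (auto simp: fun_eq_iff indicator_def \<Psi>_eq)
    then show ?thesis by simp
  qed
  have "ennreal (l ^ 3) * ?X = (\<integral>\<^sup>+ x. ennreal (measure lborel R) * ennreal (norm (b x - bR)) * indicator Q x \<partial>lborel)"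
    unfolding mQ by (subst nn_integral_cmult[symmetric]) (auto simp: mult.assoc)
  also have "\<dots> \<le> (\<integral>\<^sup>+ x. ennreal (norm (\<Psi> x)) * indicator Q x + ennreal (7 * \<epsilon>) * ((\<integral>\<^sup>+ z. ennreal (indicator R z) * ennreal (norm (b x - b z)) \<partial>lborel) * indicator Q x) \<partial>lborel)"
  proof (rule nn_integral_mono)
    fix x
    show "ennreal (measure lborel R) * ennreal (norm (b x - bR)) * indicator Q x
      \<le> ennreal (norm (\<Psi> x)) * indicator Q x + ennreal (7 * \<epsilon>) * ((\<integral>\<^sup>+ z. ennreal (indicator R z) * ennreal (norm (b x - b z)) \<partial>lborel) * indicator Q x)"
      using oscillation_le_\<Psi>[of x] by (cases "x \<in> Q") auto
  qed
  also have "\<dots> = L1_on Q \<Psi>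
     + ennreal (7 * \<epsilon>) * (\<integral>\<^sup>+ x. (\<integral>\<^sup>+ z. ennreal (indicator R z) * ennreal (norm (b x - b z)) \<partial>lborel) * indicator Q x \<partial>lborel)"
    by (subst nn_integral_add[OF \<Psi>m]) (auto simp: nn_integral_cmult)
  also have "\<dots> \<le> ennreal (64 * wt_const * L ^ 3 * Z) + ennreal (7 * \<epsilon>) * ennreal (measure lborel R * V + measure lborel Q * V)"
    by (intro add_mono IP mult_left_mono nn_integral_cross[OF VB[OF sub(1)] VB[OF sub(3)] V0]) auto
  also have "\<dots> = ennreal (64 * wt_const * L ^ 3 * Z + 7 * \<epsilon> * (l ^ 3 * V + l ^ 3 * V))"
    unfolding mQ using wt_const_pos L_pos Z0 \<epsilon> l_pos V0 by (simp flip: ennreal_plus ennreal_mult')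
  also have "64 * wt_const * L ^ 3 * Z + 7 * \<epsilon> * (l ^ 3 * V + l ^ 3 * V) = l ^ 3 * (64 * wt_const * (c2 + 1) ^ 3 * (2 * N * W + 2 * \<epsilon> * V) + 14 * \<epsilon> * V)"
    unfolding L_def Z_def power_mult_distrib by (simp add: algebra_simps)
  finally have fin: "ennreal (l ^ 3) * ?X \<le> ennreal (l ^ 3 * (64 * wt_const * (c2 + 1) ^ 3 * (2 * N * W + 2 * \<epsilon> * V) + 14 * \<epsilon> * V))" .
  have l3: "0 < l ^ 3" using l_pos by simp
  have "?X = ennreal (1 / l ^ 3) * (ennreal (l ^ 3) * ?X)"
    using l3 by (simp add: mult.assoc[symmetric] ennreal_mult[symmetric] del: ennreal_power)
  also have "\<dots> \<le> ennreal (1 / l ^ 3) * ennreal (l ^ 3 * (64 * wt_const * (c2 + 1) ^ 3 * (2 * N * W + 2 * \<epsilon> * V) + 14 * \<epsilon> * V))"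
    using fin by (rule mult_left_mono) simp
  also have "\<dots> = ennreal (64 * wt_const * (c2 + 1) ^ 3 * (2 * N * W + 2 * \<epsilon> * V) + 14 * \<epsilon> * V)"
    using l3 by (subst ennreal_mult'[symmetric]) auto
  finally show ?thesis .
qed

end

context orthonormal_frame
begin

text \<open>
Any constant c may be subtracted. Up to a factor 2 this is the same as subtracting the average, and
it makes overlapping rectangles easy to merge.
\<close>

definition osc_le :: "(real^2 \<Rightarrow> complex) \<Rightarrow> real \<Rightarrow> real \<Rightarrow> real \<Rightarrow> bool" where
  "osc_le b w h M \<longleftrightarrow>
     (\<forall>a. \<exists>c. L1_on (frame_box a w h) (\<lambda>x. b x - c) \<le> ennreal (M * (w * h)))"

lemma osc_le_mono:
  assumes "osc_le b w h M" "M \<le> M'" "0 \<le> w" "0 \<le> h"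
  shows "osc_le b w h M'"
  using assms unfolding osc_le_def
  by (meson ennreal_leI mult_nonneg_nonneg mult_right_mono order_trans)

text \<open>
On the overlap both constants are close to b, hence to each other.
\<close>

lemma nn_integral_merge:
  fixes b :: "real^2 \<Rightarrow> complex"
  assumes b [measurable]: "b \<in> borel_measurable borel"
    and B1: "L1_on B1 (\<lambda>x. b x - c1) \<le> ennreal m"
    and B2: "L1_on B2 (\<lambda>x. b x - c2) \<le> ennreal m" and m: "0 \<le> m"
    and [measurable]: "B1 \<in> sets borel" "B2 \<in> sets borel" "O1 \<in> sets borel"
    and O1: "O1 \<subseteq> B1 \<inter> B2" and mu: "emeasure lborel B2 = ennreal \<mu>" "emeasure lborel O1 = ennreal \<nu>" "0 < \<nu>" "\<mu> \<le> 2 * \<nu>" "0 \<le> \<mu>"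
  shows "L1_on (B1 \<union> B2) (\<lambda>x. b x - c1) \<le> ennreal (6 * m)"
proof -
  let ?d = "norm (c1 - c2)"
  have "ennreal (?d * \<nu>) = (\<integral>\<^sup>+ x. ennreal ?d * indicator O1 x \<partial>lborel)"
    by (simp add: nn_integral_cmult_indicator mu ennreal_mult')
  also have "\<dots> \<le> (\<integral>\<^sup>+ x. ennreal (norm (b x - c1)) * indicator B1 x + ennreal (norm (b x - c2)) * indicator B2 x \<partial>lborel)"
  proof (rule nn_integral_mono)
    fix x
    have "?d \<le> norm (b x - c1) + norm (b x - c2)"
      using norm_triangle_ineq4[of "b x - c2" "b x - c1"] by simp
    then show "ennreal ?d * indicator O1 x \<le> ennreal (norm (b x - c1)) * indicator B1 x + ennreal (norm (b x - c2)) * indicator B2 x"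
      using O1 by (cases "x \<in> O1") (auto simp: subset_eq simp flip: ennreal_plus intro!: ennreal_leI)
  qed
  also have "\<dots> = L1_on B1 (\<lambda>x. b x - c1) + L1_on B2 (\<lambda>x. b x - c2)"
    by (rule nn_integral_add) measurable
  also have "\<dots> \<le> ennreal m + ennreal m" by (intro add_mono B1 B2)
  also have "\<dots> = ennreal (2 * m)" using m by (simp flip: ennreal_plus)
  finally have d: "?d * \<nu> \<le> 2 * m" using m by (simp add: ennreal_le_iff)
  have d\<mu>: "?d * \<mu> \<le> 4 * m"
  proof -
    have "?d * \<mu> \<le> ?d * (2 * \<nu>)" using mu by (intro mult_left_mono) auto
    then show ?thesis using d by linarith
  qed
  have "L1_on (B1 \<union> B2) (\<lambda>x. b x - c1)
    \<le> (\<integral>\<^sup>+ x. ennreal (norm (b x - c1)) * indicator B1 x + (ennreal (norm (b x - c2)) * indicator B2 x + ennreal ?d * indicator B2 x) \<partial>lborel)"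
  proof (rule nn_integral_mono)
    fix x
    have "norm (b x - c1) \<le> norm (b x - c2) + ?d"
      using norm_triangle_ineq4[of "b x - c2" "c1 - c2"] by simp
    then have "ennreal (norm (b x - c1)) \<le> ennreal (norm (b x - c2)) + ennreal ?d"
      by (simp flip: ennreal_plus add: ennreal_leI)
    then show "ennreal (norm (b x - c1)) * indicator (B1 \<union> B2) x \<le> ennreal (norm (b x - c1)) * indicator B1 x + (ennreal (norm (b x - c2)) * indicator B2 x + ennreal ?d * indicator B2 x)"
      by (cases "x \<in> B1"; cases "x \<in> B2") (auto simp: add_increasing)
  qed
  also have "\<dots> = L1_on B1 (\<lambda>x. b x - c1) + (L1_on B2 (\<lambda>x. b x - c2) + ennreal (?d * \<mu>))"
    by (simp add: nn_integral_add nn_integral_cmult_indicator mu ennreal_mult')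
  also have "\<dots> \<le> ennreal m + (ennreal m + ennreal (4 * m))"
    using d\<mu> by (intro add_mono B1 B2 ennreal_leI)
  also have "\<dots> = ennreal (6 * m)" using m by (simp flip: ennreal_plus)
  finally show ?thesis .
qed

text \<open>
The wider rectangle is the union of two translates of the given one, which overlap in at least
half of their area.
\<close>

lemma osc_le_widen:
  assumes b: "b \<in> borel_measurable borel" and o: "osc_le b w h M" and w: "0 < w" "w \<le> w'" "w' \<le> 3 / 2 * w" and h: "0 < h" and M: "0 \<le> M"
  shows "osc_le b w' h (6 * M)"
  unfolding osc_le_def
proof
  fix a
  let ?a2 = "a + (w' - w) *\<^sub>R e1"
  obtain c1 where c1: "L1_on (frame_box a w h) (\<lambda>x. b x - c1) \<le> ennreal (M * (w * h))"
    using o unfolding osc_le_def by blast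
  obtain c2 where c2: "L1_on (frame_box ?a2 w h) (\<lambda>x. b x - c2) \<le> ennreal (M * (w * h))"
    using o unfolding osc_le_def by blast
  have c: "(x - ?a2) \<bullet> e1 = (x - a) \<bullet> e1 - (w' - w)" "(x - ?a2) \<bullet> e2 = (x - a) \<bullet> e2" for x
    by (auto simp: inner_diff_left inner_add_left e11 e12)
  have un: "frame_box a w' h = frame_box a w h \<union> frame_box ?a2 w h"
    unfolding frame_box_def c using w by auto
  have "L1_on (frame_box a w' h) (\<lambda>x. b x - c1) \<le> ennreal (6 * (M * (w * h)))"
    unfolding un
  proof (rule nn_integral_merge[OF b c1 c2 _ _ _ _ _ emeasure_frame_box emeasure_frame_box])
    show "frame_box ?a2 (2 * w - w') h \<subseteq> frame_box a w h \<inter> frame_box ?a2 w h"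
      unfolding frame_box_def c using w by auto
    show "w * h \<le> 2 * ((2 * w - w') * h)" using w h mult_right_mono[of w "2 * (2 * w - w')" h] by (simp add: mult.assoc)
  qed (use w h M in auto)
  also have "\<dots> \<le> ennreal (6 * M * (w' * h))" using w h M by (intro ennreal_leI) (auto intro!: mult_mono)
  finally show "\<exists>c. L1_on (frame_box a w' h) (\<lambda>x. b x - c) \<le> ennreal (6 * M * (w' * h))" by blast
qed

lemma osc_le_widen_iter:
  assumes b: "b \<in> borel_measurable borel" and o: "osc_le b w h M" and w: "0 < w" "w \<le> w'" "w' \<le> (3 / 2) ^ n * w"
    and h: "0 < h" and M: "0 \<le> M"
  shows "osc_le b w' h (6 ^ n * M)"
  using w(2,3)
proof (induction n arbitrary: w')
  case 0
  then show ?case using o by simp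
next
  case (Suc n)
  define u where "u = min w' ((3 / 2) ^ n * w)"
  have pw: "w \<le> (3 / 2) ^ n * w" using w(1) one_le_power[of "3 / 2 :: real" n] by simp
  have "osc_le b u h (6 ^ n * M)" using Suc.prems pw by (intro Suc.IH) (auto simp: u_def)
  moreover have "w \<le> u" using Suc.prems pw by (simp add: u_def)
  moreover have "u \<le> w'" "w' \<le> 3 / 2 * u" using Suc.prems w(1) by (auto simp: u_def min_def)
  ultimately have "osc_le b w' h (6 * (6 ^ n * M))"
    using w(1) h M by (intro osc_le_widen[OF b]) auto
  then show ?case by (simp add: mult.assoc)
qed

lemma osc_le_spread:
  assumes b: "b \<in> borel_measurable borel" and o: "osc_le b w h M" and w: "0 < w" "w \<le> w'" "w' \<le> (3 / 2) ^ n * w"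
    and h: "0 < h" "h \<le> h'" "h' \<le> (3 / 2) ^ n * h" and M: "0 \<le> M"
  shows "osc_le b w' h' (36 ^ n * M)"
proof -
  \<comment> \<open>Widening in the frame with the two axes exchanged is heightening in the original one.\<close>
  interpret swap: orthonormal_frame e2 e1
    by unfold_locales (use e11 e22 e12 in \<open>auto simp: inner_commute\<close>)
  have sw: "swap.osc_le b h w M \<longleftrightarrow> osc_le b w h M" for w h M
    unfolding osc_le_def swap.osc_le_def frame_box_def swap.frame_box_def by (simp add: conj_ac mult.commute)
  have "osc_le b w' h (6 ^ n * M)" by (rule osc_le_widen_iter[OF b o w h(1) M])
  then have "swap.osc_le b h' w' (6 ^ n * (6 ^ n * M))"
    unfolding sw[symmetric] using w h M by (intro swap.osc_le_widen_iter[OF b _ h]) auto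
  moreover have "(36 :: real) ^ n = 6 ^ n * 6 ^ n" by (simp add: power_mult_distrib[symmetric])
  ultimately show ?thesis unfolding sw by (simp add: mult.assoc)
qed

end

section \<open>Absorbing the a priori bound\<close>

context near_parabola
begin

text \<open>
Rectangles Q, P and R of size l fit into one of size \<open>dil * l\<close>. Returning from that size to l takes
\<open>enlargements\<close> many enlargements by 3/2 in each direction, so \<open>gain * \<epsilon>\<close> is the factor in front of the a priori bound
after one round of the argument.
\<close>

definition "dil = c2 + 1 + H + \<Lambda>"
definition "main_const = 128 * (2 * \<beta> / \<alpha>\<^sup>2) * (c2 + 1) ^ 3"
definition "enlargements = (LEAST n. dil\<^sup>2 \<le> (3 / 2) ^ n)"
definition "gain = 36 ^ enlargements * ((main_const + 14) * dil ^ 3)"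

lemma dil_ge: "7 \<le> dil" "c2 + 1 \<le> dil" "H + 1 \<le> dil\<^sup>2" "\<Lambda> + 1 \<le> dil\<^sup>2"
proof -
  have L: "1 \<le> \<Lambda>" using q_pos by (simp add: \<Lambda>_def)
  show K: "7 \<le> dil" "c2 + 1 \<le> dil" using c2_ge H_pos L by (auto simp: dil_def)
  have "dil * 1 \<le> dil * dil" using K by (intro mult_left_mono) auto
  then have "dil \<le> dil\<^sup>2" by (simp add: power2_eq_square)
  moreover have "H + 1 \<le> dil" "\<Lambda> + 1 \<le> dil" using c2_ge H_pos L by (auto simp: dil_def)
  ultimately show "H + 1 \<le> dil\<^sup>2" "\<Lambda> + 1 \<le> dil\<^sup>2" by linarith+
qed

lemma main_const_pos: "0 < main_const" using \<alpha> \<beta> c2_ge by (simp add: main_const_def)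

lemma enlargements: "dil\<^sup>2 \<le> (3 / 2) ^ enlargements"
proof -
  have "\<exists>n. dil\<^sup>2 \<le> (3 / 2 :: real) ^ n" using real_arch_pow[of "3 / 2" "dil\<^sup>2"] by (auto intro: less_imp_le)
  then show ?thesis unfolding enlargements_def by (rule LeastI_ex)
qed

end

context near_parabola_symbol
begin

text \<open>
The hypothesis at scale \<open>dil * l\<close> provides the bound V on the rectangle U around Q, P and R. All
areas are multiples of \<open>l\<^sup>3\<close>, so l drops out of the constants.
\<close>

lemma osc_le_improve:
  assumes p: "1 < p" and N: "0 < N" "commutator_norm \<gamma> p b < ennreal N"
    and l: "0 < l" "(c2 + 1) * l \<le> \<alpha> * r / 2"
    and \<rho>: "(c2 + 1) * l + (H + \<Lambda> + 2) * l\<^sup>2 \<le> \<rho>"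
    and E: "measure lborel (far_returns \<gamma> r \<rho>) / r \<le> \<epsilon>"
    and M: "0 \<le> M" "osc_le b (dil * l) ((dil * l)\<^sup>2) M"
  shows "osc_le b l (l\<^sup>2) (main_const * dil ^ 3 * N + (main_const + 14) * dil ^ 3 * \<epsilon> * M)"
  unfolding osc_le_def
proof
  fix a
  interpret os: one_scale e1 e2 \<gamma> \<gamma>' \<alpha> \<beta> r \<epsilon> b a l
    by unfold_locales (use l in auto)
  let ?U = "frame_box (a - ((dil - 1) * l) *\<^sub>R e1 - ((dil\<^sup>2 - 1) * l\<^sup>2) *\<^sub>R e2) (dil * l) ((dil * l)\<^sup>2)"
  have memU: "x \<in> ?U \<longleftrightarrow> - ((dil - 1) * l) \<le> (x - a) \<bullet> e1 \<and> (x - a) \<bullet> e1 \<le> l \<and> - ((dil\<^sup>2 - 1) * l\<^sup>2) \<le> (x - a) \<bullet> e2 \<and> (x - a) \<bullet> e2 \<le> l\<^sup>2" for x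
    unfolding frame_box_def mem_Collect_eq frame_coords(1,2) by (auto simp: algebra_simps power_mult_distrib)
  have k: "c2 * l \<le> (dil - 1) * l" "H * l\<^sup>2 \<le> (dil\<^sup>2 - 1) * l\<^sup>2" "\<Lambda> * l\<^sup>2 \<le> (dil\<^sup>2 - 1) * l\<^sup>2"
    using dil_ge l by (auto intro!: mult_right_mono)
  have nn: "0 \<le> (dil - 1) * l" "0 \<le> (dil\<^sup>2 - 1) * l\<^sup>2" "0 \<le> l\<^sup>2" "0 \<le> \<Lambda> * l\<^sup>2"
    using dil_ge l H_pos q_pos by (auto simp: \<Lambda>_def)
  have sub: "Qbox a l \<union> Pbox a l \<union> Rbox a l \<subseteq> ?U"
  proof
    fix x assume "x \<in> Qbox a l \<union> Pbox a l \<union> Rbox a l"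
    then consider "x \<in> Qbox a l" | "x \<in> Pbox a l" | "x \<in> Rbox a l" by blast
    then show "x \<in> ?U"
    proof cases
      case 1
      then show ?thesis unfolding memU mem_Qbox using nn by linarith
    next
      case 2
      then show ?thesis unfolding memU mem_Pbox using nn k l by linarith
    next
      case 3
      then show ?thesis unfolding memU mem_Rbox using nn k l by linarith
    qed
  qed
  \<comment> \<open>The area of the enclosing rectangle.\<close>
  define W where "W = (dil * l) * (dil * l)\<^sup>2"
  have W: "W = dil ^ 3 * (l * l\<^sup>2)" by (simp add: W_def power_mult_distrib power3_eq_cube power2_eq_square)
  have W0: "0 \<le> W" using dil_ge l by (simp add: W_def)
  obtain c where c: "L1_on ?U (\<lambda>x. b x - c) \<le> ennreal (M * W)"
    using M(2) unfolding osc_le_def W_def by blast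
  have mU: "measure lborel ?U \<le> W" using dil_ge l by (subst measure_frame_box) (auto simp: W_def)
  have "L1_on (Qbox a l) (\<lambda>x. b x - os.bR)
    \<le> ennreal (64 * os.wt_const * (c2 + 1) ^ 3 * (2 * N * W + 2 * \<epsilon> * (M * W)) + 14 * \<epsilon> * (M * W))"
    by (rule os.one_scale_estimate[OF p N sub frame_box_borel bounded_frame_box mU c _ _ E])
      (use M W0 \<rho> in \<open>auto simp: os.L_def\<close>)
  also have "64 * os.wt_const * (c2 + 1) ^ 3 * (2 * N * W + 2 * \<epsilon> * (M * W)) + 14 * \<epsilon> * (M * W)
    = (main_const * N + (main_const + 14) * \<epsilon> * M) * W"
  proof -
    have A: "main_const = 128 * os.wt_const * (c2 + 1) ^ 3" unfolding main_const_def os.wt_const_def ..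
    show ?thesis unfolding A by (simp add: algebra_simps)
  qed
  also have "\<dots> = (main_const * dil ^ 3 * N + (main_const + 14) * dil ^ 3 * \<epsilon> * M) * (l * l\<^sup>2)"
    unfolding W by (simp add: algebra_simps)
  finally show "\<exists>c. L1_on (frame_box a l (l\<^sup>2)) (\<lambda>x. b x - c)
    \<le> ennreal ((main_const * dil ^ 3 * N + (main_const + 14) * dil ^ 3 * \<epsilon> * M) * (l * l\<^sup>2))"
    unfolding Qbox_def by blast
qed

text \<open>
Covering the scales up to \<open>dil * l0\<close> by smaller ones closes the circle: the same scales appear on
both sides, and a bound M improves to half of M plus a multiple of N.
\<close>

lemma osc_le_absorb:
  assumes p: "1 < p" and N: "0 < N" "commutator_norm \<gamma> p b < ennreal N"
    and l0: "0 < l0" "(c2 + 1) * l0 \<le> \<alpha> * r / 2"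
    and \<rho>: "(c2 + 1) * l0 + (H + \<Lambda> + 2) * l0\<^sup>2 \<le> \<rho>"
    and E: "measure lborel (far_returns \<gamma> r \<rho>) / r \<le> \<epsilon>"
    and gain: "gain * \<epsilon> \<le> 1 / 2"
    and M: "0 \<le> M" "\<And>l. 0 < l \<Longrightarrow> l \<le> dil * l0 \<Longrightarrow> osc_le b l (l\<^sup>2) M"
    and l: "0 < l" "l \<le> dil * l0"
  shows "osc_le b l (l\<^sup>2) (36 ^ enlargements * main_const * dil ^ 3 * N + M / 2)"
proof -
  let ?l = "l / dil"
  have K: "0 < dil" "1 \<le> dil" using dil_ge by auto
  have lK: "dil * ?l = l" using K by simp
  have l': "0 < ?l" "?l \<le> l0" using l K by (auto simp: divide_le_eq mult.commute)
  have m1: "(c2 + 1) * ?l \<le> (c2 + 1) * l0" using l' c2_ge by (intro mult_left_mono) auto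
  have m2: "(H + \<Lambda> + 2) * ?l\<^sup>2 \<le> (H + \<Lambda> + 2) * l0\<^sup>2"
    using l' H_pos q_pos by (intro mult_left_mono power_mono) (auto simp: \<Lambda>_def)
  let ?M = "main_const * dil ^ 3 * N + (main_const + 14) * dil ^ 3 * \<epsilon> * M"
  have o: "osc_le b ?l (?l\<^sup>2) ?M"
  proof (rule osc_le_improve[OF p N l'(1) _ _ E M(1)])
    show "(c2 + 1) * ?l \<le> \<alpha> * r / 2" using m1 l0 by linarith
    show "(c2 + 1) * ?l + (H + \<Lambda> + 2) * ?l\<^sup>2 \<le> \<rho>" using m1 m2 \<rho> by linarith
    show "osc_le b (dil * ?l) ((dil * ?l)\<^sup>2) M" unfolding lK by (rule M(2)[OF l])
  qed
  have M0: "0 \<le> ?M" using main_const_pos K N \<epsilon> M by simp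
  have d: "dil \<le> (3 / 2) ^ enlargements" "dil\<^sup>2 \<le> (3 / 2) ^ enlargements"
  proof -
    have "dil * 1 \<le> dil * dil" using K by (intro mult_left_mono) auto
    then show "dil \<le> (3 / 2) ^ enlargements" "dil\<^sup>2 \<le> (3 / 2) ^ enlargements" using enlargements by (auto simp: power2_eq_square)
  qed
  have sq: "l\<^sup>2 = dil\<^sup>2 * ?l\<^sup>2" using K by (simp add: power_divide)
  have o': "osc_le b l (l\<^sup>2) (36 ^ enlargements * ?M)"
  proof (rule osc_le_spread[OF b_borel o l'(1)])
    show "?l \<le> l" using l K by (simp add: divide_le_eq)
    show "l \<le> (3 / 2) ^ enlargements * ?l" using mult_right_mono[OF d(1), of ?l] l'(1) lK by simp
    show "?l\<^sup>2 \<le> l\<^sup>2" using l K by (intro power_mono) (auto simp: divide_le_eq)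
    show "l\<^sup>2 \<le> (3 / 2) ^ enlargements * ?l\<^sup>2" unfolding sq using d(2) by (intro mult_right_mono) auto
  qed (use l' M0 in auto)
  have "36 ^ enlargements * ?M = 36 ^ enlargements * main_const * dil ^ 3 * N + gain * \<epsilon> * M"
    by (simp add: gain_def algebra_simps)
  moreover have "gain * \<epsilon> * M \<le> 1 / 2 * M" using gain M(1) by (rule mult_right_mono)
  ultimately have le: "36 ^ enlargements * ?M \<le> 36 ^ enlargements * main_const * dil ^ 3 * N + M / 2" by linarith
  show ?thesis by (rule osc_le_mono[OF o' le]) (use l in auto)
qed

text \<open>
After n rounds only \<open>M / 2 ^ n\<close> of the a priori bound is left. Scales between \<open>dil * l0\<close> and 1 follow by
covering, with a constant that depends on \<open>l0\<close> through m.
\<close>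

lemma osc_le_a_priori_removed:
  assumes p: "1 < p" and N: "0 < N" "commutator_norm \<gamma> p b < ennreal N"
    and l0: "0 < l0" "(c2 + 1) * l0 \<le> \<alpha> * r / 2" "dil * l0 \<le> 1"
    and \<rho>: "(c2 + 1) * l0 + (H + \<Lambda> + 2) * l0\<^sup>2 \<le> \<rho>"
    and E: "measure lborel (far_returns \<gamma> r \<rho>) / r \<le> \<epsilon>"
    and gain: "gain * \<epsilon> \<le> 1 / 2" and m: "1 / (dil * l0)\<^sup>2 \<le> (3 / 2) ^ m"
    and M: "0 \<le> M" "\<And>l. 0 < l \<Longrightarrow> l \<le> 1 \<Longrightarrow> osc_le b l (l\<^sup>2) M"
    and l: "0 < l" "l \<le> 1"
  shows "osc_le b l (l\<^sup>2) (36 ^ m * (2 * (36 ^ enlargements * main_const * dil ^ 3 * N) + M / 2 ^ n))"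
proof -
  let ?B = "36 ^ enlargements * main_const * dil ^ 3 * N"
  have B0: "0 \<le> ?B" using main_const_pos dil_ge N by simp
  have small: "osc_le b l (l\<^sup>2) (2 * ?B + M / 2 ^ n)" if "0 < l" "l \<le> dil * l0" for l
    using that
  proof (induction n arbitrary: l)
    case 0
    show ?case by (rule osc_le_mono[OF M(2)[OF 0(1)]]) (use 0 l0 B0 in auto)
  next
    case (Suc n)
    have "osc_le b l (l\<^sup>2) (?B + (2 * ?B + M / 2 ^ n) / 2)"
      by (rule osc_le_absorb[OF p N l0(1,2) \<rho> E gain _ Suc.IH Suc.prems]) (use B0 M in auto)
    moreover have "?B + (2 * ?B + M / 2 ^ n) / 2 = 2 * ?B + M / 2 ^ Suc n" by (simp add: field_simps)
    ultimately show ?case by simp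
  qed
  let ?M = "2 * ?B + M / 2 ^ n"
  have M0: "0 \<le> ?M" using B0 M by simp
  define l1 where "l1 = min l (dil * l0)"
  have K: "0 < dil" using dil_ge by simp
  have k0: "0 < dil * l0" using K l0 by simp
  have l1: "0 < l1" "l1 \<le> l" "l1 \<le> dil * l0" using l k0 by (auto simp: l1_def)
  show ?thesis
  proof (rule osc_le_spread[OF b_borel small[OF l1(1,3)] l1(1,2)])
    have one: "1 \<le> (3 / 2 :: real) ^ m" by simp
    have mk: "1 \<le> (3 / 2) ^ m * (dil * l0)\<^sup>2"
      using mult_right_mono[OF m, of "(dil * l0)\<^sup>2"] K l0 by simp
    show "l1\<^sup>2 \<le> l\<^sup>2" using l1 by (intro power_mono) auto
    show "l\<^sup>2 \<le> (3 / 2) ^ m * l1\<^sup>2"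
    proof (cases "l \<le> dil * l0")
      case True
      then show ?thesis using mult_right_mono[OF one, of "l\<^sup>2"] by (simp add: l1_def)
    next
      case False
      have "l\<^sup>2 \<le> 1" using l by (simp add: power_le_one)
      also note mk
      finally show ?thesis using False by (simp add: l1_def)
    qed
    show "l \<le> (3 / 2) ^ m * l1"
    proof (cases "l \<le> dil * l0")
      case True
      then show ?thesis using mult_right_mono[OF one, of l] l by (simp add: l1_def)
    next
      case False
      have "1 \<le> (3 / 2) ^ m * (dil * l0)\<^sup>2" by (rule mk)
      also have "\<dots> \<le> (3 / 2) ^ m * (dil * l0)"
        using k0 mult_left_mono[OF l0(3), of "dil * l0"] by (intro mult_left_mono) (simp_all add: power2_eq_square)
      finally show ?thesis using False l by (simp add: l1_def)
    qed
  qed (use l1 M0 in auto)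
qed

lemma mean_oscillation_le:
  assumes o: "osc_le b l (l\<^sup>2) M" and l: "0 < l" and M: "0 \<le> M"
  shows "mean_oscillation (frame_box a l (l\<^sup>2)) b \<le> ennreal (2 * M)"
proof -
  let ?Q = "frame_box a l (l\<^sup>2)"
  define m where "m = l * l\<^sup>2"
  have m: "0 < m" using l by (simp add: m_def)
  have eQ: "emeasure lborel ?Q = ennreal m" "measure lborel ?Q = m"
    using l by (auto simp: emeasure_frame_box measure_frame_box m_def)
  obtain c where c: "L1_on ?Q (\<lambda>x. b x - c) \<le> ennreal (M * m)"
    using o unfolding osc_le_def m_def by blast
  have ib: "integrable lborel (\<lambda>x. indicator ?Q x *\<^sub>R b x)"
    using b_loc[OF compact_frame_box] unfolding set_integrable_def .
  have ic: "integrable lborel (\<lambda>x. indicator ?Q x *\<^sub>R c)"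
    by (intro integrable_scaleR_left integrable_real_indicator) (auto simp: eQ)
  have av: "average ?Q b = (LINT x|lborel. indicator ?Q x *\<^sub>R b x) /\<^sub>R m"
    unfolding average_def set_lebesgue_integral_def using eQ by (subst integral_completion) auto
  have "ennreal (m * norm (average ?Q b - c)) = ennreal (norm (m *\<^sub>R (average ?Q b - c)))" using m by simp
  also have "m *\<^sub>R (average ?Q b - c) = (LINT x|lborel. indicator ?Q x *\<^sub>R b x) - m *\<^sub>R c"
    unfolding av using m by (simp add: scaleR_diff_right)
  also have "m *\<^sub>R c = (LINT x|lborel. indicator ?Q x *\<^sub>R c)"
    by (subst integral_scaleR_left) (use eQ in auto)
  also have "(LINT x|lborel. indicator ?Q x *\<^sub>R b x) - (LINT x|lborel. indicator ?Q x *\<^sub>R c) = (LINT x|lborel. indicator ?Q x *\<^sub>R b x - indicator ?Q x *\<^sub>R c)"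
    by (rule Bochner_Integration.integral_diff[OF ib ic, symmetric])
  also have "ennreal (norm \<dots>) \<le> (\<integral>\<^sup>+ x. ennreal (norm (indicator ?Q x *\<^sub>R b x - indicator ?Q x *\<^sub>R c)) \<partial>lborel)"
    by (rule norm_integral_le_nn_integral)
  also have "\<dots> = L1_on ?Q (\<lambda>x. b x - c)"
    by (intro nn_integral_cong) (auto simp: indicator_def)
  also note c
  finally have ac: "m * norm (average ?Q b - c) \<le> M * m" using M m by (simp add: ennreal_le_iff)
  have "(\<integral>\<^sup>+ x \<in> ?Q. ennreal (norm (b x - average ?Q b)) \<partial>lebesgue)
      = L1_on ?Q (\<lambda>x. b x - average ?Q b)"
    by (rule nn_integral_completion)
  also have "\<dots> \<le> (\<integral>\<^sup>+ x. ennreal (norm (b x - c)) * indicator ?Q x + ennreal (norm (average ?Q b - c)) * indicator ?Q x \<partial>lborel)"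
  proof (rule nn_integral_mono)
    fix x
    have "norm (b x - average ?Q b) \<le> norm (b x - c) + norm (average ?Q b - c)"
      using norm_triangle_ineq4[of "b x - c" "average ?Q b - c"] by simp
    then show "ennreal (norm (b x - average ?Q b)) * indicator ?Q x \<le> ennreal (norm (b x - c)) * indicator ?Q x + ennreal (norm (average ?Q b - c)) * indicator ?Q x"
      by (auto simp: indicator_def simp flip: ennreal_plus intro!: ennreal_leI)
  qed
  also have "\<dots> = L1_on ?Q (\<lambda>x. b x - c) + ennreal (norm (average ?Q b - c) * m)"
    by (subst nn_integral_add) (auto simp: nn_integral_cmult_indicator eQ ennreal_mult')
  also have "\<dots> \<le> ennreal (M * m) + ennreal (M * m)"
    using ac by (intro add_mono c ennreal_leI) (simp add: mult.commute)
  also have "\<dots> = ennreal (2 * M) * ennreal m" using M m by (simp flip: ennreal_plus ennreal_mult' add: mult.assoc)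
  finally have "(\<integral>\<^sup>+ x \<in> ?Q. ennreal (norm (b x - average ?Q b)) \<partial>lebesgue) \<le> ennreal (2 * M) * ennreal m" .
  then have "(\<integral>\<^sup>+ x \<in> ?Q. ennreal (norm (b x - average ?Q b)) \<partial>lebesgue) / ennreal m \<le> ennreal (2 * M)"
    using m by (intro divide_le_posI_ennreal) (simp_all add: mult.commute)
  moreover have "emeasure lebesgue ?Q = ennreal m" using eQ by simp
  ultimately show ?thesis unfolding mean_oscillation_def by simp
qed

lemma osc_le_of_mean_oscillation:
  assumes o: "\<And>a. mean_oscillation (frame_box a l (l\<^sup>2)) b \<le> ennreal M" and l: "0 < l" and M: "0 \<le> M"
  shows "osc_le b l (l\<^sup>2) M"
  unfolding osc_le_def
proof
  fix a
  let ?Q = "frame_box a l (l\<^sup>2)"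
  have m: "0 < l * l\<^sup>2" using l by simp
  have eQ: "emeasure lborel ?Q = ennreal (l * l\<^sup>2)" using l by (simp add: emeasure_frame_box)
  have "(\<integral>\<^sup>+ x \<in> ?Q. ennreal (norm (b x - average ?Q b)) \<partial>lebesgue) / ennreal (l * l\<^sup>2) \<le> ennreal M"
    using o[of a] unfolding mean_oscillation_def using eQ by simp
  then have "(\<integral>\<^sup>+ x \<in> ?Q. ennreal (norm (b x - average ?Q b)) \<partial>lebesgue) / ennreal (l * l\<^sup>2) * ennreal (l * l\<^sup>2) \<le> ennreal M * ennreal (l * l\<^sup>2)"
    by (rule mult_right_mono) simp
  moreover have "y / ennreal (l * l\<^sup>2) * ennreal (l * l\<^sup>2) = y" for y
    unfolding ennreal_divide_times using m by (subst ennreal_divide_self) auto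
  ultimately have "(\<integral>\<^sup>+ x \<in> ?Q. ennreal (norm (b x - average ?Q b)) \<partial>lebesgue) \<le> ennreal M * ennreal (l * l\<^sup>2)"
    by (simp only:)
  then have "L1_on ?Q (\<lambda>x. b x - average ?Q b) \<le> ennreal (M * (l * l\<^sup>2))"
    using M m by (simp add: nn_integral_completion ennreal_mult')
  then show "\<exists>c. L1_on ?Q (\<lambda>x. b x - c) \<le> ennreal (M * (l * l\<^sup>2))" by blast
qed

end

section \<open>Reduction to Borel symbols and nearly parabolic arcs\<close>

text \<open>
Lebesgue measure is complete, so functions that are equal almost everywhere are measurable
together; if they are not measurable, both have Bochner integral 0.
\<close>

lemma borel_measurable_lebesgue_cong_AE:
  fixes f g :: "'a::euclidean_space \<Rightarrow> 'b::topological_space"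
  assumes ae: "AE x in lborel. f x = g x" and f: "f \<in> borel_measurable lebesgue"
  shows "g \<in> borel_measurable lebesgue"
proof (rule measurableI)
  fix A :: "'b set" assume "A \<in> sets borel"
  then have fA: "f -` A \<in> sets lebesgue" using measurable_sets[OF f] by simp
  have aeA: "AE x in lebesgue. x \<in> f -` A \<longleftrightarrow> x \<in> g -` A"
    using AE_completion[OF ae] by eventually_elim simp
  have "g -` A \<in> sets lebesgue" by (rule completion.in_sets_AE[OF aeA fA]) simp
  then show "g -` A \<inter> space lebesgue \<in> sets lebesgue" by simp
qed simp

lemma integral_lebesgue_cong_AE:
  fixes f g :: "'a::euclidean_space \<Rightarrow> 'b::{banach, second_countable_topology}"
  assumes ae: "AE x in lborel. f x = g x"
  shows "integral\<^sup>L lebesgue f = integral\<^sup>L lebesgue g"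
proof (cases "f \<in> borel_measurable lebesgue")
  case True
  then show ?thesis
    using borel_measurable_lebesgue_cong_AE[OF ae True] AE_completion[OF ae] by (rule integral_cong_AE)
next
  case False
  have "AE x in lborel. g x = f x" using ae by eventually_elim simp
  then have "g \<notin> borel_measurable lebesgue" using False borel_measurable_lebesgue_cong_AE by blast
  then have "\<not> integrable lebesgue f" "\<not> integrable lebesgue g" using False by auto
  then show ?thesis by (simp add: not_integrable_integral_eq)
qed

text \<open>
A curve can be a null set, so this may fail for single points x; it holds for almost all of them
by the measure-preserving shear \<open>(x, t) \<mapsto> (x - \<gamma> t, t)\<close>.
\<close>

lemma AE_translated_curve:
  fixes \<gamma> :: "real \<Rightarrow> real^2"
  assumes ae: "AE x in lborel. P x" and \<gamma> [measurable]: "\<gamma> \<in> borel_measurable borel"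
  shows "AE x in lborel. AE t in lborel. P (x - \<gamma> t)"
proof -
  obtain N where N: "{x. \<not> P x} \<subseteq> N" "emeasure lborel N = 0" "N \<in> sets borel" using AE_E[OF ae] by auto
  have [measurable]: "N \<in> sets borel" by (rule N)
  have "(\<integral>\<^sup>+ x. (\<integral>\<^sup>+ t. 1 * indicator N (x - \<gamma> t) \<partial>lborel) \<partial>lborel) = (\<integral>\<^sup>+ t. 1 \<partial>(lborel :: real measure)) * (\<integral>\<^sup>+ y. indicator N y \<partial>lborel)"
    by (rule nn_integral_shear) measurable
  also have "\<dots> = 0" using N by simp
  finally have "AE x in lborel. (\<integral>\<^sup>+ t. indicator N (x - \<gamma> t) \<partial>lborel) = (0 :: ennreal)"
    by (subst (asm) nn_integral_0_iff_AE) auto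
  then show ?thesis
  proof eventually_elim
    case (elim x)
    then have "AE t in lborel. indicator N (x - \<gamma> t) = (0 :: ennreal)"
      by (subst (asm) nn_integral_0_iff_AE) auto
    then show ?case by eventually_elim (use N(1) in \<open>auto simp: indicator_def split: if_splits\<close>)
  qed
qed

lemma curve_hilbert_cong_AE:
  assumes "AE t in lborel. f (x - \<gamma> t) = h (x - \<gamma> t)"
  shows "curve_hilbert \<gamma> f x = curve_hilbert \<gamma> h x"
proof -
  have "(LINT t:A|lebesgue. f (x - \<gamma> t) / complex_of_real t) = (LINT t:A|lebesgue. h (x - \<gamma> t) / complex_of_real t)" for A
    unfolding set_lebesgue_integral_def
    by (rule integral_lebesgue_cong_AE) (use assms in \<open>eventually_elim, simp\<close>)
  then show ?thesis unfolding curve_hilbert_def by simp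
qed

text \<open>
A test function may fail to be measurable along the curve. The two integrands are still equal for
almost every t, and hence their Bochner integrals agree.
\<close>

lemma commutator_norm_cong_AE:
  assumes ae: "AE x in lborel. b x = b' x" and \<gamma>: "\<gamma> \<in> borel_measurable borel"
  shows "commutator_norm \<gamma> p b = commutator_norm \<gamma> p b'"
proof -
  have "Lp_norm p (curve_commutator \<gamma> b f) = Lp_norm p (curve_commutator \<gamma> b' f)" for f
  proof -
    have "AE x in lborel. curve_commutator \<gamma> b f x = curve_commutator \<gamma> b' f x"
      using ae AE_translated_curve[OF ae \<gamma>]
    proof eventually_elim
      case (elim x)
      have "AE t in lborel. b (x - \<gamma> t) * f (x - \<gamma> t) = b' (x - \<gamma> t) * f (x - \<gamma> t)"
        using elim(2) by eventually_elim simp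
      then have "curve_hilbert \<gamma> (\<lambda>y. b y * f y) x = curve_hilbert \<gamma> (\<lambda>y. b' y * f y) x"
        by (rule curve_hilbert_cong_AE)
      then show ?case using elim(1) by (simp add: curve_commutator_def)
    qed
    then have ae': "AE x in lborel. ennreal (norm (curve_commutator \<gamma> b f x) powr p) = ennreal (norm (curve_commutator \<gamma> b' f x) powr p)"
      by eventually_elim simp
    have "(\<integral>\<^sup>+ x. ennreal (norm (curve_commutator \<gamma> b f x) powr p) \<partial>lebesgue) = (\<integral>\<^sup>+ x. ennreal (norm (curve_commutator \<gamma> b' f x) powr p) \<partial>lebesgue)"
      by (rule nn_integral_cong_AE[OF AE_completion[OF ae']])
    then show ?thesis by (simp add: Lp_norm_def)
  qed
  then show ?thesis unfolding commutator_norm_def by simp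
qed

lemma mean_oscillation_cong_AE:
  assumes ae: "AE x in lborel. b x = b' x"
  shows "mean_oscillation Q b = mean_oscillation Q b'"
proof -
  have "(LINT x:Q|lebesgue. b x) = (LINT x:Q|lebesgue. b' x)"
    unfolding set_lebesgue_integral_def
    by (rule integral_lebesgue_cong_AE) (use ae in \<open>eventually_elim, simp\<close>)
  then have av: "average Q b = average Q b'" by (simp add: average_def)
  have ae': "AE x in lborel. ennreal (norm (b x - average Q b')) * indicator Q x = ennreal (norm (b' x - average Q b')) * indicator Q x"
    using ae by eventually_elim simp
  show ?thesis unfolding mean_oscillation_def av
    using nn_integral_cong_AE[OF AE_completion[OF ae']] by simp
qed

text \<open>
Only parameters in \<open>[-1, 1]\<close> enter the transform. The curve may thus be extended continuously
by constants.
\<close>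

lemma curve_hilbert_clamp:
  assumes "\<And>t. \<bar>t\<bar> \<le> 1 \<Longrightarrow> \<gamma> t = \<gamma>1 t"
  shows "curve_hilbert \<gamma> f x = curve_hilbert \<gamma>1 f x"
proof -
  have "(LINT t:{t. \<epsilon> < \<bar>t\<bar> \<and> \<bar>t\<bar> \<le> 1}|lebesgue. f (x - \<gamma> t) / complex_of_real t)
     = (LINT t:{t. \<epsilon> < \<bar>t\<bar> \<and> \<bar>t\<bar> \<le> 1}|lebesgue. f (x - \<gamma>1 t) / complex_of_real t)" for \<epsilon>
    unfolding set_lebesgue_integral_def
    by (intro Bochner_Integration.integral_cong) (use assms in \<open>auto simp: indicator_def\<close>)
  then show ?thesis unfolding curve_hilbert_def by simp
qed

lemma locally_integrable_borel_version:
  assumes b: "locally_integrable b"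
  obtains b' where "b' \<in> borel_measurable borel" "AE x in lborel. b x = b' x"
    "\<And>K. compact K \<Longrightarrow> set_integrable lborel K b'"
proof -
  have iK: "integrable lebesgue (\<lambda>x. indicator K x *\<^sub>R b x)" if "compact K" for K
    using b that unfolding locally_integrable_def set_integrable_def by simp
  have K: "(\<lambda>x. indicator K x *\<^sub>R b x) \<in> borel_measurable lebesgue" if "compact K" for K
    using iK[OF that] by (rule borel_measurable_integrable)
  have bm: "b \<in> borel_measurable lebesgue"
  proof (rule borel_measurable_LIMSEQ_metric)
    show "(\<lambda>x. indicator (cball 0 (real n)) x *\<^sub>R b x) \<in> borel_measurable lebesgue" for n by (rule K) simp
    fix x :: "real^2"
    obtain n0 where n0: "norm x \<le> real n0" using real_arch_simple by blast
    have "\<forall>\<^sub>F n in sequentially. indicator (cball 0 (real n)) x *\<^sub>R b x = b x"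
      using eventually_ge_at_top[of n0] by eventually_elim (use n0 in \<open>auto simp: indicator_def\<close>)
    then show "(\<lambda>n. indicator (cball 0 (real n)) x *\<^sub>R b x) \<longlonglongrightarrow> b x" by (rule tendsto_eventually)
  qed
  have "(\<lambda>x. Re (b x)) \<in> borel_measurable lebesgue" "(\<lambda>x. Im (b x)) \<in> borel_measurable lebesgue"
    using bm by measurable
  from this[THEN completion_ex_borel_measurable_real] obtain u v where
    u: "u \<in> borel_measurable lborel" "AE x in lborel. Re (b x) = u x" and
    v: "v \<in> borel_measurable lborel" "AE x in lborel. Im (b x) = v x" by blast
  define b' where "b' x = complex_of_real (u x) + \<i> * complex_of_real (v x)" for x
  have m: "b' \<in> borel_measurable borel" using u(1) v(1) unfolding b'_def[abs_def] by simp
  have ae: "AE x in lborel. b x = b' x"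
    using u(2) v(2) by eventually_elim (simp add: b'_def complex_eq_iff)
  have "set_integrable lborel K b'" if "compact K" for K
  proof -
    have [measurable]: "K \<in> sets borel" using that by (rule borel_compact)
    have mb: "(\<lambda>x. indicator K x *\<^sub>R b' x) \<in> borel_measurable lborel" using m by measurable
    have "AE x in lborel. indicator K x *\<^sub>R b x = indicator K x *\<^sub>R b' x" using ae by eventually_elim simp
    from AE_completion[OF this] have "integrable lebesgue (\<lambda>x. indicator K x *\<^sub>R b' x)"
      using integrable_cong_AE[OF K[OF that] measurable_completion[OF mb]] iK[OF that] by simp
    then show ?thesis unfolding set_integrable_def using integrable_completion[OF mb] by blast
  qed
  with m ae show ?thesis by (rule that)
qed

text \<open>
The sets decrease to the empty set as \<open>\<rho>\<close> tends to 0, because \<open>\<gamma> t\<close> is required to be nonzero.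
\<close>

lemma far_returns_vanish:
  fixes \<gamma> :: "real \<Rightarrow> real^2"
  assumes \<gamma> [measurable]: "\<gamma> \<in> borel_measurable borel" and \<eta>: "0 < \<eta>"
  obtains \<rho> where "0 < \<rho>" "measure lborel (far_returns \<gamma> r \<rho>) < \<eta>"
proof -
  define A where "A n = {t. r < \<bar>t\<bar> \<and> \<bar>t\<bar> \<le> 1 \<and> 0 < norm (\<gamma> t) \<and> norm (\<gamma> t) \<le> 1 / real (Suc n)}" for n
  have Am: "A n \<in> sets lborel" for n unfolding A_def by measurable
  have "A n \<subseteq> {-1..1}" for n by (auto simp: A_def)
  then have fin: "emeasure lborel (A n) \<noteq> \<infinity>" for n
    using emeasure_bounded_finite[OF bounded_subset[OF bounded_closed_interval]] by (metis infinity_ennreal_def less_irrefl)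
  have dec: "decseq A"
  proof (rule decseq_SucI, rule subsetI)
    fix n t assume "t \<in> A (Suc n)"
    moreover have "1 / real (Suc (Suc n)) \<le> 1 / real (Suc n)" by (simp add: frac_le)
    ultimately show "t \<in> A n" unfolding A_def by (auto intro: order_trans)
  qed
  have empty: "(\<Inter>n. A n) = {}"
  proof (rule ccontr)
    assume "(\<Inter>n. A n) \<noteq> {}"
    then obtain t where t: "\<And>n. t \<in> A n" by auto
    then have "0 < norm (\<gamma> t)" by (auto simp: A_def)
    then obtain n where "1 / real (Suc n) < norm (\<gamma> t)" using nat_approx_posE by (metis inverse_eq_divide)
    then show False using t[of n] by (auto simp: A_def)
  qed
  have "(\<lambda>n. measure lborel (A n)) \<longlonglongrightarrow> measure lborel (\<Inter>n. A n)"
    using Am fin dec by (intro Lim_measure_decseq) auto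
  then have "\<forall>\<^sub>F n in sequentially. measure lborel (A n) < \<eta>"
    unfolding empty by (intro order_tendstoD) (use \<eta> in auto)
  then obtain n where "measure lborel (A n) < \<eta>" by (auto simp: eventually_sequentially)
  then show ?thesis by (intro that[of "1 / real (Suc n)"]) (auto simp: A_def)
qed

text \<open>
The term \<open>(a \<bullet> e1) t\<^sup>2 / 2\<close> in the direction of the velocity is negligible against \<open>\<alpha> t\<close>. In the direction
e2 the velocity has no component, so the quadratic term is the leading one there and the remainder is
small relative to it.
\<close>

lemma curve_near_parabola:
  fixes \<gamma> f' R :: "real \<Rightarrow> real^2" and e1 e2 v a :: "real^2"
  assumes e: "norm e1 = 1" "norm e2 = 1"
    and v: "v \<bullet> e1 = \<alpha>" "v \<bullet> e2 = 0" and a: "a \<bullet> e2 = 2 * \<beta>" and \<alpha>: "0 < \<alpha>" and \<beta>: "0 < \<beta>"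
    and \<gamma>: "\<And>t. t \<in> {-1<..<1} \<Longrightarrow> \<gamma> t = t *\<^sub>R v + t\<^sup>2 *\<^sub>R (a /\<^sub>R 2) + R t"
    and R0: "R 0 = 0" and R: "((\<lambda>t. norm (R t) / \<bar>t\<bar>\<^sup>2) \<longlongrightarrow> 0) (at 0)"
    and f': "(f' has_vector_derivative a) (at 0)" "f' 0 = v" and \<epsilon>: "0 < \<epsilon>"
  obtains r where "0 < r" "r < 1"
    "\<And>t. \<bar>t\<bar> \<le> r \<Longrightarrow> \<bar>\<gamma> t \<bullet> e1 - \<alpha> * t\<bar> \<le> \<epsilon> * (\<alpha> * \<bar>t\<bar>)"
    "\<And>t. \<bar>t\<bar> \<le> r \<Longrightarrow> \<bar>\<gamma> t \<bullet> e2 - \<beta> * t\<^sup>2\<bar> \<le> \<epsilon> * (\<beta> * t\<^sup>2)"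
    "\<And>t. \<bar>t\<bar> \<le> r \<Longrightarrow> \<bar>f' t \<bullet> e1 - \<alpha>\<bar> \<le> \<epsilon> * \<alpha>"
    "\<And>t. \<bar>t\<bar> \<le> r \<Longrightarrow> \<bar>f' t \<bullet> e2 - 2 * \<beta> * t\<bar> \<le> \<epsilon> * (2 * \<beta> * \<bar>t\<bar>)"
proof -
  have ip: "\<bar>u \<bullet> e1\<bar> \<le> norm u" "\<bar>u \<bullet> e2\<bar> \<le> norm u" for u
    using Cauchy_Schwarz_ineq2[of u e1] Cauchy_Schwarz_ineq2[of u e2] e by auto
  define \<eta> where "\<eta> = min 1 (\<epsilon> * \<beta>)"
  have \<eta>: "0 < \<eta>" "\<eta> \<le> 1" "\<eta> \<le> \<epsilon> * \<beta>" using \<epsilon> \<beta> by (auto simp: \<eta>_def)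
  have "\<forall>\<^sub>F t in at 0. norm (R t) / \<bar>t\<bar>\<^sup>2 < \<eta>" using R \<eta>(1) by (rule order_tendstoD)
  then obtain d1 where d1: "0 < d1" "\<And>t. t \<noteq> 0 \<Longrightarrow> \<bar>t\<bar> < d1 \<Longrightarrow> norm (R t) / \<bar>t\<bar>\<^sup>2 < \<eta>"
    unfolding eventually_at by (auto simp: dist_norm)
  have Rb: "norm (R t) \<le> \<eta> * t\<^sup>2" if "\<bar>t\<bar> < d1" for t
  proof (cases "t = 0")
    case False
    then show ?thesis using d1(2)[OF False that] by (simp add: divide_less_eq)
  qed (simp add: R0)
  have "(f' has_derivative (\<lambda>h. h *\<^sub>R a)) (at 0)" using f'(1) unfolding has_vector_derivative_def .
  then have "\<exists>d>0. \<forall>y. norm (y - 0) < d \<longrightarrow> norm (f' y - f' 0 - (y - 0) *\<^sub>R a) \<le> \<eta> * norm (y - 0)"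
    unfolding has_derivative_at_alt using \<eta>(1) by blast
  then obtain d2 where d2: "0 < d2" "\<And>t. \<bar>t\<bar> < d2 \<Longrightarrow> norm (f' t - v - t *\<^sub>R a) \<le> \<eta> * \<bar>t\<bar>"
    unfolding f'(2) by auto
  define k where "k = \<bar>a \<bullet> e1\<bar> + 1"
  have k: "0 < k" by (simp add: k_def)
  define r where "r = Min {1 / 2, d1 / 2, d2 / 2, \<epsilon> * \<alpha> / k}"
  have r: "0 < r" "r \<le> 1 / 2" "r \<le> d1 / 2" "r \<le> d2 / 2" "r \<le> \<epsilon> * \<alpha> / k"
    using d1(1) d2(1) k \<epsilon> \<alpha> by (simp add: r_def) (unfold r_def, (rule Min_le; simp)+)
  have rk: "\<bar>t\<bar> * k \<le> \<epsilon> * \<alpha>" if "\<bar>t\<bar> \<le> r" for t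
    using that r(5) k by (simp add: le_divide_eq) (meson mult_right_mono less_imp_le order_trans)
  show ?thesis
  proof (rule that[of r])
    show "0 < r" "r < 1" using r by auto
    fix t assume t: "\<bar>t\<bar> \<le> r"
    have ti: "t \<in> {-1<..<1}" and td1: "\<bar>t\<bar> < d1" and td2: "\<bar>t\<bar> < d2" using t r d1 d2 by auto
    have t2: "t\<^sup>2 = \<bar>t\<bar> * \<bar>t\<bar>" by (simp add: power2_eq_square)
    have g1: "\<gamma> t \<bullet> e1 - \<alpha> * t = t\<^sup>2 * (a \<bullet> e1 / 2) + R t \<bullet> e1"
      unfolding \<gamma>[OF ti] by (simp add: inner_add_left v)
    have "\<bar>t\<^sup>2 * (a \<bullet> e1 / 2)\<bar> = t\<^sup>2 * (\<bar>a \<bullet> e1\<bar> / 2)" by (simp add: abs_mult)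
    then have "\<bar>\<gamma> t \<bullet> e1 - \<alpha> * t\<bar> \<le> t\<^sup>2 * (\<bar>a \<bullet> e1\<bar> / 2) + \<eta> * t\<^sup>2"
      unfolding g1 using ip(1)[of "R t"] Rb[OF td1] by linarith
    also have "\<dots> \<le> t\<^sup>2 * (\<bar>a \<bullet> e1\<bar> / 2) + 1 * t\<^sup>2" using \<eta> by (intro add_left_mono mult_right_mono) auto
    also have "\<dots> = t\<^sup>2 * (\<bar>a \<bullet> e1\<bar> / 2 + 1)" by (simp add: algebra_simps)
    also have "\<dots> \<le> t\<^sup>2 * k" unfolding k_def by (intro mult_left_mono) auto
    also have "\<dots> = \<bar>t\<bar> * (\<bar>t\<bar> * k)" unfolding t2 by simp
    also have "\<dots> \<le> \<bar>t\<bar> * (\<epsilon> * \<alpha>)" using rk[OF t] by (rule mult_left_mono) simp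
    finally show "\<bar>\<gamma> t \<bullet> e1 - \<alpha> * t\<bar> \<le> \<epsilon> * (\<alpha> * \<bar>t\<bar>)" by (simp add: ac_simps)
    have g2: "\<gamma> t \<bullet> e2 - \<beta> * t\<^sup>2 = R t \<bullet> e2"
      unfolding \<gamma>[OF ti] by (simp add: inner_add_left v a)
    have "\<bar>R t \<bullet> e2\<bar> \<le> \<eta> * t\<^sup>2" using ip(2)[of "R t"] Rb[OF td1] by linarith
    also have "\<dots> \<le> (\<epsilon> * \<beta>) * t\<^sup>2" using \<eta> by (intro mult_right_mono) auto
    finally show "\<bar>\<gamma> t \<bullet> e2 - \<beta> * t\<^sup>2\<bar> \<le> \<epsilon> * (\<beta> * t\<^sup>2)" unfolding g2 by (simp add: mult.assoc)
    have h1: "f' t \<bullet> e1 - \<alpha> = t * (a \<bullet> e1) + (f' t - v - t *\<^sub>R a) \<bullet> e1" by (simp add: inner_diff_left v)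
    have "\<bar>t * (a \<bullet> e1)\<bar> = \<bar>t\<bar> * \<bar>a \<bullet> e1\<bar>" by (simp add: abs_mult)
    then have "\<bar>f' t \<bullet> e1 - \<alpha>\<bar> \<le> \<bar>t\<bar> * \<bar>a \<bullet> e1\<bar> + \<eta> * \<bar>t\<bar>"
      unfolding h1 using ip(1)[of "f' t - v - t *\<^sub>R a"] d2(2)[OF td2] by linarith
    also have "\<dots> \<le> \<bar>t\<bar> * \<bar>a \<bullet> e1\<bar> + 1 * \<bar>t\<bar>" using \<eta> by (intro add_left_mono mult_right_mono) auto
    also have "\<dots> = \<bar>t\<bar> * k" by (simp add: k_def algebra_simps)
    finally show "\<bar>f' t \<bullet> e1 - \<alpha>\<bar> \<le> \<epsilon> * \<alpha>" using rk[OF t] by linarith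
    have h2: "f' t \<bullet> e2 - 2 * \<beta> * t = (f' t - v - t *\<^sub>R a) \<bullet> e2" by (simp add: inner_diff_left v a)
    have "\<bar>(f' t - v - t *\<^sub>R a) \<bullet> e2\<bar> \<le> \<eta> * \<bar>t\<bar>" using ip(2)[of "f' t - v - t *\<^sub>R a"] d2(2)[OF td2] by linarith
    also have "\<dots> \<le> (\<epsilon> * \<beta>) * \<bar>t\<bar>" using \<eta> by (intro mult_right_mono) auto
    also have "\<dots> \<le> \<epsilon> * (2 * \<beta> * \<bar>t\<bar>)" using \<epsilon> \<beta> by simp
    finally show "\<bar>f' t \<bullet> e2 - 2 * \<beta> * t\<bar> \<le> \<epsilon> * (2 * \<beta> * \<bar>t\<bar>)" unfolding h2 .
  qed
qed

section \<open>The lower bound for the commutator norm\<close>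

text \<open>
Linear independence enters here: it makes the normal component of the acceleration nonzero.
\<close>

lemma curve_frame:
  assumes ne: "velocity \<gamma> \<noteq> acceleration \<gamma>" and ind: "independent {velocity \<gamma>, acceleration \<gamma>}"
  shows "orthonormal_frame (frame1 \<gamma>) (frame2 \<gamma>)"
    "velocity \<gamma> \<bullet> frame1 \<gamma> = norm (velocity \<gamma>)" "velocity \<gamma> \<bullet> frame2 \<gamma> = 0"
    "0 < norm (velocity \<gamma>)" "0 < acceleration \<gamma> \<bullet> frame2 \<gamma>"
proof -
  define v where "v = velocity \<gamma>"
  define a where "a = acceleration \<gamma>"
  define w where "w = a /\<^sub>R 2 - ((a /\<^sub>R 2) \<bullet> frame1 \<gamma>) *\<^sub>R frame1 \<gamma>"
  have v0: "v \<noteq> 0" using ind dependent_zero[of "{v, a}"] unfolding v_def a_def by auto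
  then show nv: "0 < norm (velocity \<gamma>)" by (simp add: v_def)
  have e1: "frame1 \<gamma> = v /\<^sub>R norm v" by (simp add: frame1_def v_def)
  have e2: "frame2 \<gamma> = inverse (norm w) *\<^sub>R w" unfolding frame2_def w_def a_def Let_def ..
  have e11: "frame1 \<gamma> \<bullet> frame1 \<gamma> = 1" unfolding e1 using v0 by (simp add: dot_square_norm power2_eq_square)
  have w1: "w \<bullet> frame1 \<gamma> = 0" by (simp add: w_def inner_diff_left e11)
  have w0: "w \<noteq> 0"
  proof
    assume "w = 0"
    define k where "k = (a /\<^sub>R 2) \<bullet> frame1 \<gamma>"
    have "a /\<^sub>R 2 = k *\<^sub>R frame1 \<gamma>" using \<open>w = 0\<close> unfolding w_def k_def[symmetric] by (rule right_minus_eq[THEN iffD1])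
    then have "2 *\<^sub>R (a /\<^sub>R 2) = (2 * k * inverse (norm v)) *\<^sub>R v" unfolding e1 by simp
    also have "\<dots> \<in> span {v}" by (intro span_scale span_base) simp
    finally have "2 *\<^sub>R (a /\<^sub>R 2) \<in> span {v}" .
    then have "a \<in> span ({v, a} - {a})" using ne by (simp add: v_def a_def insert_Diff_if)
    then show False using ind unfolding dependent_def v_def a_def by blast
  qed
  show "velocity \<gamma> \<bullet> frame1 \<gamma> = norm (velocity \<gamma>)"
    unfolding e1 v_def[symmetric] using v0 by (simp add: dot_square_norm power2_eq_square)
  have e12: "frame1 \<gamma> \<bullet> frame2 \<gamma> = 0" unfolding e2 using w1 by (simp add: inner_commute)
  have "v = norm v *\<^sub>R frame1 \<gamma>" unfolding e1 using v0 by simp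
  then show "velocity \<gamma> \<bullet> frame2 \<gamma> = 0" using e12 unfolding v_def by (metis inner_scaleR_left mult_zero_right)
  have e22: "frame2 \<gamma> \<bullet> frame2 \<gamma> = 1" unfolding e2 using w0 by (simp add: dot_square_norm power2_eq_square)
  show "orthonormal_frame (frame1 \<gamma>) (frame2 \<gamma>)" by unfold_locales (use e11 e22 e12 in auto)
  have "a = 2 *\<^sub>R w + (a \<bullet> frame1 \<gamma>) *\<^sub>R frame1 \<gamma>" by (simp add: w_def scaleR_diff_right)
  then have "a \<bullet> frame2 \<gamma> = 2 * (w \<bullet> frame2 \<gamma>)" using e12 by (metis add.right_neutral inner_add_left inner_scaleR_left mult_zero_right)
  also have "w \<bullet> frame2 \<gamma> = norm w" unfolding e2 using w0 by (simp add: dot_square_norm power2_eq_square)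
  finally show "0 < acceleration \<gamma> \<bullet> frame2 \<gamma>" using w0 by (simp add: a_def)
qed

context near_parabola_symbol
begin

lemma mean_oscillation_le_commutator_norm:
  assumes p: "1 < p" and N: "0 < N" "commutator_norm \<gamma> p b < ennreal N"
    and l0: "0 < l0" "(c2 + 1) * l0 \<le> \<alpha> * r / 2" "dil * l0 \<le> 1"
    and \<rho>: "(c2 + 1) * l0 + (H + \<Lambda> + 2) * l0\<^sup>2 \<le> \<rho>"
    and E: "measure lborel (far_returns \<gamma> r \<rho>) / r \<le> \<epsilon>"
    and gain: "gain * \<epsilon> \<le> 1 / 2" and m: "1 / (dil * l0)\<^sup>2 \<le> (3 / 2) ^ m"
    and M: "0 \<le> M" "\<And>a l. 0 < l \<Longrightarrow> l \<le> 1 \<Longrightarrow> mean_oscillation (frame_box a l (l\<^sup>2)) b \<le> ennreal M"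
    and l: "0 < l" "l \<le> 1"
  shows "mean_oscillation (frame_box a l (l\<^sup>2)) b \<le> ennreal (4 * 36 ^ m * 36 ^ enlargements * main_const * dil ^ 3 * N)"
proof -
  let ?B = "36 ^ enlargements * main_const * dil ^ 3 * N"
  let ?X = "\<lambda>n::nat. 2 * (36 ^ m * (2 * ?B + M / 2 ^ n))"
  have B0: "0 \<le> ?B" using main_const_pos dil_ge N by simp
  have "mean_oscillation (frame_box a l (l\<^sup>2)) b \<le> ennreal (?X n)" for n
  proof (rule mean_oscillation_le[OF _ l(1)])
    show "osc_le b l (l\<^sup>2) (36 ^ m * (2 * ?B + M / 2 ^ n))"
      by (rule osc_le_a_priori_removed[OF p N l0 \<rho> E gain m M(1) _ l])
        (rule osc_le_of_mean_oscillation[OF M(2) _ M(1)])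
    show "0 \<le> 36 ^ m * (2 * ?B + M / 2 ^ n)" using B0 M(1) by simp
  qed
  moreover have "(\<lambda>n. ennreal (?X n)) \<longlonglongrightarrow> ennreal (2 * (36 ^ m * (2 * ?B + 0)))"
  proof -
    have "(\<lambda>n. M * (1 / 2) ^ n) \<longlonglongrightarrow> M * 0"
      by (rule tendsto_mult[OF tendsto_const LIMSEQ_power_zero]) simp
    then have Z: "(\<lambda>n. M / 2 ^ n) \<longlonglongrightarrow> 0" by (simp add: power_one_over)
    show ?thesis
      by (rule tendsto_ennrealI[OF tendsto_mult[OF tendsto_const tendsto_mult[OF tendsto_const tendsto_add[OF tendsto_const Z]]]])
  qed
  ultimately have "mean_oscillation (frame_box a l (l\<^sup>2)) b \<le> ennreal (2 * (36 ^ m * (2 * ?B + 0)))"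
    using LIMSEQ_le_const by blast
  also have "2 * (36 ^ m * (2 * ?B + 0)) = 4 * 36 ^ m * 36 ^ enlargements * main_const * dil ^ 3 * N" by simp
  finally show ?thesis .
qed

end

lemma ennreal_le_of_le_all_greater:
  fixes x y :: ennreal
  assumes C: "0 < C" and y: "y < \<infinity>" and le: "\<And>N. 0 < N \<Longrightarrow> y < ennreal N \<Longrightarrow> x \<le> ennreal (C * N)"
  shows "x \<le> ennreal C * y"
proof -
  obtain k where k: "y = ennreal k" "0 \<le> k" using y less_top_ennreal by auto
  have "x \<le> ennreal (C * (k + inverse (real (Suc n))))" for n
    by (rule le) (use k in \<open>auto simp: ennreal_less_iff add_nonneg_pos\<close>)
  moreover have "(\<lambda>n. ennreal (C * (k + inverse (real (Suc n))))) \<longlonglongrightarrow> ennreal (C * (k + 0))"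
    by (rule tendsto_ennrealI[OF tendsto_mult[OF tendsto_const tendsto_add[OF tendsto_const LIMSEQ_inverse_real_of_nat]]])
  ultimately have "x \<le> ennreal (C * (k + 0))" using LIMSEQ_le_const by blast
  then show ?thesis using C k by (simp add: ennreal_mult)
qed

theorem theorem4p5:
  fixes \<gamma> :: "real \<Rightarrow> real^2" and p :: real
  assumes "C2_on {-1..1} \<gamma>"
    and "velocity \<gamma> \<noteq> acceleration \<gamma>"
    and "independent {velocity \<gamma>, acceleration \<gamma>}"
    and "\<exists>R :: real \<Rightarrow> real^2.
           C2_on {-1<..<1} R \<and>
           (\<forall>t\<in>{-1<..<1}. \<gamma> t = t *\<^sub>R velocity \<gamma> + t\<^sup>2 *\<^sub>R (acceleration \<gamma> /\<^sub>R 2) + R t) \<and>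
           ((\<lambda>t. norm (R t) / \<bar>t\<bar>\<^sup>2) \<longlongrightarrow> 0) (at 0)"
    and "1 < p"
  shows "\<exists>C::real. 0 \<le> C \<and>
           (\<forall>b :: real^2 \<Rightarrow> complex.
              locally_integrable b \<longrightarrow>
              commutator_norm \<gamma> p b < \<infinity> \<longrightarrow>
              BMO_norm \<gamma> b < \<infinity> \<longrightarrow>
              BMO_norm \<gamma> b \<le> ennreal C * commutator_norm \<gamma> p b)"
proof -
  note p = \<open>1 < p\<close>
  define v where "v = velocity \<gamma>"
  define a where "a = acceleration \<gamma>"
  define e1 where "e1 = frame1 \<gamma>"
  define e2 where "e2 = frame2 \<gamma>"
  define \<alpha> where "\<alpha> = norm v"
  define \<beta> where "\<beta> = (a \<bullet> e2) / 2"
  note fr = curve_frame[OF assms(2,3), folded v_def a_def e1_def e2_def]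
  interpret of: orthonormal_frame e1 e2 by (rule fr(1))
  have \<alpha>: "0 < \<alpha>" and \<beta>: "0 < \<beta>" using fr by (auto simp: \<alpha>_def \<beta>_def)
  obtain f' f'' where f': "\<And>t. t \<in> {-1..1} \<Longrightarrow> (\<gamma> has_vector_derivative f' t) (at t within {-1..1})"
    and f'': "\<And>t. t \<in> {-1..1} \<Longrightarrow> (f' has_vector_derivative f'' t) (at t within {-1..1})"
    using assms(1) unfolding C2_on_def by blast
  have f'i: "(\<gamma> has_vector_derivative f' t) (at t)" "(f' has_vector_derivative f'' t) (at t)" if "- 1 < t" "t < 1" for t
    using f'[of t] f''[of t] that by (auto simp: at_within_Icc_at)
  have v: "f' 0 = v" unfolding v_def velocity_def using f'i(1)[of 0] by (simp add: vector_derivative_at)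
  have a: "f'' 0 = a"
  proof -
    have "((\<lambda>t. vector_derivative \<gamma> (at t)) has_vector_derivative f'' 0) (at 0)"
      by (rule has_vector_derivative_transform_within_open[OF f'i(2)[of 0], of "{-1<..<1}"])
        (auto intro!: vector_derivative_at[symmetric] f'i(1))
    then show ?thesis unfolding a_def acceleration_def by (simp add: vector_derivative_at)
  qed
  \<comment> \<open>Continuous extension of the curve and its velocity, so that they are Borel on the whole line.\<close>
  define clamp1 where "clamp1 t = max (- 1) (min 1 t)" for t :: real
  define \<gamma>1 where "\<gamma>1 t = \<gamma> (clamp1 t)" for t
  define f1 where "f1 t = f' (clamp1 t)" for t
  have cl: "clamp1 t = t" if "\<bar>t\<bar> \<le> 1" for t using that by (auto simp: clamp1_def)
  have clr: "clamp1 t \<in> {-1..1}" for t by (auto simp: clamp1_def)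
  have ccl: "continuous_on UNIV clamp1" unfolding clamp1_def[abs_def] by (intro continuous_intros)
  have "continuous_on {-1..1} \<gamma>" "continuous_on {-1..1} f'"
    by (rule continuous_on_vector_derivative[OF f'], simp) (rule continuous_on_vector_derivative[OF f''], simp)
  then have c1: "continuous_on UNIV \<gamma>1" and c2: "continuous_on UNIV f1"
    unfolding \<gamma>1_def[abs_def] f1_def[abs_def] using clr by (auto intro!: continuous_on_compose2[OF _ ccl])
  have \<gamma>1_meas: "\<gamma>1 \<in> borel_measurable borel" using c1 by (rule borel_measurable_continuous_onI)
  have hil: "curve_hilbert \<gamma> f x = curve_hilbert \<gamma>1 f x" for f x
    by (rule curve_hilbert_clamp) (simp add: \<gamma>1_def cl)
  have comm: "commutator_norm \<gamma> p b = commutator_norm \<gamma>1 p b" for b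
    unfolding commutator_norm_def curve_commutator_def hil ..
  obtain R where R: "C2_on {-1<..<1} R" "\<And>t. t \<in> {-1<..<1} \<Longrightarrow> \<gamma> t = t *\<^sub>R v + t\<^sup>2 *\<^sub>R (a /\<^sub>R 2) + R t"
    "((\<lambda>t. norm (R t) / \<bar>t\<bar>\<^sup>2) \<longlongrightarrow> 0) (at 0)"
    using assms(4) unfolding v_def a_def by blast
  have R0: "R 0 = 0"
  proof -
    obtain R' where R': "\<And>t. t \<in> {-1<..<1} \<Longrightarrow> (R has_vector_derivative R' t) (at t within {-1<..<1})"
      using R(1) unfolding C2_on_def by blast
    have "continuous_on {-1<..<1} R" by (rule continuous_on_vector_derivative[OF R'])
    then have "isCont R 0" by (simp add: continuous_on_eq_continuous_at)
    then have 1: "((\<lambda>t. norm (R t)) \<longlongrightarrow> norm (R 0)) (at 0)" by (intro tendsto_norm) (simp add: isCont_def)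
    have "((\<lambda>t. norm (R t) / \<bar>t\<bar>\<^sup>2 * \<bar>t\<bar>\<^sup>2) \<longlongrightarrow> 0 * \<bar>0\<bar>\<^sup>2) (at 0)"
      by (intro tendsto_intros R(3))
    moreover have "\<forall>\<^sub>F t in at 0. norm (R t) / \<bar>t\<bar>\<^sup>2 * \<bar>t\<bar>\<^sup>2 = norm (R t)"
      by (simp add: eventually_at_filter)
    ultimately have "((\<lambda>t. norm (R t)) \<longlongrightarrow> 0) (at 0)" by (simp add: tendsto_cong)
    with 1 have "norm (R 0) = 0" by (rule tendsto_unique[rotated]) simp
    then show ?thesis by simp
  qed
  \<comment> \<open>The gain depends only on \<open>\<alpha>\<close> and \<open>\<beta>\<close>, so the accuracy can be fixed before the arc \<open>[-r, r]\<close>.\<close>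
  define \<epsilon> where "\<epsilon> = min (1 / 10) (1 / (2 * max 1 (near_parabola.gain \<alpha> \<beta>)))"
  have \<epsilon>: "0 < \<epsilon>" "\<epsilon> \<le> 1 / 10" by (auto simp: \<epsilon>_def)
  have gain: "near_parabola.gain \<alpha> \<beta> * \<epsilon> \<le> 1 / 2"
  proof -
    let ?g = "near_parabola.gain \<alpha> \<beta>"
    have "?g * \<epsilon> \<le> max 1 ?g * \<epsilon>" using \<epsilon> by (intro mult_right_mono) auto
    also have "\<dots> \<le> max 1 ?g * (1 / (2 * max 1 ?g))" by (intro mult_left_mono) (auto simp: \<epsilon>_def)
    also have "\<dots> = 1 / 2" by simp
    finally show ?thesis .
  qed
  have ne: "norm e1 = 1" "norm e2 = 1" using of.e11 of.e22 by (auto simp: norm_eq_sqrt_inner)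
  have f0: "(f' has_vector_derivative a) (at 0)" using f'i(2)[of 0] a by simp
  obtain r where r: "0 < r" "r < 1"
    and nr: "\<And>t. \<bar>t\<bar> \<le> r \<Longrightarrow> \<bar>\<gamma> t \<bullet> e1 - \<alpha> * t\<bar> \<le> \<epsilon> * (\<alpha> * \<bar>t\<bar>)"
    "\<And>t. \<bar>t\<bar> \<le> r \<Longrightarrow> \<bar>\<gamma> t \<bullet> e2 - \<beta> * t\<^sup>2\<bar> \<le> \<epsilon> * (\<beta> * t\<^sup>2)"
    "\<And>t. \<bar>t\<bar> \<le> r \<Longrightarrow> \<bar>f' t \<bullet> e1 - \<alpha>\<bar> \<le> \<epsilon> * \<alpha>"
    "\<And>t. \<bar>t\<bar> \<le> r \<Longrightarrow> \<bar>f' t \<bullet> e2 - 2 * \<beta> * t\<bar> \<le> \<epsilon> * (2 * \<beta> * \<bar>t\<bar>)"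
    by (rule curve_near_parabola[OF ne _ _ _ \<alpha> \<beta> R(2) R0 R(3) f0 v \<epsilon>(1)])
      (use fr in \<open>auto simp: \<alpha>_def \<beta>_def\<close>)
  interpret np: near_parabola e1 e2 \<gamma>1 f1 \<alpha> \<beta> r \<epsilon>
  proof unfold_locales
    show "\<gamma>1 0 = 0" using R(2)[of 0] R0 by (simp add: \<gamma>1_def cl)
    show "f1 \<in> borel_measurable borel" using c2 by (rule borel_measurable_continuous_onI)
    fix t :: real assume t: "\<bar>t\<bar> \<le> r"
    then have c: "clamp1 t = t" and ti: "- 1 < t" "t < 1" using r by (auto simp: cl)
    show "(\<gamma>1 has_vector_derivative f1 t) (at t)"
      unfolding f1_def c
      by (rule has_vector_derivative_transform_within_open[OF f'i(1)[OF ti], of "{-1<..<1}"])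
        (use ti in \<open>auto simp: \<gamma>1_def cl\<close>)
    show "\<bar>\<gamma>1 t \<bullet> e1 - \<alpha> * t\<bar> \<le> \<epsilon> * (\<alpha> * \<bar>t\<bar>)" "\<bar>\<gamma>1 t \<bullet> e2 - \<beta> * t\<^sup>2\<bar> \<le> \<epsilon> * (\<beta> * t\<^sup>2)"
      "\<bar>f1 t \<bullet> e1 - \<alpha>\<bar> \<le> \<epsilon> * \<alpha>" "\<bar>f1 t \<bullet> e2 - 2 * \<beta> * t\<bar> \<le> \<epsilon> * (2 * \<beta> * \<bar>t\<bar>)"
      using nr[OF t] by (simp_all add: \<gamma>1_def f1_def c)
  qed (use c1 \<alpha> \<beta> r \<epsilon> in auto)
  \<comment> \<open>Only after r is known can the scale be taken so small that far returns are rare.\<close>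
  obtain \<rho> where \<rho>: "0 < \<rho>"
    "measure lborel (far_returns \<gamma>1 r \<rho>) < \<epsilon> * r"
    using far_returns_vanish[OF \<gamma>1_meas, of "\<epsilon> * r" r] r \<epsilon> by auto
  have E: "measure lborel (far_returns \<gamma>1 r \<rho>) / r \<le> \<epsilon>"
    using \<rho>(2) r by (simp add: divide_le_eq)
  let ?s = "(np.c2 + 1) + (np.H + np.\<Lambda> + 2)"
  have pos: "0 < np.c2 + 1" "0 < np.dil" "0 < ?s" "0 \<le> np.H + np.\<Lambda> + 2" "1 \<le> np.dil"
    using np.c2_ge np.dil_ge np.H_pos np.q_pos by (auto simp: np.\<Lambda>_def)
  define l0 where "l0 = min (1 / np.dil) (min (\<alpha> * r / 2 / (np.c2 + 1)) (\<rho> / ?s))"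
  have l0: "0 < l0" "l0 \<le> 1 / np.dil" "l0 \<le> \<alpha> * r / 2 / (np.c2 + 1)" "l0 \<le> \<rho> / ?s"
    using pos \<alpha> r \<rho> unfolding l0_def by (auto simp only: min_less_iff_conj min.cobounded1 intro!: divide_pos_pos mult_pos_pos min.coboundedI2)
  have cancel: "k * l0 \<le> u" if "0 < k" "l0 \<le> u / k" for k u
    using mult_left_mono[OF that(2), of k] that(1) by simp
  have l01: "(np.c2 + 1) * l0 \<le> \<alpha> * r / 2" "np.dil * l0 \<le> 1"
    by (rule cancel[OF pos(1) l0(3)], rule cancel[OF pos(2) l0(2)])
  have l02: "(np.c2 + 1) * l0 + (np.H + np.\<Lambda> + 2) * l0\<^sup>2 \<le> \<rho>"
  proof -
    have "l0 * np.dil \<le> 1" using l01(2) by (simp add: mult.commute)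
    moreover have "l0 * 1 \<le> l0 * np.dil" using l0(1) pos by (intro mult_left_mono) auto
    ultimately have "l0 \<le> 1" by linarith
    then have "l0\<^sup>2 \<le> l0" using l0(1) by (simp add: power2_eq_square mult_left_le)
    then have "(np.H + np.\<Lambda> + 2) * l0\<^sup>2 \<le> (np.H + np.\<Lambda> + 2) * l0" using pos by (intro mult_left_mono) auto
    moreover have "?s * l0 \<le> \<rho>" by (rule cancel[OF pos(3) l0(4)])
    ultimately show ?thesis by (simp add: algebra_simps)
  qed
  obtain m where m: "1 / (np.dil * l0)\<^sup>2 \<le> (3 / 2) ^ m"
    using real_arch_pow[of "3 / 2" "1 / (np.dil * l0)\<^sup>2"] by (auto intro: less_imp_le)
  define C where "C = 4 * 36 ^ m * 36 ^ np.enlargements * np.main_const * np.dil ^ 3"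
  have C: "0 < C" using np.main_const_pos pos by (simp add: C_def)
  have rect: "curve_rectangle \<gamma> x l = of.frame_box x l (l\<^sup>2)" for x l
    unfolding curve_rectangle_def of.frame_box_eq_image unfolding e1_def e2_def ..
  show ?thesis
  proof (intro exI conjI allI impI)
    show "0 \<le> C" using C by simp
    fix b :: "real^2 \<Rightarrow> complex"
    assume b: "locally_integrable b" and cn: "commutator_norm \<gamma> p b < \<infinity>" and bmo: "BMO_norm \<gamma> b < \<infinity>"
    obtain b' where b': "b' \<in> borel_measurable borel" "AE x in lborel. b x = b' x"
      "\<And>K. compact K \<Longrightarrow> set_integrable lborel K b'"
      using locally_integrable_borel_version[OF b] by metis
    interpret ns: near_parabola_symbol e1 e2 \<gamma>1 f1 \<alpha> \<beta> r \<epsilon> b'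
      by unfold_locales (use b' in auto)
    obtain M where M: "BMO_norm \<gamma> b = ennreal M" "0 \<le> M" using bmo less_top_ennreal by auto
    have osc: "mean_oscillation (of.frame_box x l (l\<^sup>2)) b' \<le> ennreal M" if "0 < l" "l \<le> 1" for x l
    proof -
      have "mean_oscillation (curve_rectangle \<gamma> x l) b \<le> BMO_norm \<gamma> b"
        unfolding BMO_norm_def by (rule SUP_upper) (use that in auto)
      then show ?thesis unfolding M(1) rect mean_oscillation_cong_AE[OF b'(2)] .
    qed
    show "BMO_norm \<gamma> b \<le> ennreal C * commutator_norm \<gamma> p b"
    proof (rule ennreal_le_of_le_all_greater[OF C cn])
      fix N assume N: "0 < N" "commutator_norm \<gamma> p b < ennreal N"
      have N': "commutator_norm \<gamma>1 p b' < ennreal N"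
        using N(2) unfolding comm commutator_norm_cong_AE[OF b'(2) \<gamma>1_meas] .
      show "BMO_norm \<gamma> b \<le> ennreal (C * N)"
        unfolding BMO_norm_def
      proof (rule SUP_least)
        fix Q assume "Q \<in> {curve_rectangle \<gamma> x l |x l. 0 < l \<and> l \<le> 1}"
        then obtain x l where Q: "Q = of.frame_box x l (l\<^sup>2)" and l: "0 < l" "l \<le> 1" unfolding rect by blast
        show "mean_oscillation Q b \<le> ennreal (C * N)"
          unfolding Q mean_oscillation_cong_AE[OF b'(2)] C_def
          by (rule ns.mean_oscillation_le_commutator_norm[OF p N(1) N' l0(1) l01 l02 E gain m M(2) osc l])
      qed
    qed
  qed
qed

end
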